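(* The natural action $\delta=(\mathrm{id}\otimes\pi)\Delta$ of the compact quantum subgroup $(C(G),\Delta_G)$ on the algebra $C^*_{red}(S)$ is non-ergodic and coincides with the representation $\tau\colon G\to\mathrm{Aut}\,C^*_{red}(S)$ (under the identification $C^*_{red}(S)\otimes C(G)=C(G,C^*_{red}(S))$, i.e. $\delta(A)(\alpha)=\tau(\alpha)(A)$). The left coset space of this action equals $\mathfrak{A}_0$. The compact quantum quotient space $(C^*_{red}(S),\Delta)/(C(G),\Delta_G)$ is a compact (classical) quantum semigroup $(\mathfrak{A}_0,\Delta|_{\mathfrak{A}_0})$.
   Context: $\Gamma$ is a discrete torsion-free abelian group written additively, $G$ is its compact dual group, and $\chi^a$ is the character of $G$ corresponding to $a\in\Gamma$. $S\subseteq\Gamma$ is a subsemigroup with $0\in S$ and $\Gamma=\{a-b : a,b\in S\}$. $\{e_a\}_{a\in S}$ is the canonical orthonormal basis of $\ell^2(S)$, and $T_a$ ($a\in S$) is the isometry $T_ae_b=e_{a+b}$. $C^*_{red}(S)\subseteq B(\ell^2(S))$ is the $C^*$-algebra generated by all $T_a,T_a^*$, $a\in S$. A monomial is a finite product of operators $T_a$ and $T_b^*$ ($a,b\in S$). For each monomial $V$ there are $a,b\in S$ with $T_c^*VT_c=T_a^*T_b$ for all sufficiently large $c\in S$ (in the natural quasi-order $a\prec b\iff b-a\in S$), and the index of $V$ is $\mathrm{ind}\,V=b-a\in\Gamma$. $\mathfrak{A}_0$ is the closed linear span of the monomials of index $0$; it is a commutative $C^*$-algebra. $\Delta\colon C^*_{red}(S)\to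 C^*_{red}(S)\otimes C^*_{red}(S)$ (minimal tensor product) is the continuous extension of the map $\sum_i\lambda_iV_i\mapsto\sum_i\lambda_iV_i\otimes V_i$ on finite linear combinations of monomials $V_i$. $\Delta_G(f)(\alpha,\beta)=f(\alpha\beta)$ on $C(G)$. $\pi\colon C^*_{red}(S)\to C(G)$ is the surjective $*$-homomorphism with $\pi(T_a)=\chi^a$, $a\in S$ (the quotient map by the commutator ideal). $\tau(\alpha)$, $\alpha\in G$, is the $*$-automorphism of $C^*_{red}(S)$ with $\tau(\alpha)(T_a)=\chi^a(\alpha)T_a$, $a\in S$. An action of $(\mathcal{A},\Delta)$ on a unital $C^*$-algebra $B$ is a unital $*$-homomorphism $\delta\colon B\to B\otimes\mathcal{A}$ with $(\delta\otimes\mathrm{id})\delta=(\mathrm{id}\otimes\Delta)\delta$; it is ergodic if the fixed point algebra $B^\delta=\{b\in B:\delta(b)=b\otimes I\}$ equals $\mathbb{C}$. If $(\mathcal{A}',\Delta')$ is a compact quantum subsemigroup of $(\mathcal{A},\Delta)$ via a $*$-epimorphism $\pi\colon\mathcal{A}\to\mathcal{A}'$ with $\Delta'\pi=(\pi\otimes\pi)\Delta$, its natural action on $\mathcal{A}$ is $\delta=(\mathrm{id}\otimes\pi)\Delta$; the fixed point algebra $\mathcal{A}^\delta$ is the (quantum) left coset space, and $\mathcal{A}^\delta$ together with $\Delta|_{\mathcal{A}^\delta}$ is the quantum left quotient space $(\mathcal{A},\Delta)/(\mathcal{A}',\Delta')$. Compact quantum semigroup: a pair $(\mathcal{A},\Delta)$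 with $\mathcal{A}$ a unital $C^*$-algebra and $\Delta\colon\mathcal{A}\to\mathcal{A}\otimes\mathcal{A}$ an injective unital $*$-homomorphism for which the product $(\xi\times\eta)(A)=(\xi\otimes\eta)(\Delta(A))$ on $\mathcal{A}^*$ is associative; it is classical if $\mathcal{A}$ is commutative.
   Formalization: Non-ergodicity is claimed only for S ≠ Γ: when S = Γ every T_a is unitary, the index-0 algebra is ℂI and the action is ergodic, so the unrestricted claim is false; all other assertions are proved for every S. *)

theory Defs
  imports "HOL-Analysis.Analysis"
begin

section \<open>Complex normed spaces and the Hilbert spaces of square-summable families\<close>

class complex_normed_vector = real_normed_vector +
  fixes scaleC :: "complex \<Rightarrow> 'a \<Rightarrow> 'a" (infixr "*\<^sub>C" 75)
  assumes scaleC_add_right: "c *\<^sub>C (x + y) = c *\<^sub>C x + c *\<^sub>C y"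
    and scaleC_add_left: "(c + d) *\<^sub>C x = c *\<^sub>C x + d *\<^sub>C x"
    and scaleC_scaleC: "c *\<^sub>C (d *\<^sub>C x) = (c * d) *\<^sub>C x"
    and scaleR_scaleC: "r *\<^sub>R x = complex_of_real r *\<^sub>C x"
    and norm_scaleC: "norm (c *\<^sub>C x) = cmod c * norm x"

definition cspan :: "'a::complex_normed_vector set \<Rightarrow> 'a set"
  where "cspan = module.span scaleC"

lemma vector_space_scaleC: "vector_space (scaleC :: complex \<Rightarrow> 'a \<Rightarrow> 'a::complex_normed_vector)"
proof
  show "1 *\<^sub>C x = x" for x :: 'a
    using scaleR_scaleC[of 1 x] by simp
qed (simp_all add: scaleC_add_right scaleC_add_left scaleC_scaleC)

lemma bounded_linear_scaleC_right:
  "bounded_linear (\<lambda>x :: 'a::complex_normed_vector. c *\<^sub>C x)"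
proof (rule bounded_linear_intro[where K = "cmod c"])
  show "c *\<^sub>C (r *\<^sub>R x) = r *\<^sub>R (c *\<^sub>C x)" for r and x :: 'a
    by (simp add: scaleR_scaleC scaleC_scaleC mult.commute)
qed (simp_all add: scaleC_add_right norm_scaleC mult.commute)

instantiation complex :: complex_normed_vector
begin
definition scaleC_complex :: "complex \<Rightarrow> complex \<Rightarrow> complex"
  where "scaleC_complex c x = c * x"
instance
  by standard (simp_all add: scaleC_complex_def algebra_simps norm_mult scaleR_conv_of_real)
end

instantiation blinfun :: (real_normed_vector, complex_normed_vector) complex_normed_vector
begin
lift_definition scaleC_blinfun :: "complex \<Rightarrow> 'a \<Rightarrow>\<^sub>L 'b \<Rightarrow> 'a \<Rightarrow>\<^sub>L 'b"
  is "\<lambda>c f x. c *\<^sub>C f x"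
  by (rule bounded_linear_compose[OF bounded_linear_scaleC_right])
instance
proof
  fix c d :: complex and r :: real and x y :: "'a \<Rightarrow>\<^sub>L 'b"
  show "c *\<^sub>C (x + y) = c *\<^sub>C x + c *\<^sub>C y" by transfer (simp add: scaleC_add_right)
  show "(c + d) *\<^sub>C x = c *\<^sub>C x + d *\<^sub>C x" by transfer (simp add: scaleC_add_left)
  show "c *\<^sub>C (d *\<^sub>C x) = (c * d) *\<^sub>C x" by transfer (simp add: scaleC_scaleC)
  show "r *\<^sub>R x = complex_of_real r *\<^sub>C x" by transfer (simp add: scaleR_scaleC)
  have le: "norm (c *\<^sub>C z) \<le> cmod c * norm z" for c and z :: "'a \<Rightarrow>\<^sub>L 'b"
    by (rule norm_blinfun_bound)
      (simp_all add: scaleC_blinfun.rep_eq norm_scaleC mult.assoc mult_left_mono norm_blinfun)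
  show "norm (c *\<^sub>C x) = cmod c * norm x"
  proof (cases "c = 0")
    case True
    have "norm (c *\<^sub>C x) \<le> 0" using le[of c x] True by simp
    then show ?thesis using True by simp
  next
    case False
    have "inverse c *\<^sub>C (c *\<^sub>C x) = x"
    proof -
      have "inverse c *\<^sub>C (c *\<^sub>C x) = 1 *\<^sub>C x"
        using False by transfer (simp add: scaleC_scaleC)
      also have "\<dots> = x"
        by transfer (simp add: scaleR_scaleC[of 1, simplified, symmetric])
      finally show ?thesis .
    qed
    then have "norm x \<le> inverse (cmod c) * norm (c *\<^sub>C x)"
      using le[of "inverse c" "c *\<^sub>C x"] by (simp add: norm_inverse)
    then have "cmod c * norm x \<le> norm (c *\<^sub>C x)"
      using False by (simp add: field_simps)
    with le show ?thesis by (simp add: antisym)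
  qed
qed
end

typedef 'i ell2 = "{f :: 'i \<Rightarrow> complex. (\<lambda>i. (cmod (f i))\<^sup>2) summable_on UNIV}"
  by (rule exI[of _ "\<lambda>_. 0"]) simp

setup_lifting type_definition_ell2

lemma square_summable_bound:
  fixes f :: "'i \<Rightarrow> complex"
  assumes "\<And>F. finite F \<Longrightarrow> L2_set (\<lambda>i. cmod (f i)) F \<le> B"
  shows "(\<lambda>i. (cmod (f i))\<^sup>2) summable_on UNIV"
    and "sqrt (\<Sum>\<^sub>\<infinity>i. (cmod (f i))\<^sup>2) \<le> B"
proof -
  have B: "0 \<le> B" using assms[of "{}"] by simp
  have le: "(\<Sum>i\<in>F. (cmod (f i))\<^sup>2) \<le> B\<^sup>2" if "finite F" for F
    using assms[OF that] B unfolding L2_set_def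
    by (meson real_le_lsqrt real_sqrt_le_iff sum_nonneg zero_le_power2 sqrt_le_D)
  show *: "(\<lambda>i. (cmod (f i))\<^sup>2) summable_on UNIV"
    by (rule nonneg_bdd_above_summable_on) (auto intro!: bdd_aboveI2[where M = "B\<^sup>2"] le)
  have "(\<Sum>\<^sub>\<infinity>i. (cmod (f i))\<^sup>2) \<le> B\<^sup>2"
    by (rule infsum_le_finite_sums[OF *]) (simp add: le)
  then show "sqrt (\<Sum>\<^sub>\<infinity>i. (cmod (f i))\<^sup>2) \<le> B"
    using B by (simp add: real_le_lsqrt infsum_nonneg)
qed

lemma L2_set_le_infsum:
  fixes f :: "'i \<Rightarrow> complex"
  assumes "(\<lambda>i. (cmod (f i))\<^sup>2) summable_on UNIV" "finite F"
  shows "L2_set (\<lambda>i. cmod (f i)) F \<le> sqrt (\<Sum>\<^sub>\<infinity>i. (cmod (f i))\<^sup>2)"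
  unfolding L2_set_def by (simp add: finite_sum_le_infsum assms)

lemma L2_set_add_le_infsum:
  fixes f g :: "'i \<Rightarrow> complex"
  assumes f: "(\<lambda>i. (cmod (f i))\<^sup>2) summable_on UNIV"
    and g: "(\<lambda>i. (cmod (g i))\<^sup>2) summable_on UNIV" and F: "finite F"
  shows "L2_set (\<lambda>i. cmod (f i + g i)) F
    \<le> sqrt (\<Sum>\<^sub>\<infinity>i. (cmod (f i))\<^sup>2) + sqrt (\<Sum>\<^sub>\<infinity>i. (cmod (g i))\<^sup>2)"
proof -
  have "L2_set (\<lambda>i. cmod (f i + g i)) F \<le> L2_set (\<lambda>i. cmod (f i) + cmod (g i)) F"
    by (rule L2_set_mono) (simp_all add: norm_triangle_ineq)
  also have "\<dots> \<le> L2_set (\<lambda>i. cmod (f i)) F + L2_set (\<lambda>i. cmod (g i)) F"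
    by (rule L2_set_triangle_ineq)
  finally show ?thesis
    using L2_set_le_infsum[OF f F] L2_set_le_infsum[OF g F] by linarith
qed

lemma square_summable_scale:
  fixes f :: "'i \<Rightarrow> complex"
  assumes "(\<lambda>i. (cmod (f i))\<^sup>2) summable_on UNIV"
  shows "(\<lambda>i. (cmod (c * f i))\<^sup>2) summable_on UNIV"
  using summable_on_cmult_right[OF assms, of "(cmod c)\<^sup>2"]
  by (simp add: norm_mult power_mult_distrib)

instantiation ell2 :: (type) complex_normed_vector
begin

lift_definition zero_ell2 :: "'a ell2" is "\<lambda>_. 0" by simp
lift_definition plus_ell2 :: "'a ell2 \<Rightarrow> 'a ell2 \<Rightarrow> 'a ell2" is "\<lambda>f g i. f i + g i"
  by (rule square_summable_bound(1)[OF L2_set_add_le_infsum]) auto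
lift_definition uminus_ell2 :: "'a ell2 \<Rightarrow> 'a ell2" is "\<lambda>f i. - f i" by simp
definition minus_ell2 :: "'a ell2 \<Rightarrow> 'a ell2 \<Rightarrow> 'a ell2" where "minus_ell2 f g = f + (- g)"
lift_definition scaleC_ell2 :: "complex \<Rightarrow> 'a ell2 \<Rightarrow> 'a ell2" is "\<lambda>c f i. c * f i"
  by (rule square_summable_scale)
definition scaleR_ell2 :: "real \<Rightarrow> 'a ell2 \<Rightarrow> 'a ell2"
  where "scaleR_ell2 r f = complex_of_real r *\<^sub>C f"
lift_definition norm_ell2 :: "'a ell2 \<Rightarrow> real" is "\<lambda>f. sqrt (\<Sum>\<^sub>\<infinity>i. (cmod (f i))\<^sup>2)" .
definition dist_ell2 :: "'a ell2 \<Rightarrow> 'a ell2 \<Rightarrow> real" where "dist_ell2 f g = norm (f - g)"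
definition sgn_ell2 :: "'a ell2 \<Rightarrow> 'a ell2" where "sgn_ell2 f = inverse (norm f) *\<^sub>R f"
definition uniformity_ell2 :: "('a ell2 \<times> 'a ell2) filter"
  where "uniformity_ell2 = (INF e\<in>{0<..}. principal {(x, y). dist x y < e})"
definition open_ell2 :: "'a ell2 set \<Rightarrow> bool"
  where "open_ell2 U = (\<forall>x\<in>U. \<forall>\<^sub>F (x', y) in uniformity. x' = x \<longrightarrow> y \<in> U)"

instance
proof
  fix f g h :: "'a ell2" and c d :: complex and r s :: real and U :: "'a ell2 set"
  show "f + g + h = f + (g + h)" by transfer (simp add: add.assoc)
  show "f + g = g + f" by transfer (simp add: add.commute)
  show "0 + f = f" by transfer simp
  show "- f + f = 0" by transfer simp
  show "f - g = f + - g" by (rule minus_ell2_def)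
  show cr: "c *\<^sub>C (f + g) = c *\<^sub>C f + c *\<^sub>C g" for c :: complex and f g :: "'a ell2"
    by transfer (simp add: algebra_simps)
  show cl: "(c + d) *\<^sub>C f = c *\<^sub>C f + d *\<^sub>C f" for c d :: complex and f :: "'a ell2"
    by transfer (simp add: algebra_simps)
  show cc: "c *\<^sub>C d *\<^sub>C f = (c * d) *\<^sub>C f" for c d :: complex and f :: "'a ell2"
    by transfer (simp add: algebra_simps)
  show "r *\<^sub>R f = complex_of_real r *\<^sub>C f" by (rule scaleR_ell2_def)
  show nc: "norm (c *\<^sub>C f) = cmod c * norm f" for c :: complex and f :: "'a ell2"
    by transfer (simp add: norm_mult power_mult_distrib infsum_cmult_right' real_sqrt_mult)
  show "r *\<^sub>R (f + g) = r *\<^sub>R f + r *\<^sub>R g" by (simp add: scaleR_ell2_def cr)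
  show "(r + s) *\<^sub>R f = r *\<^sub>R f + s *\<^sub>R f" by (simp add: scaleR_ell2_def cl)
  show "r *\<^sub>R s *\<^sub>R f = (r * s) *\<^sub>R f" by (simp add: scaleR_ell2_def cc)
  show "1 *\<^sub>R f = f" unfolding scaleR_ell2_def by transfer simp
  show "norm (r *\<^sub>R f) = \<bar>r\<bar> * norm f" by (simp add: scaleR_ell2_def nc)
  show "norm f = 0 \<longleftrightarrow> f = 0"
  proof transfer
    fix f :: "'a \<Rightarrow> complex"
    assume f: "(\<lambda>i. (cmod (f i))\<^sup>2) summable_on UNIV"
    have "f = (\<lambda>_. 0)" if "(\<Sum>\<^sub>\<infinity>i. (cmod (f i))\<^sup>2) = 0"
      using nonneg_infsum_le_0D[of "\<lambda>i. (cmod (f i))\<^sup>2" UNIV] f that by auto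
    then show "sqrt (\<Sum>\<^sub>\<infinity>i. (cmod (f i))\<^sup>2) = 0 \<longleftrightarrow> f = (\<lambda>_. 0)" by auto
  qed
  show "norm (f + g) \<le> norm f + norm g"
    by transfer (rule square_summable_bound(2)[OF L2_set_add_le_infsum])
  show "dist f g = norm (f - g)" by (rule dist_ell2_def)
  show "sgn f = inverse (norm f) *\<^sub>R f" by (rule sgn_ell2_def)
  show "uniformity = (INF e\<in>{0<..}. principal {(x :: 'a ell2, y). dist x y < e})"
    by (rule uniformity_ell2_def)
  show "open U = (\<forall>x\<in>U. \<forall>\<^sub>F (x', y) in uniformity. x' = x \<longrightarrow> y \<in> U)"
    by (rule open_ell2_def)
qed
end

definition cinner :: "'i ell2 \<Rightarrow> 'i ell2 \<Rightarrow> complex"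
  where "cinner f g = (\<Sum>\<^sub>\<infinity>i. cnj (Rep_ell2 f i) * Rep_ell2 g i)"

lift_definition ket :: "'i \<Rightarrow> 'i ell2" is "\<lambda>i j. if j = i then 1 else 0"
proof -
  fix i :: 'i
  have "(\<lambda>j. (cmod (if j = i then 1 else 0))\<^sup>2) summable_on {i}" by simp
  then show "(\<lambda>j. (cmod (if j = i then 1 else 0))\<^sup>2) summable_on UNIV"
    by (rule summable_on_cong_neutral[THEN iffD1, rotated -1]) auto
qed

text \<open>The Hilbert space tensor product of \<open>'i ell2\<close> and \<open>'j ell2\<close> is \<open>('i \<times> 'j) ell2\<close>.\<close>

lift_definition tensor_vec :: "'i ell2 \<Rightarrow> 'j ell2 \<Rightarrow> ('i \<times> 'j) ell2" (infixr "\<otimes>\<^sub>v" 70)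
  is "\<lambda>f g (i, j). f i * g j"
proof -
  fix f :: "'i \<Rightarrow> complex" and g :: "'j \<Rightarrow> complex"
  assume f: "(\<lambda>i. (cmod (f i))\<^sup>2) summable_on UNIV" and g: "(\<lambda>i. (cmod (g i))\<^sup>2) summable_on UNIV"
  let ?M = "(\<Sum>\<^sub>\<infinity>i. (cmod (f i))\<^sup>2) * (\<Sum>\<^sub>\<infinity>i. (cmod (g i))\<^sup>2)"
  show "(\<lambda>p. (cmod (case p of (i, j) \<Rightarrow> f i * g j))\<^sup>2) summable_on UNIV"
  proof (rule nonneg_bdd_above_summable_on, simp, rule bdd_aboveI2)
    fix F :: "('i \<times> 'j) set"
    assume "F \<in> {F. F \<subseteq> UNIV \<and> finite F}"
    then have F: "finite F" by simp
    have "(\<Sum>p\<in>F. (cmod (case p of (i, j) \<Rightarrow> f i * g j))\<^sup>2)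
      \<le> (\<Sum>p\<in>fst ` F \<times> snd ` F. (cmod (case p of (i, j) \<Rightarrow> f i * g j))\<^sup>2)"
      by (rule sum_mono2) (use F subset_fst_snd[of F] in auto)
    also have "\<dots> = (\<Sum>i\<in>fst ` F. (cmod (f i))\<^sup>2) * (\<Sum>j\<in>snd ` F. (cmod (g j))\<^sup>2)"
      by (simp add: sum_product sum.cartesian_product norm_mult power_mult_distrib case_prod_beta)
    also have "\<dots> \<le> ?M"
      by (rule mult_mono)
        (use F f g in \<open>auto intro!: finite_sum_le_infsum infsum_nonneg sum_nonneg\<close>)
    finally show "(\<Sum>p\<in>F. (cmod (case p of (i, j) \<Rightarrow> f i * g j))\<^sup>2) \<le> ?M" .
  qed
qed

lift_definition assoc_ell2 :: "(('i \<times> 'j) \<times> 'k) ell2 \<Rightarrow> ('i \<times> 'j \<times> 'k) ell2"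
  is "\<lambda>f (i, j, k). f ((i, j), k)"
proof -
  fix f :: "('i \<times> 'j) \<times> 'k \<Rightarrow> complex"
  assume f: "(\<lambda>p. (cmod (f p))\<^sup>2) summable_on UNIV"
  have "bij_betw (\<lambda>(i, j, k). ((i, j), k)) UNIV (UNIV :: (('i \<times> 'j) \<times> 'k) set)"
    by (rule bij_betwI[where g = "\<lambda>((i, j), k). (i, j, k)"]) auto
  from summable_on_reindex_bij_betw[OF this, of "\<lambda>p. (cmod (f p))\<^sup>2"] f
  show "(\<lambda>p. (cmod (case p of (i, j, k) \<Rightarrow> f ((i, j), k)))\<^sup>2) summable_on UNIV"
    by (simp add: case_prod_beta')
qed

section \<open>Operator algebras on these spaces\<close>

text \<open>
  Elements of \<open>'i ell2 \<Rightarrow>\<^sub>L 'j ell2\<close> are only real-linear; complex linearity is imposed separately.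
\<close>

definition clinear_op :: "('a::complex_normed_vector \<Rightarrow>\<^sub>L 'b::complex_normed_vector) \<Rightarrow> bool"
  where "clinear_op A \<longleftrightarrow> (\<forall>c f. A (c *\<^sub>C f) = c *\<^sub>C A f)"

definition adj :: "('i ell2 \<Rightarrow>\<^sub>L 'j ell2) \<Rightarrow> ('j ell2 \<Rightarrow>\<^sub>L 'i ell2)"
  where "adj A = (THE B :: 'j ell2 \<Rightarrow>\<^sub>L 'i ell2. \<forall>f g. cinner (B f) g = cinner f (A g))"

definition tensor_op ::
    "('i ell2 \<Rightarrow>\<^sub>L 'i ell2) \<Rightarrow> ('j ell2 \<Rightarrow>\<^sub>L 'j ell2) \<Rightarrow> (('i \<times> 'j) ell2 \<Rightarrow>\<^sub>L ('i \<times> 'j) ell2)"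
    (infixr "\<otimes>\<^sub>o" 70)
  where "A \<otimes>\<^sub>o B = (THE C :: ('i \<times> 'j) ell2 \<Rightarrow>\<^sub>L ('i \<times> 'j) ell2. \<forall>f g. C (f \<otimes>\<^sub>v g) = A f \<otimes>\<^sub>v B g)"

text \<open>
  C*-algebras are represented concretely, as norm-closed self-adjoint subalgebras of the bounded
  operators on some \<open>'i ell2\<close>. The unit need not be the identity operator: for a subset \<open>X\<close> of
  \<open>'i\<close> the operators on \<open>\<ell>\<^sup>2(X)\<close> are identified, by extending them by \<open>0\<close>, with the operators
  on \<open>'i ell2\<close> that vanish on the orthogonal complement of \<open>\<ell>\<^sup>2(X)\<close> and have range in
  \<open>\<ell>\<^sup>2(X)\<close>, and the projection onto \<open>\<ell>\<^sup>2(X)\<close> becomes the unit.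
\<close>

definition cstar_subalgebra :: "('i ell2 \<Rightarrow>\<^sub>L 'i ell2) set \<Rightarrow> bool"
  where "cstar_subalgebra A \<longleftrightarrow>
    (\<forall>a\<in>A. clinear_op a) \<and> 0 \<in> A \<and> (\<forall>a\<in>A. \<forall>b\<in>A. a + b \<in> A) \<and> (\<forall>c. \<forall>a\<in>A. c *\<^sub>C a \<in> A) \<and>
    (\<forall>a\<in>A. \<forall>b\<in>A. a o\<^sub>L b \<in> A) \<and> (\<forall>a\<in>A. adj a \<in> A) \<and> closed A"

definition is_unit_of :: "('i ell2 \<Rightarrow>\<^sub>L 'i ell2) \<Rightarrow> ('i ell2 \<Rightarrow>\<^sub>L 'i ell2) set \<Rightarrow> bool"
  where "is_unit_of u A \<longleftrightarrow> u \<in> A \<and> (\<forall>a\<in>A. u o\<^sub>L a = a \<and> a o\<^sub>L u = a)"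

definition unit_of :: "('i ell2 \<Rightarrow>\<^sub>L 'i ell2) set \<Rightarrow> ('i ell2 \<Rightarrow>\<^sub>L 'i ell2)"
  where "unit_of A = (THE u. is_unit_of u A)"

definition unital_cstar_algebra :: "('i ell2 \<Rightarrow>\<^sub>L 'i ell2) set \<Rightarrow> bool"
  where "unital_cstar_algebra A \<longleftrightarrow> cstar_subalgebra A \<and> (\<exists>u. is_unit_of u A)"

definition commutative_algebra :: "('i ell2 \<Rightarrow>\<^sub>L 'i ell2) set \<Rightarrow> bool"
  where "commutative_algebra A \<longleftrightarrow> (\<forall>a\<in>A. \<forall>b\<in>A. a o\<^sub>L b = b o\<^sub>L a)"

definition clinear_on ::
    "'a::complex_normed_vector set \<Rightarrow> ('a \<Rightarrow> 'b::complex_normed_vector) \<Rightarrow> bool"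
  where "clinear_on A F \<longleftrightarrow>
    (\<forall>x\<in>A. \<forall>y\<in>A. F (x + y) = F x + F y) \<and> (\<forall>c. \<forall>x\<in>A. F (c *\<^sub>C x) = c *\<^sub>C F x)"

definition star_hom ::
    "('i ell2 \<Rightarrow>\<^sub>L 'i ell2) set \<Rightarrow> ('j ell2 \<Rightarrow>\<^sub>L 'j ell2) set \<Rightarrow>
     (('i ell2 \<Rightarrow>\<^sub>L 'i ell2) \<Rightarrow> ('j ell2 \<Rightarrow>\<^sub>L 'j ell2)) \<Rightarrow> bool"
  where "star_hom A B \<phi> \<longleftrightarrow> \<phi> ` A \<subseteq> B \<and> clinear_on A \<phi> \<and>
    (\<forall>a\<in>A. \<forall>b\<in>A. \<phi> (a o\<^sub>L b) = \<phi> a o\<^sub>L \<phi> b) \<and> (\<forall>a\<in>A. \<phi> (adj a) = adj (\<phi> a))"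

definition unital_star_hom ::
    "('i ell2 \<Rightarrow>\<^sub>L 'i ell2) set \<Rightarrow> ('j ell2 \<Rightarrow>\<^sub>L 'j ell2) set \<Rightarrow>
     (('i ell2 \<Rightarrow>\<^sub>L 'i ell2) \<Rightarrow> ('j ell2 \<Rightarrow>\<^sub>L 'j ell2)) \<Rightarrow> bool"
  where "unital_star_hom A B \<phi> \<longleftrightarrow> star_hom A B \<phi> \<and> \<phi> (unit_of A) = unit_of B"

definition star_automorphism ::
    "('i ell2 \<Rightarrow>\<^sub>L 'i ell2) set \<Rightarrow> (('i ell2 \<Rightarrow>\<^sub>L 'i ell2) \<Rightarrow> ('i ell2 \<Rightarrow>\<^sub>L 'i ell2)) \<Rightarrow> bool"
  where "star_automorphism A \<phi> \<longleftrightarrow> star_hom A A \<phi> \<and> bij_betw \<phi> A A"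

text \<open>For concrete algebras the minimal tensor product is the spatial one.\<close>

definition min_tensor ::
    "('i ell2 \<Rightarrow>\<^sub>L 'i ell2) set \<Rightarrow> ('j ell2 \<Rightarrow>\<^sub>L 'j ell2) set \<Rightarrow>
     (('i \<times> 'j) ell2 \<Rightarrow>\<^sub>L ('i \<times> 'j) ell2) set" (infixr "\<otimes>\<^sub>m" 70)
  where "A \<otimes>\<^sub>m B = closure (cspan {a \<otimes>\<^sub>o b | a b. a \<in> A \<and> b \<in> B})"

text \<open>
  The maps \<open>\<phi> \<otimes> \<psi>\<close> on \<open>A \<otimes>\<^sub>m B\<close>, for linear maps and for functionals. Two maps with the
  properties required of \<open>F\<close> agree on \<open>A \<otimes>\<^sub>m B\<close>, so the choice only concerns the values outside.
\<close>

definition tensor_map ::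
    "('i ell2 \<Rightarrow>\<^sub>L 'i ell2) set \<Rightarrow> ('j ell2 \<Rightarrow>\<^sub>L 'j ell2) set \<Rightarrow>
     (('i ell2 \<Rightarrow>\<^sub>L 'i ell2) \<Rightarrow> ('k ell2 \<Rightarrow>\<^sub>L 'k ell2)) \<Rightarrow>
     (('j ell2 \<Rightarrow>\<^sub>L 'j ell2) \<Rightarrow> ('l ell2 \<Rightarrow>\<^sub>L 'l ell2)) \<Rightarrow>
     (('i \<times> 'j) ell2 \<Rightarrow>\<^sub>L ('i \<times> 'j) ell2) \<Rightarrow> (('k \<times> 'l) ell2 \<Rightarrow>\<^sub>L ('k \<times> 'l) ell2)"
  where "tensor_map A B \<phi> \<psi> = (SOME F.
    clinear_on (A \<otimes>\<^sub>m B) F \<and> continuous_on (A \<otimes>\<^sub>m B) F \<and>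
    (\<forall>a\<in>A. \<forall>b\<in>B. F (a \<otimes>\<^sub>o b) = \<phi> a \<otimes>\<^sub>o \<psi> b))"

definition tensor_functional ::
    "('i ell2 \<Rightarrow>\<^sub>L 'i ell2) set \<Rightarrow> ('j ell2 \<Rightarrow>\<^sub>L 'j ell2) set \<Rightarrow>
     (('i ell2 \<Rightarrow>\<^sub>L 'i ell2) \<Rightarrow> complex) \<Rightarrow> (('j ell2 \<Rightarrow>\<^sub>L 'j ell2) \<Rightarrow> complex) \<Rightarrow>
     (('i \<times> 'j) ell2 \<Rightarrow>\<^sub>L ('i \<times> 'j) ell2) \<Rightarrow> complex"
  where "tensor_functional A B \<xi> \<eta> = (SOME F.
    clinear_on (A \<otimes>\<^sub>m B) F \<and> continuous_on (A \<otimes>\<^sub>m B) F \<and>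
    (\<forall>a\<in>A. \<forall>b\<in>B. F (a \<otimes>\<^sub>o b) = \<xi> a * \<eta> b))"

definition dual_space :: "'a::complex_normed_vector set \<Rightarrow> ('a \<Rightarrow> complex) set"
  where "dual_space A = {\<xi>. clinear_on A \<xi> \<and> continuous_on A \<xi>}"

section \<open>Compact quantum semigroups and their actions\<close>

definition conv ::
    "('i ell2 \<Rightarrow>\<^sub>L 'i ell2) set \<Rightarrow>
     (('i ell2 \<Rightarrow>\<^sub>L 'i ell2) \<Rightarrow> (('i \<times> 'i) ell2 \<Rightarrow>\<^sub>L ('i \<times> 'i) ell2)) \<Rightarrow>
     (('i ell2 \<Rightarrow>\<^sub>L 'i ell2) \<Rightarrow> complex) \<Rightarrow> (('i ell2 \<Rightarrow>\<^sub>L 'i ell2) \<Rightarrow> complex) \<Rightarrow>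
     ('i ell2 \<Rightarrow>\<^sub>L 'i ell2) \<Rightarrow> complex"
  where "conv A \<Delta> \<xi> \<eta> = (\<lambda>a. tensor_functional A A \<xi> \<eta> (\<Delta> a))"

definition compact_quantum_semigroup ::
    "('i ell2 \<Rightarrow>\<^sub>L 'i ell2) set \<Rightarrow>
     (('i ell2 \<Rightarrow>\<^sub>L 'i ell2) \<Rightarrow> (('i \<times> 'i) ell2 \<Rightarrow>\<^sub>L ('i \<times> 'i) ell2)) \<Rightarrow> bool"
  where "compact_quantum_semigroup A \<Delta> \<longleftrightarrow>
    unital_cstar_algebra A \<and> unital_star_hom A (A \<otimes>\<^sub>m A) \<Delta> \<and> inj_on \<Delta> A \<and>
    (\<forall>\<xi>\<in>dual_space A. \<forall>\<eta>\<in>dual_space A. \<forall>\<zeta>\<in>dual_space A. \<forall>a\<in>A.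
       conv A \<Delta> (conv A \<Delta> \<xi> \<eta>) \<zeta> a = conv A \<Delta> \<xi> (conv A \<Delta> \<eta> \<zeta>) a)"

definition classical_compact_quantum_semigroup ::
    "('i ell2 \<Rightarrow>\<^sub>L 'i ell2) set \<Rightarrow>
     (('i ell2 \<Rightarrow>\<^sub>L 'i ell2) \<Rightarrow> (('i \<times> 'i) ell2 \<Rightarrow>\<^sub>L ('i \<times> 'i) ell2)) \<Rightarrow> bool"
  where "classical_compact_quantum_semigroup A \<Delta> \<longleftrightarrow>
    compact_quantum_semigroup A \<Delta> \<and> commutative_algebra A"

definition compact_quantum_subsemigroup ::
    "('i ell2 \<Rightarrow>\<^sub>L 'i ell2) set \<Rightarrow>
     (('i ell2 \<Rightarrow>\<^sub>L 'i ell2) \<Rightarrow> (('i \<times> 'i) ell2 \<Rightarrow>\<^sub>L ('i \<times> 'i) ell2)) \<Rightarrow>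
     ('j ell2 \<Rightarrow>\<^sub>L 'j ell2) set \<Rightarrow>
     (('j ell2 \<Rightarrow>\<^sub>L 'j ell2) \<Rightarrow> (('j \<times> 'j) ell2 \<Rightarrow>\<^sub>L ('j \<times> 'j) ell2)) \<Rightarrow>
     (('i ell2 \<Rightarrow>\<^sub>L 'i ell2) \<Rightarrow> ('j ell2 \<Rightarrow>\<^sub>L 'j ell2)) \<Rightarrow> bool"
  where "compact_quantum_subsemigroup A \<Delta> A' \<Delta>' \<pi> \<longleftrightarrow>
    compact_quantum_semigroup A \<Delta> \<and> compact_quantum_semigroup A' \<Delta>' \<and>
    star_hom A A' \<pi> \<and> \<pi> ` A = A' \<and> (\<forall>a\<in>A. \<Delta>' (\<pi> a) = tensor_map A A \<pi> \<pi> (\<Delta> a))"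

text \<open>
  The two sides of the coassociativity identity live on differently bracketed tensor products;
  \<open>assoc_ell2\<close> is the canonical unitary between them.
\<close>

definition quantum_action ::
    "('i ell2 \<Rightarrow>\<^sub>L 'i ell2) set \<Rightarrow>
     (('i ell2 \<Rightarrow>\<^sub>L 'i ell2) \<Rightarrow> (('i \<times> 'i) ell2 \<Rightarrow>\<^sub>L ('i \<times> 'i) ell2)) \<Rightarrow>
     ('j ell2 \<Rightarrow>\<^sub>L 'j ell2) set \<Rightarrow>
     (('j ell2 \<Rightarrow>\<^sub>L 'j ell2) \<Rightarrow> (('j \<times> 'i) ell2 \<Rightarrow>\<^sub>L ('j \<times> 'i) ell2)) \<Rightarrow> bool"
  where "quantum_action A \<Delta> B \<delta> \<longleftrightarrow>
    compact_quantum_semigroup A \<Delta> \<and> unital_cstar_algebra B \<and> unital_star_hom B (B \<otimes>\<^sub>m A) \<delta> \<and>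
    (\<forall>b\<in>B. \<forall>f. assoc_ell2 (tensor_map B A \<delta> id (\<delta> b) f) = tensor_map B A id \<Delta> (\<delta> b) (assoc_ell2 f))"

definition fixed_point_algebra ::
    "('i ell2 \<Rightarrow>\<^sub>L 'i ell2) set \<Rightarrow> ('j ell2 \<Rightarrow>\<^sub>L 'j ell2) set \<Rightarrow>
     (('j ell2 \<Rightarrow>\<^sub>L 'j ell2) \<Rightarrow> (('j \<times> 'i) ell2 \<Rightarrow>\<^sub>L ('j \<times> 'i) ell2)) \<Rightarrow> ('j ell2 \<Rightarrow>\<^sub>L 'j ell2) set"
  where "fixed_point_algebra A B \<delta> = {b \<in> B. \<delta> b = b \<otimes>\<^sub>o unit_of A}"

definition ergodic_action ::
    "('i ell2 \<Rightarrow>\<^sub>L 'i ell2) set \<Rightarrow> ('j ell2 \<Rightarrow>\<^sub>L 'j ell2) set \<Rightarrow>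
     (('j ell2 \<Rightarrow>\<^sub>L 'j ell2) \<Rightarrow> (('j \<times> 'i) ell2 \<Rightarrow>\<^sub>L ('j \<times> 'i) ell2)) \<Rightarrow> bool"
  where "ergodic_action A B \<delta> \<longleftrightarrow> fixed_point_algebra A B \<delta> = range (\<lambda>c. c *\<^sub>C unit_of B)"

definition natural_action ::
    "('i ell2 \<Rightarrow>\<^sub>L 'i ell2) set \<Rightarrow>
     (('i ell2 \<Rightarrow>\<^sub>L 'i ell2) \<Rightarrow> (('i \<times> 'i) ell2 \<Rightarrow>\<^sub>L ('i \<times> 'i) ell2)) \<Rightarrow>
     (('i ell2 \<Rightarrow>\<^sub>L 'i ell2) \<Rightarrow> ('j ell2 \<Rightarrow>\<^sub>L 'j ell2)) \<Rightarrow>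
     ('i ell2 \<Rightarrow>\<^sub>L 'i ell2) \<Rightarrow> (('i \<times> 'j) ell2 \<Rightarrow>\<^sub>L ('i \<times> 'j) ell2)"
  where "natural_action A \<Delta> \<pi> = (\<lambda>a. tensor_map A A id \<pi> (\<Delta> a))"

definition left_coset_space ::
    "('i ell2 \<Rightarrow>\<^sub>L 'i ell2) set \<Rightarrow>
     (('i ell2 \<Rightarrow>\<^sub>L 'i ell2) \<Rightarrow> (('i \<times> 'i) ell2 \<Rightarrow>\<^sub>L ('i \<times> 'i) ell2)) \<Rightarrow>
     ('j ell2 \<Rightarrow>\<^sub>L 'j ell2) set \<Rightarrow>
     (('i ell2 \<Rightarrow>\<^sub>L 'i ell2) \<Rightarrow> ('j ell2 \<Rightarrow>\<^sub>L 'j ell2)) \<Rightarrow> ('i ell2 \<Rightarrow>\<^sub>L 'i ell2) set"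
  where "left_coset_space A \<Delta> A' \<pi> = fixed_point_algebra A' A (natural_action A \<Delta> \<pi>)"

definition left_quotient_space ::
    "('i ell2 \<Rightarrow>\<^sub>L 'i ell2) set \<Rightarrow>
     (('i ell2 \<Rightarrow>\<^sub>L 'i ell2) \<Rightarrow> (('i \<times> 'i) ell2 \<Rightarrow>\<^sub>L ('i \<times> 'i) ell2)) \<Rightarrow>
     ('j ell2 \<Rightarrow>\<^sub>L 'j ell2) set \<Rightarrow>
     (('i ell2 \<Rightarrow>\<^sub>L 'i ell2) \<Rightarrow> ('j ell2 \<Rightarrow>\<^sub>L 'j ell2)) \<Rightarrow>
     ('i ell2 \<Rightarrow>\<^sub>L 'i ell2) set \<times>
     (('i ell2 \<Rightarrow>\<^sub>L 'i ell2) \<Rightarrow> (('i \<times> 'i) ell2 \<Rightarrow>\<^sub>L ('i \<times> 'i) ell2))"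
  where "left_quotient_space A \<Delta> A' \<pi> =
    (left_coset_space A \<Delta> A' \<pi>, restrict \<Delta> (left_coset_space A \<Delta> A' \<pi>))"

section \<open>Continuous functions as multiplication operators\<close>

text \<open>
  \<open>C(K)\<close> is represented faithfully by the multiplication operators \<open>mult_op K f\<close> on \<open>\<ell>\<^sup>2(K)\<close>.
\<close>

definition mult_op :: "'k set \<Rightarrow> ('k \<Rightarrow> complex) \<Rightarrow> ('k ell2 \<Rightarrow>\<^sub>L 'k ell2)"
  where "mult_op K f = (THE X. clinear_op X \<and>
    (\<forall>k. X (ket k) = (if k \<in> K then f k *\<^sub>C ket k else 0)))"

definition symbol :: "('k ell2 \<Rightarrow>\<^sub>L 'k ell2) \<Rightarrow> 'k \<Rightarrow> complex"
  where "symbol X k = cinner (ket k) (X (ket k))"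

definition cont_algebra :: "'k::topological_space set \<Rightarrow> ('k ell2 \<Rightarrow>\<^sub>L 'k ell2) set"
  where "cont_algebra K = {mult_op K f | f. continuous_on K f}"

text \<open>
  The identification of \<open>A \<otimes>\<^sub>m cont_algebra K\<close> with \<open>C(K, A)\<close>: the operator \<open>a \<otimes>\<^sub>o mult_op K f\<close>
  corresponds to the function mapping \<open>k\<close> to \<open>f k *\<^sub>C a\<close>.
\<close>

definition corresponds_to_function ::
    "('i ell2 \<Rightarrow>\<^sub>L 'i ell2) set \<Rightarrow> 'k::topological_space set \<Rightarrow>
     (('i \<times> 'k) ell2 \<Rightarrow>\<^sub>L ('i \<times> 'k) ell2) \<Rightarrow> ('k \<Rightarrow> ('i ell2 \<Rightarrow>\<^sub>L 'i ell2)) \<Rightarrow> bool"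
  where "corresponds_to_function A K X F \<longleftrightarrow>
    X \<in> A \<otimes>\<^sub>m cont_algebra K \<and> continuous_on K F \<and> F ` K \<subseteq> A \<and>
    (\<forall>k\<in>K. \<forall>f. X (f \<otimes>\<^sub>v ket k) = F k f \<otimes>\<^sub>v ket k)"

text \<open>
  The dual of the discrete group \<open>'g\<close>. Its compact topology is that of pointwise convergence,
  i.e. the one induced by the topology of the function type.
\<close>

definition dual_group :: "('g::ab_group_add \<Rightarrow> complex) set"
  where "dual_group = {\<alpha>. (\<forall>a. cmod (\<alpha> a) = 1) \<and> (\<forall>a b. \<alpha> (a + b) = \<alpha> a * \<alpha> b)}"

text \<open>\<open>(\<Delta>\<^sub>G f) (\<alpha>, \<beta>) = f (\<alpha> \<beta>)\<close>, in terms of multiplication operators.\<close>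

definition dual_comult ::
    "(('g::ab_group_add \<Rightarrow> complex) ell2 \<Rightarrow>\<^sub>L ('g \<Rightarrow> complex) ell2) \<Rightarrow>
     ((('g \<Rightarrow> complex) \<times> ('g \<Rightarrow> complex)) ell2 \<Rightarrow>\<^sub>L (('g \<Rightarrow> complex) \<times> ('g \<Rightarrow> complex)) ell2)"
  where "dual_comult X =
    mult_op (dual_group \<times> dual_group) (\<lambda>(\<alpha>, \<beta>). symbol X (\<lambda>a. \<alpha> a * \<beta> a))"

section \<open>The reduced semigroup C*-algebra\<close>

text \<open>The isometry \<open>T\<^sub>a\<close> of \<open>\<ell>\<^sup>2(S)\<close>, extended by \<open>0\<close> to \<open>'g ell2\<close>.\<close>

definition trans_op :: "'g::ab_group_add set \<Rightarrow> 'g \<Rightarrow> ('g ell2 \<Rightarrow>\<^sub>L 'g ell2)"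
  where "trans_op S a = (THE X. clinear_op X \<and>
    (\<forall>b. X (ket b) = (if b \<in> S then ket (a + b) else 0)))"

definition reduced_cstar :: "'g::ab_group_add set \<Rightarrow> ('g ell2 \<Rightarrow>\<^sub>L 'g ell2) set"
  where "reduced_cstar S = cstar_subalgebra hull (trans_op S ` S)"

inductive_set monomials :: "'g::ab_group_add set \<Rightarrow> ('g ell2 \<Rightarrow>\<^sub>L 'g ell2) set"
  for S :: "'g set" where
  trans: "a \<in> S \<Longrightarrow> trans_op S a \<in> monomials S"
| adj_trans: "a \<in> S \<Longrightarrow> adj (trans_op S a) \<in> monomials S"
| comp: "V \<in> monomials S \<Longrightarrow> W \<in> monomials S \<Longrightarrow> V o\<^sub>L W \<in> monomials S"

definition monomial_index :: "'g::ab_group_add set \<Rightarrow> ('g ell2 \<Rightarrow>\<^sub>L 'g ell2) \<Rightarrow> 'g"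
  where "monomial_index S V = (THE g. \<exists>a\<in>S. \<exists>b\<in>S. g = b - a \<and>
    (\<exists>c\<^sub>0\<in>S. \<forall>c\<in>S. c - c\<^sub>0 \<in> S \<longrightarrow>
       adj (trans_op S c) o\<^sub>L V o\<^sub>L trans_op S c = adj (trans_op S a) o\<^sub>L trans_op S b))"

definition index_zero_algebra :: "'g::ab_group_add set \<Rightarrow> ('g ell2 \<Rightarrow>\<^sub>L 'g ell2) set"
  where "index_zero_algebra S = closure (cspan {V \<in> monomials S. monomial_index S V = 0})"

end

theory Submission
  imports Defs
begin

text \<open>
  On the spatial tensor product the slice map \<open>id \<otimes> \<eta>\<close> of a bounded functional \<open>\<eta>\<close> has norm at most
  \<open>\<parallel>\<eta>\<parallel>\<close>, since its matrix coefficients are the values of \<open>\<eta>\<close> at compressions. Hence product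
  functionals exist, and so do all maps \<open>\<phi> \<otimes> \<psi>\<close> with \<open>\<psi>\<close> taking values in multiplication operators.
  Monomials are group-like, \<open>\<Delta> V = V \<otimes> V\<close>, and span a dense subalgebra, which reduces every identity
  between continuous maps to monomials. Evaluating \<open>\<pi>\<close> at the trivial character gives a counit, so
  \<open>\<Delta>\<close> is injective.

  A monomial \<open>V\<close> of index \<open>g\<close> maps each \<open>e\<^sub>x\<close> to \<open>0\<close> or \<open>e\<^bsub>x + g\<^esub>\<close>. Thus \<open>\<pi> V\<close> is the character
  \<open>\<chi>\<^sup>g\<close> and \<open>\<tau>(\<alpha>) V = \<alpha>(g) V\<close>, which gives the identification of \<open>\<delta>\<close> with \<open>\<tau>\<close>. An operator fixed by all
  \<open>\<tau>(\<alpha>)\<close> is diagonal because characters separate the points of \<open>\<Gamma>\<close>, and the compression to the diagonal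
  is a contraction that annihilates the monomials of non-zero index; so the fixed points are \<open>\<AA>\<^sub>0\<close>.
\<close>

section \<open>Hilbert spaces of square-summable families\<close>

text \<open>Operators here are only real-linear, \<open>adj\<close>, \<open>tensor_op\<close>,
  \<open>mult_op\<close> and \<open>trans_op\<close> are definite descriptions, and
  \<open>tensor_map\<close> and \<open>tensor_functional\<close> are choices. Nothing can be said
  about any of them before an existence proof, so every operator is first built from its values on
  basis vectors. For an arbitrary pair of bounded maps, \<phi> \<otimes> \<psi> need not be bounded
  on the spatial tensor product. When \<psi> takes values in multiplication operators the target
  splits into blocks, and each block only sees \<phi> applied to a slice, so a norm bound for \<phi>
  is enough. Every tensor map in the statement is of this kind. Two analytic facts are obtained by a
  detour. The continuity of \<pi> and of each \<tau>(\<alpha>) follows from the contractivity of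
  star homomorphisms, proved by inverting one element with a fixed point argument instead of
  spectral theory. The density of the characters in C(G) is read off from the surjectivity of \<pi>
  instead of Stone-Weierstrass. Torsion-freeness enters through the separating characters: it allows
  the value -1 at any g \<noteq> 0.\<close>

interpretation complex_vs: vector_space "scaleC :: complex \<Rightarrow> 'a \<Rightarrow> 'a::complex_normed_vector"
  by (rule vector_space_scaleC)

declare zero_ell2.rep_eq [simp] plus_ell2.rep_eq [simp] uminus_ell2.rep_eq [simp]
  scaleC_ell2.rep_eq [simp] ket.rep_eq [simp] scaleC_blinfun.rep_eq [simp]

lemma Rep_ell2_diff [simp]: "Rep_ell2 (f - g) i = Rep_ell2 f i - Rep_ell2 g i"
  unfolding minus_ell2_def plus_ell2.rep_eq uminus_ell2.rep_eq by (rule add_uminus_conv_diff)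

lemma Rep_ell2_sum [simp]: "Rep_ell2 (\<Sum>x\<in>F. f x) i = (\<Sum>x\<in>F. Rep_ell2 (f x) i)"
  by (induction F rule: infinite_finite_induct) auto

lemma ell2_eqI: "(\<And>i. Rep_ell2 f i = Rep_ell2 g i) \<Longrightarrow> f = g"
  by (metis Rep_ell2_inject ext)

lemma square_summable_ell2 [simp]: "(\<lambda>i. (cmod (Rep_ell2 f i))\<^sup>2) summable_on UNIV"
  using Rep_ell2[of f] by simp

lemma norm_ell2_power2: "(norm f)\<^sup>2 = (\<Sum>\<^sub>\<infinity>i. (cmod (Rep_ell2 f i))\<^sup>2)"
  by (simp add: norm_ell2.rep_eq infsum_nonneg)

lemma L2_set_le_norm_ell2: "finite F \<Longrightarrow> L2_set (\<lambda>i. cmod (Rep_ell2 f i)) F \<le> norm f"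
  by (simp add: norm_ell2.rep_eq L2_set_le_infsum)

text \<open>Membership and norm bound both follow from uniformly bounded finite partial sums.
  Vectors given by coordinates, such as limits and images under operators, are obtained in this
  way.\<close>

lemma ell2_of_bounded:
  assumes "\<And>F. finite F \<Longrightarrow> L2_set (\<lambda>i. cmod (f i)) F \<le> B"
  obtains h where "Rep_ell2 h = f" "norm h \<le> B"
proof
  show "Rep_ell2 (Abs_ell2 f) = f"
    using square_summable_bound(1)[OF assms] by (simp add: Abs_ell2_inverse)
  then show "norm (Abs_ell2 f) \<le> B"
    using square_summable_bound(2)[OF assms] by (simp add: norm_ell2.rep_eq)
qed

lemma norm_Rep_ell2_le: "cmod (Rep_ell2 f i) \<le> norm f"
  using L2_set_le_norm_ell2[of "{i}" f] by simp

text \<open>Completeness carries over to the operators on these spaces, where it is needed to extend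
  maps to closed spans and to apply the Banach fixed point theorem.\<close>

instance ell2 :: (type) banach
proof
  fix X :: "nat \<Rightarrow> 'a ell2"
  assume "Cauchy X"
  have "Cauchy (\<lambda>n. Rep_ell2 (X n) i)" for i
  proof (rule metric_CauchyI)
    fix e :: real assume "e > 0"
    then obtain N where N: "\<And>m n. m \<ge> N \<Longrightarrow> n \<ge> N \<Longrightarrow> dist (X m) (X n) < e"
      using metric_CauchyD[OF \<open>Cauchy X\<close>] by blast
    have "dist (Rep_ell2 (X m) i) (Rep_ell2 (X n) i) < e" if "m \<ge> N" "n \<ge> N" for m n
      using norm_Rep_ell2_le[of "X m - X n" i] N[OF that] by (simp add: dist_norm)
    then show "\<exists>M. \<forall>m\<ge>M. \<forall>n\<ge>M. dist (Rep_ell2 (X m) i) (Rep_ell2 (X n) i) < e" by blast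
  qed
  then obtain L where L: "(\<lambda>n. Rep_ell2 (X n) i) \<longlonglongrightarrow> L i" for i
    unfolding Cauchy_convergent_iff convergent_def by metis
  have ex: "\<exists>N. \<forall>n\<ge>N. \<exists>h. Rep_ell2 h = (\<lambda>i. L i - Rep_ell2 (X n) i) \<and> norm h \<le> e" if "e > 0" for e
  proof -
    obtain N where N: "\<And>m n. m \<ge> N \<Longrightarrow> n \<ge> N \<Longrightarrow> dist (X m) (X n) < e"
      using metric_CauchyD[OF \<open>Cauchy X\<close> \<open>e > 0\<close>] by blast
    have "\<exists>h. Rep_ell2 h = (\<lambda>i. L i - Rep_ell2 (X n) i) \<and> norm h \<le> e" if n: "n \<ge> N" for n
    proof -
      \<comment> \<open>On a finite set of coordinates the Cauchy estimate for
        \<open>X m - X n\<close> survives the limit in \<open>m\<close>.\<close>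
      have "L2_set (\<lambda>i. cmod (L i - Rep_ell2 (X n) i)) F \<le> e" if F: "finite F" for F
      proof (rule LIMSEQ_le_const2)
        show "(\<lambda>m. L2_set (\<lambda>i. cmod (Rep_ell2 (X m) i - Rep_ell2 (X n) i)) F)
            \<longlonglongrightarrow> L2_set (\<lambda>i. cmod (L i - Rep_ell2 (X n) i)) F"
          unfolding L2_set_def by (intro tendsto_intros L)
        have "L2_set (\<lambda>i. cmod (Rep_ell2 (X m) i - Rep_ell2 (X n) i)) F \<le> e" if "m \<ge> N" for m
          using L2_set_le_norm_ell2[OF F, of "X m - X n"] N[OF that n] by (simp add: dist_norm)
        then show "\<exists>M. \<forall>m\<ge>M. L2_set (\<lambda>i. cmod (Rep_ell2 (X m) i - Rep_ell2 (X n) i)) F \<le> e"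
          by blast
      qed
      then show ?thesis using ell2_of_bounded by metis
    qed
    then show ?thesis by blast
  qed
  \<comment> \<open>A single square-summable difference \<open>L - X N\<close> already makes
    \<open>L\<close> square-summable.\<close>
  obtain N h0 where h0: "Rep_ell2 h0 = (\<lambda>i. L i - Rep_ell2 (X N) i)"
    using ex[of 1] by auto
  define l where "l = h0 + X N"
  have l: "Rep_ell2 l i = L i" for i unfolding l_def by (simp add: h0)
  have "X \<longlonglongrightarrow> l"
  proof (rule metric_LIMSEQ_I)
    fix e :: real assume "e > 0"
    then obtain M where M: "\<forall>n\<ge>M. \<exists>h. Rep_ell2 h = (\<lambda>i. L i - Rep_ell2 (X n) i) \<and> norm h \<le> e / 2"
      using ex[of "e / 2"] by auto
    have "dist (X n) l < e" if n: "n \<ge> M" for n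
    proof -
      obtain h where h: "Rep_ell2 h = (\<lambda>i. L i - Rep_ell2 (X n) i)" "norm h \<le> e / 2"
        using M n by blast
      have "h = l - X n" by (rule ell2_eqI) (simp add: h l)
      then show ?thesis using h(2) \<open>e > 0\<close> by (simp add: dist_norm norm_minus_commute)
    qed
    then show "\<exists>M. \<forall>n\<ge>M. dist (X n) l < e" by blast
  qed
  then show "convergent X" by (auto simp: convergent_def)
qed

section \<open>The inner product and expansions in the canonical basis\<close>

lemma sum_norm_cinner_le:
  assumes F: "finite F"
  shows "(\<Sum>i\<in>F. norm (cnj (Rep_ell2 f i) * Rep_ell2 g i)) \<le> norm f * norm g"
proof -
  have "(\<Sum>i\<in>F. norm (cnj (Rep_ell2 f i) * Rep_ell2 g i))
      = (\<Sum>i\<in>F. \<bar>cmod (Rep_ell2 f i)\<bar> * \<bar>cmod (Rep_ell2 g i)\<bar>)"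
    by (simp add: norm_mult)
  also have "\<dots> \<le> L2_set (\<lambda>i. cmod (Rep_ell2 f i)) F * L2_set (\<lambda>i. cmod (Rep_ell2 g i)) F"
    by (rule L2_set_mult_ineq)
  also have "\<dots> \<le> norm f * norm g"
    by (intro mult_mono L2_set_le_norm_ell2 F) auto
  finally show ?thesis .
qed

lemma cinner_abs_summable: "(\<lambda>i. norm (cnj (Rep_ell2 f i) * Rep_ell2 g i)) summable_on UNIV"
  by (rule nonneg_bdd_above_summable_on)
    (auto intro!: bdd_aboveI2[where M = "norm f * norm g"] sum_norm_cinner_le simp del: norm_mult)

lemma cinner_summable: "(\<lambda>i. cnj (Rep_ell2 f i) * Rep_ell2 g i) summable_on UNIV"
  by (rule abs_summable_summable[OF cinner_abs_summable])

lemma norm_cinner_le: "cmod (cinner f g) \<le> norm f * norm g"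
proof -
  have "cmod (cinner f g) \<le> (\<Sum>\<^sub>\<infinity>i. norm (cnj (Rep_ell2 f i) * Rep_ell2 g i))"
    unfolding cinner_def by (rule norm_infsum_bound[OF cinner_abs_summable])
  also have "\<dots> \<le> norm f * norm g"
    by (rule infsum_le_finite_sums[OF cinner_abs_summable sum_norm_cinner_le])
  finally show ?thesis .
qed

lemma cinner_add_right: "cinner f (g + h) = cinner f g + cinner f h"
  unfolding cinner_def
  by (simp add: distrib_left infsum_add[OF cinner_summable cinner_summable])

lemma cinner_scaleC_right [simp]: "cinner f (c *\<^sub>C g) = c * cinner f g"
proof -
  have "cinner f (c *\<^sub>C g) = (\<Sum>\<^sub>\<infinity>i. c * (cnj (Rep_ell2 f i) * Rep_ell2 g i))"
    unfolding cinner_def by (simp add: ac_simps)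
  then show ?thesis by (simp add: infsum_cmult_right' cinner_def)
qed

lemma cinner_commute: "cinner f g = cnj (cinner g f)"
proof -
  have "cnj (cinner g f) = (\<Sum>\<^sub>\<infinity>i. cnj (cnj (Rep_ell2 g i) * Rep_ell2 f i))"
    unfolding cinner_def infsum_cnj ..
  then show ?thesis by (simp add: cinner_def mult.commute)
qed

lemma cinner_add_left: "cinner (f + g) h = cinner f h + cinner g h"
  by (metis cinner_commute cinner_add_right complex_cnj_add)

lemma cinner_scaleC_left [simp]: "cinner (c *\<^sub>C f) g = cnj c * cinner f g"
  by (metis cinner_commute cinner_scaleC_right complex_cnj_mult)

lemma cinner_zero_right [simp]: "cinner f 0 = 0" and cinner_zero_left [simp]: "cinner 0 f = 0"
  by (simp_all add: cinner_def)

lemma cinner_minus_right: "cinner f (- g) = - cinner f g"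
  using cinner_add_right[of f g "- g"] by (simp add: add_eq_0_iff)

lemma cinner_diff_right: "cinner f (g - h) = cinner f g - cinner f h"
  unfolding diff_conv_add_uminus by (simp only: cinner_add_right cinner_minus_right)

lemma cinner_diff_left: "cinner (f - g) h = cinner f h - cinner g h"
  by (metis cinner_commute cinner_diff_right complex_cnj_diff)

lemma cinner_sum_right: "cinner f (\<Sum>x\<in>F. g x) = (\<Sum>x\<in>F. cinner f (g x))"
  by (induction F rule: infinite_finite_induct) (auto simp: cinner_add_right)

lemma cinner_sum_left: "cinner (\<Sum>x\<in>F. g x) f = (\<Sum>x\<in>F. cinner (g x) f)"
  by (induction F rule: infinite_finite_induct) (auto simp: cinner_add_left)

lemma cinner_self: "cinner f f = complex_of_real ((norm f)\<^sup>2)"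
proof -
  have "cinner f f = (\<Sum>\<^sub>\<infinity>i. complex_of_real ((cmod (Rep_ell2 f i))\<^sup>2))"
    unfolding cinner_def complex_norm_square by (simp add: mult.commute)
  moreover have "((\<lambda>i. complex_of_real ((cmod (Rep_ell2 f i))\<^sup>2)) has_sum complex_of_real ((norm f)\<^sup>2)) UNIV"
    unfolding norm_ell2_power2
    by (rule has_sum_bounded_linear[OF bounded_linear_of_real has_sum_infsum[OF square_summable_ell2]])
  ultimately show ?thesis by (simp only: infsumI)
qed

lemma cinner_ket_left [simp]: "cinner (ket i) f = Rep_ell2 f i"
proof -
  have "((\<lambda>j. cnj (Rep_ell2 (ket i) j) * Rep_ell2 f j) has_sum Rep_ell2 f i) UNIV"
    by (rule has_sum_finite_neutralI[where B = "{i}"]) auto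
  then show ?thesis unfolding cinner_def by (rule infsumI)
qed

lemma cinner_ket_right [simp]: "cinner f (ket i) = cnj (Rep_ell2 f i)"
  by (subst cinner_commute) simp

lemma cinner_eqI: "(\<And>h. cinner h f = cinner h g) \<Longrightarrow> f = g"
  by (rule ell2_eqI) (metis cinner_ket_left)

text \<open>The test vector \<open>g = f\<close> gives the bound after division by the norm of
  \<open>f\<close>.\<close>

lemma norm_leI:
  assumes "\<And>g. cmod (cinner g f) \<le> C * norm g"
  shows "norm f \<le> C"
proof (cases "f = 0")
  \<comment> \<open>For \<open>f = 0\<close> the claim is \<open>0 \<le> C\<close>, which the
    non-zero test vector \<open>ket undefined\<close> yields.\<close>
  case True
  have "cinner (ket undefined) f = 0" using True by simp
  moreover have "0 \<le> C * norm (ket undefined :: 'a ell2)"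
    using assms[of "ket undefined"] True by simp
  moreover have "ket undefined \<noteq> (0 :: 'a ell2)"
    
  proof
    assume "ket undefined = (0 :: 'a ell2)"
    then have "Rep_ell2 (ket undefined :: 'a ell2) undefined = Rep_ell2 0 (undefined :: 'a)" by simp
    then show False by simp
  qed
  ultimately show ?thesis using True by (simp add: zero_le_mult_iff)
next
  case False
  have "norm f * norm f \<le> C * norm f"
    using assms[of f] by (simp add: cinner_self power2_eq_square norm_mult)
  then show ?thesis using False by simp
qed

lemma bounded_linear_cinner_right: "bounded_linear (cinner f)"
  by (rule bounded_linear_intro[where K = "norm f"])
    (use norm_cinner_le[of f] in
      \<open>simp_all add: cinner_add_right scaleR_scaleC scaleC_complex_def mult.commute\<close>)

lemma norm_sum_ket: "norm (\<Sum>i\<in>F. c i *\<^sub>C ket i) = L2_set (\<lambda>i. cmod (c i)) F"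
proof (cases "finite F")
  case True
  have R: "Rep_ell2 (\<Sum>j\<in>F. c j *\<^sub>C ket j) i = c i" if "i \<in> F" for i
    using True that by (simp add: if_distrib[of "\<lambda>x. _ * x"] sum.delta cong: if_cong)
  have "cinner (\<Sum>i\<in>F. c i *\<^sub>C ket i) (\<Sum>i\<in>F. c i *\<^sub>C ket i) = (\<Sum>i\<in>F. cnj (c i) * c i)"
    unfolding cinner_sum_left[where F = F] by (rule sum.cong) (simp_all add: R del: Rep_ell2_sum)
  also have "\<dots> = (\<Sum>i\<in>F. complex_of_real ((cmod (c i))\<^sup>2))"
    unfolding complex_norm_square by (simp add: mult.commute)
  finally have "cinner (\<Sum>i\<in>F. c i *\<^sub>C ket i) (\<Sum>i\<in>F. c i *\<^sub>C ket i)
      = (\<Sum>i\<in>F. complex_of_real ((cmod (c i))\<^sup>2))" .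
  then have "(norm (\<Sum>i\<in>F. c i *\<^sub>C ket i))\<^sup>2 = (\<Sum>i\<in>F. (cmod (c i))\<^sup>2)"
    unfolding cinner_self of_real_sum[symmetric] of_real_eq_iff .
  then show ?thesis unfolding L2_set_def by (metis norm_ge_zero real_sqrt_unique)
qed simp

lemma norm_ket [simp]: "norm (ket i) = 1"
  using norm_sum_ket[of "\<lambda>_. 1" "{i}"] by simp

text \<open>By Pythagoras the squared distance of a finite partial sum from \<open>f\<close> is the
  squared norm of \<open>f\<close> minus a partial sum of the series that converges to it.\<close>

lemma has_sum_ket: "((\<lambda>i. Rep_ell2 f i *\<^sub>C ket i) has_sum f) UNIV"
proof -
  let ?s = "\<lambda>F. \<Sum>i\<in>F. Rep_ell2 f i *\<^sub>C ket i"
  have "(norm (?s F - f))\<^sup>2 = (norm f)\<^sup>2 - (\<Sum>i\<in>F. (cmod (Rep_ell2 f i))\<^sup>2)" if F: "finite F" for F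
  proof -
    have s: "cinner (?s F) f = complex_of_real (\<Sum>i\<in>F. (cmod (Rep_ell2 f i))\<^sup>2)"
      unfolding of_real_sum complex_norm_square
      by (simp only: cinner_sum_left cinner_scaleC_left cinner_ket_left mult.commute)
    have n: "(norm (?s F))\<^sup>2 = (\<Sum>i\<in>F. (cmod (Rep_ell2 f i))\<^sup>2)"
      unfolding norm_sum_ket L2_set_def by (simp add: sum_nonneg)
    have "complex_of_real ((norm (?s F - f))\<^sup>2)
        = complex_of_real ((norm (?s F))\<^sup>2) - cinner (?s F) f - cnj (cinner (?s F) f)
          + complex_of_real ((norm f)\<^sup>2)"
      unfolding cinner_self[symmetric] cinner_diff_left cinner_diff_right cinner_commute[of f "?s F"]
      by simp
    also have "\<dots> = complex_of_real ((norm f)\<^sup>2 - (\<Sum>i\<in>F. (cmod (Rep_ell2 f i))\<^sup>2))"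
      unfolding s n by simp
    finally show ?thesis unfolding of_real_eq_iff .
  qed
  then have ev: "\<forall>\<^sub>F F in finite_subsets_at_top UNIV.
      (norm (?s F - f))\<^sup>2 = (norm f)\<^sup>2 - (\<Sum>i\<in>F. (cmod (Rep_ell2 f i))\<^sup>2)"
    by (intro eventually_finite_subsets_at_top_weakI) auto
  have "((\<lambda>i. (cmod (Rep_ell2 f i))\<^sup>2) has_sum (norm f)\<^sup>2) UNIV"
    by (simp add: norm_ell2_power2)
  then have "((\<lambda>F. \<Sum>i\<in>F. (cmod (Rep_ell2 f i))\<^sup>2) \<longlongrightarrow> (norm f)\<^sup>2) (finite_subsets_at_top UNIV)"
    by (simp add: has_sum_def)
  then have "((\<lambda>F. (norm f)\<^sup>2 - (\<Sum>i\<in>F. (cmod (Rep_ell2 f i))\<^sup>2)) \<longlongrightarrow> (norm f)\<^sup>2 - (norm f)\<^sup>2)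
      (finite_subsets_at_top UNIV)"
    by (rule tendsto_diff[OF tendsto_const])
  then have "((\<lambda>F. (norm (?s F - f))\<^sup>2) \<longlongrightarrow> 0) (finite_subsets_at_top UNIV)"
    using tendsto_cong[OF ev] by simp
  then have "((\<lambda>F. sqrt ((norm (?s F - f))\<^sup>2)) \<longlongrightarrow> sqrt 0) (finite_subsets_at_top UNIV)"
    by (rule tendsto_real_sqrt)
  then have "((\<lambda>F. norm (?s F - f)) \<longlongrightarrow> 0) (finite_subsets_at_top UNIV)"
    by simp
  then show ?thesis
    unfolding has_sum_def by (rule LIM_zero_cancel[OF tendsto_norm_zero_cancel])
qed

text \<open>Formulated for functions instead of elements of the operator type, so that it also
  applies to inner products and tensor products with all arguments but one held fixed.\<close>

lemma bounded_clinear_eqI: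
  fixes F G :: "'i ell2 \<Rightarrow> 'b::complex_normed_vector"
  assumes F: "bounded_linear F" "\<And>c f. F (c *\<^sub>C f) = c *\<^sub>C F f"
    and G: "bounded_linear G" "\<And>c f. G (c *\<^sub>C f) = c *\<^sub>C G f"
    and eq: "\<And>k. F (ket k) = G (ket k)"
  shows "F f = G f"
proof -
  have "((\<lambda>i. Rep_ell2 f i *\<^sub>C F (ket i)) has_sum F f) UNIV"
    using has_sum_bounded_linear[OF F(1) has_sum_ket[of f]] by (simp add: F(2) o_def)
  moreover have "((\<lambda>i. Rep_ell2 f i *\<^sub>C F (ket i)) has_sum G f) UNIV"
    using has_sum_bounded_linear[OF G(1) has_sum_ket[of f]] by (simp add: G(2) o_def eq)
  ultimately show ?thesis by (rule has_sum_unique)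
qed

lemma clinear_opD: "clinear_op A \<Longrightarrow> A (c *\<^sub>C f) = c *\<^sub>C A f"
  by (simp add: clinear_op_def)

lemma clinear_op_eqI:
  fixes A B :: "'i ell2 \<Rightarrow>\<^sub>L 'b::complex_normed_vector"
  assumes "clinear_op A" "clinear_op B" "\<And>k. A (ket k) = B (ket k)"
  shows "A = B"
  by (rule blinfun_eqI, rule bounded_clinear_eqI)
    (use assms in \<open>auto simp: clinear_op_def blinfun.bounded_linear_right\<close>)

section \<open>Adjoints and tensor products of operators\<close>

text \<open>Without complex linearity the multiples \<open>c *\<^sub>C ket k\<close> have to be
  tested as well. The description defining \<open>tensor_op\<close> does not ask its candidates to
  be complex-linear, so its uniqueness rests on this form.\<close>

lemma bounded_linear_blinfun_of_ket_eqI: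
  fixes A B :: "'i ell2 \<Rightarrow>\<^sub>L 'b::complex_normed_vector"
  assumes eq: "\<And>c k. A (c *\<^sub>C ket k) = B (c *\<^sub>C ket k)"
  shows "A = B"
proof (rule blinfun_eqI)
  fix f
  have "((\<lambda>i. A (Rep_ell2 f i *\<^sub>C ket i)) has_sum A f) UNIV"
    by (rule has_sum_bounded_linear[OF blinfun.bounded_linear_right has_sum_ket])
  moreover have "((\<lambda>i. A (Rep_ell2 f i *\<^sub>C ket i)) has_sum B f) UNIV"
    unfolding eq by (rule has_sum_bounded_linear[OF blinfun.bounded_linear_right has_sum_ket])
  ultimately show "A f = B f" by (rule has_sum_unique)
qed

section \<open>Operators given by their columns, and adjoints\<close>

lemma blinfun_apply_sum_ket:
  "clinear_op A \<Longrightarrow> A (\<Sum>k\<in>F. c k *\<^sub>C f k) = (\<Sum>k\<in>F. c k *\<^sub>C A (f k))"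
  by (simp add: blinfun.sum_right clinear_opD)

text \<open>The operator obtained is the adjoint of the one sending \<open>ket k\<close> to
  \<open>w k\<close>. Its coordinates are explicit inner products, so no limit is involved in
  defining it.\<close>

lemma operator_from_columns:
  fixes w :: "'k \<Rightarrow> 'i ell2"
  assumes bd: "\<And>F c. finite F \<Longrightarrow> norm (\<Sum>k\<in>F. c k *\<^sub>C w k) \<le> C * L2_set (\<lambda>k. cmod (c k)) F"
  obtains Y :: "'i ell2 \<Rightarrow>\<^sub>L 'k ell2" where "\<And>h k. Rep_ell2 (Y h) k = cinner (w k) h" "clinear_op Y"
    "norm Y \<le> C"
proof -
  have "norm (w undefined) \<le> C" using bd[of "{undefined}" "\<lambda>_. 1"] by simp
  then have C: "0 \<le> C" by (rule order_trans[OF norm_ge_zero])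
  have "L2_set (\<lambda>k. cmod (cinner (w k) h)) F \<le> C * norm h" if F: "finite F" for F h
  proof -
    \<comment> \<open>These are the extremal coefficients: paired with \<open>h\<close>, the
      combination of the \<open>w k\<close> gives exactly the square of \<open>?L\<close>, and one
      factor \<open>?L\<close> cancels against the hypothesis.\<close>
    let ?c = "\<lambda>k. cinner (w k) h" and ?L = "L2_set (\<lambda>k. cmod (cinner (w k) h)) F"
    have "cinner (\<Sum>k\<in>F. ?c k *\<^sub>C w k) h = (\<Sum>k\<in>F. complex_of_real ((cmod (?c k))\<^sup>2))"
      unfolding complex_norm_square by (simp add: cinner_sum_left mult.commute)
    also have "\<dots> = complex_of_real (?L\<^sup>2)"
      unfolding L2_set_def by (simp add: sum_nonneg)
    finally have "?L\<^sup>2 = cmod (cinner (\<Sum>k\<in>F. ?c k *\<^sub>C w k) h)"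
      by (metis abs_of_nonneg norm_of_real zero_le_power2)
    also have "\<dots> \<le> norm (\<Sum>k\<in>F. ?c k *\<^sub>C w k) * norm h" by (rule norm_cinner_le)
    also have "\<dots> \<le> C * ?L * norm h" by (intro mult_right_mono bd F) simp
    finally have "?L * ?L \<le> (C * norm h) * ?L" by (simp add: power2_eq_square ac_simps)
    then show ?thesis
      using C by (cases "?L = 0") (auto simp: less_le)
  qed
  then have "\<exists>y. Rep_ell2 y = (\<lambda>k. cinner (w k) h) \<and> norm y \<le> C * norm h" for h
    using ell2_of_bounded by metis
  then obtain y where y: "\<And>h. Rep_ell2 (y h) = (\<lambda>k. cinner (w k) h)" "\<And>h. norm (y h) \<le> C * norm h"
    by metis
  have yc: "y (c *\<^sub>C h) = c *\<^sub>C y h" for c h by (rule ell2_eqI) (simp add: y)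
  have bl: "bounded_linear y"
  proof (rule bounded_linear_intro[where K = C])
    show "y (g + h) = y g + y h" for g h by (rule ell2_eqI) (simp add: y cinner_add_right)
    show "y (r *\<^sub>R h) = r *\<^sub>R y h" for r h by (simp add: scaleR_scaleC yc)
    show "norm (y h) \<le> norm h * C" for h using y(2)[of h] by (simp add: mult.commute)
  qed
  show thesis
  proof
    show "Rep_ell2 (Blinfun y h) k = cinner (w k) h" for h k
      by (simp add: bounded_linear_Blinfun_apply[OF bl] y)
    show "clinear_op (Blinfun y)"
      by (simp add: clinear_op_def bounded_linear_Blinfun_apply[OF bl] yc)
    show "norm (Blinfun y) \<le> C"
      by (rule norm_blinfun_bound[OF C]) (simp add: bounded_linear_Blinfun_apply[OF bl] y)
  qed
qed

text \<open>The columns of \<open>A\<close> determine the coordinates of the adjoint, which makes a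
  Riesz representation argument unnecessary.\<close>

lemma adj_exists:
  fixes A :: "'i ell2 \<Rightarrow>\<^sub>L 'j ell2"
  assumes A: "clinear_op A"
  obtains B :: "'j ell2 \<Rightarrow>\<^sub>L 'i ell2" where "\<And>f g. cinner (B f) g = cinner f (A g)" "clinear_op B"
    "norm B \<le> norm A"
proof -
  have "norm (\<Sum>k\<in>F. c k *\<^sub>C A (ket k)) \<le> norm A * L2_set (\<lambda>k. cmod (c k)) F" for F c
    using norm_blinfun[of A "\<Sum>k\<in>F. c k *\<^sub>C ket k"]
    by (simp add: blinfun_apply_sum_ket[OF A] norm_sum_ket)
  then obtain Y :: "'j ell2 \<Rightarrow>\<^sub>L 'i ell2"
    where Y: "\<And>h k. Rep_ell2 (Y h) k = cinner (A (ket k)) h" "clinear_op Y" "norm Y \<le> norm A"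
    using operator_from_columns[of "\<lambda>k. A (ket k)" "norm A"] by blast
  have "cinner (Y f) g = cinner f (A g)" for f g
  proof (rule bounded_clinear_eqI[where F = "cinner (Y f)" and G = "\<lambda>g. cinner f (A g)"])
    show "bounded_linear (\<lambda>g. cinner f (A g))"
      by (rule bounded_linear_compose[OF bounded_linear_cinner_right blinfun.bounded_linear_right])
    show "cinner (Y f) (ket k) = cinner f (A (ket k))" for k
      by (simp add: Y cinner_commute[of f])
  qed (simp_all add: bounded_linear_cinner_right clinear_opD[OF A] scaleC_complex_def)
  with Y that show thesis by blast
qed

lemma adj_eqI:
  fixes A :: "'i ell2 \<Rightarrow>\<^sub>L 'j ell2" and B :: "'j ell2 \<Rightarrow>\<^sub>L 'i ell2"
  assumes "\<And>f g. cinner (B f) g = cinner f (A g)"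
  shows "adj A = B"
  unfolding adj_def
proof (rule the_equality)
  fix B' :: "'j ell2 \<Rightarrow>\<^sub>L 'i ell2" assume B': "\<forall>f g. cinner (B' f) g = cinner f (A g)"
  show "B' = B"
  proof (rule blinfun_eqI, rule cinner_eqI)
    show "cinner h (B' f) = cinner h (B f)" for h f
      using assms B' by (metis cinner_commute)
  qed
qed (use assms in auto)

lemma
  fixes A :: "'i ell2 \<Rightarrow>\<^sub>L 'j ell2"
  assumes A: "clinear_op A"
  shows cinner_adj_left: "cinner (adj A f) g = cinner f (A g)"
    and clinear_op_adj: "clinear_op (adj A)"
    and norm_adj_le: "norm (adj A) \<le> norm A"
proof -
  obtain B :: "'j ell2 \<Rightarrow>\<^sub>L 'i ell2"
    where "\<And>f g. cinner (B f) g = cinner f (A g)" "clinear_op B" "norm B \<le> norm A"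
    using adj_exists[OF A] by blast
  moreover from this(1) have "adj A = B" by (rule adj_eqI)
  ultimately show "cinner (adj A f) g = cinner f (A g)" "clinear_op (adj A)" "norm (adj A) \<le> norm A"
    by auto
qed

lemma cinner_adj_right: "clinear_op A \<Longrightarrow> cinner f (adj A g) = cinner (A f) g"
  by (metis cinner_adj_left cinner_commute)

lemma adj_adj: "clinear_op A \<Longrightarrow> adj (adj A) = A"
  by (rule adj_eqI) (simp add: cinner_adj_right)

lemma clinear_op_0 [simp]: "clinear_op 0"
  by (simp add: clinear_op_def)
lemma clinear_op_add: "clinear_op A \<Longrightarrow> clinear_op B \<Longrightarrow> clinear_op (A + B)"
  by (simp add: clinear_op_def blinfun.add_left scaleC_add_right)
lemma clinear_op_scaleC: "clinear_op A \<Longrightarrow> clinear_op (c *\<^sub>C A)"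
  by (simp add: clinear_op_def scaleC_scaleC mult.commute)
lemma clinear_op_compose: "clinear_op A \<Longrightarrow> clinear_op B \<Longrightarrow> clinear_op (A o\<^sub>L B)"
  by (simp add: clinear_op_def)

lemma adj_add: "clinear_op A \<Longrightarrow> clinear_op B \<Longrightarrow> adj (A + B) = adj A + adj B"
  by (rule adj_eqI) (simp add: cinner_adj_left blinfun.add_left cinner_add_left cinner_add_right)
lemma adj_scaleC: "clinear_op A \<Longrightarrow> adj (c *\<^sub>C A) = cnj c *\<^sub>C adj A"
  by (rule adj_eqI) (simp add: cinner_adj_left)
lemma adj_compose: "clinear_op A \<Longrightarrow> clinear_op B \<Longrightarrow> adj (A o\<^sub>L B) = adj B o\<^sub>L adj A"
  by (rule adj_eqI) (simp add: cinner_adj_left clinear_op_adj)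
lemma adj_0 [simp]: "adj 0 = 0"
  by (rule adj_eqI) simp

lemma Rep_adj_ket:
  "clinear_op A \<Longrightarrow> Rep_ell2 (adj A (ket k)) l = cnj (Rep_ell2 (A (ket l)) k)"
  using cinner_adj_right[of A "ket l" "ket k"] by simp

lemma adj_eq_ketI:
  assumes A: "clinear_op A" and B: "clinear_op B"
    and eq: "\<And>k l. Rep_ell2 (B (ket k)) l = cnj (Rep_ell2 (A (ket l)) k)"
  shows "adj A = B"
proof (rule clinear_op_eqI[OF clinear_op_adj[OF A] B], rule ell2_eqI)
  show "Rep_ell2 (adj A (ket k)) l = Rep_ell2 (B (ket k)) l" for k l
    by (simp add: Rep_adj_ket[OF A] eq)
qed

text \<open>The operator with prescribed columns is the adjoint of the one from
  \<open>operator_from_columns\<close>, with the same norm bound.\<close>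

lemma operator_on_kets:
  fixes w :: "'k \<Rightarrow> 'i ell2"
  assumes bd: "\<And>F c. finite F \<Longrightarrow> norm (\<Sum>k\<in>F. c k *\<^sub>C w k) \<le> C * L2_set (\<lambda>k. cmod (c k)) F"
  obtains X :: "'k ell2 \<Rightarrow>\<^sub>L 'i ell2" where "clinear_op X" "norm X \<le> C" "\<And>k. X (ket k) = w k"
proof -
  obtain Y :: "'i ell2 \<Rightarrow>\<^sub>L 'k ell2"
    where Y: "\<And>h k. Rep_ell2 (Y h) k = cinner (w k) h" "clinear_op Y" "norm Y \<le> C"
    using operator_from_columns[OF bd] by blast
  show thesis
  proof
    show "clinear_op (adj Y)" by (rule clinear_op_adj[OF Y(2)])
    show "norm (adj Y) \<le> C" using norm_adj_le[OF Y(2)] Y(3) by linarith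
    have "Rep_ell2 (adj Y (ket k)) i = Rep_ell2 (w k) i" for k i
      by (simp add: Rep_adj_ket[OF Y(2)] Y(1))
    then show "adj Y (ket k) = w k" for k by (rule ell2_eqI)
  qed
qed

text \<open>Translations, multiplication operators and the flip of a tensor product are all
  constructed from this lemma. Distinct basis vectors with non-zero weight have orthogonal images,
  so the norm is controlled by the weights.\<close>

lemma weighted_shift_exists:
  fixes p :: "'k \<Rightarrow> 'i"
  assumes inj: "inj_on p {k. s k \<noteq> 0}" and C: "\<And>k. cmod (s k) \<le> C"
  obtains X :: "'k ell2 \<Rightarrow>\<^sub>L 'i ell2"
  where "clinear_op X" "norm X \<le> C" "\<And>k. X (ket k) = s k *\<^sub>C ket (p k)"
proof -
  have C0: "0 \<le> C" using C[of undefined] norm_ge_zero order_trans by blast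
  have "norm (\<Sum>k\<in>F. c k *\<^sub>C s k *\<^sub>C ket (p k)) \<le> C * L2_set (\<lambda>k. cmod (c k)) F" if F: "finite F" for F c
  proof -
    \<comment> \<open>The map \<open>p\<close> is injective only where the weight is non-zero, so
      the vanishing terms are discarded before reindexing.\<close>
    let ?F = "{k \<in> F. s k \<noteq> 0}"
    let ?q = "the_inv_into ?F p"
    have inj': "inj_on p ?F" by (rule inj_on_subset[OF inj]) auto
    have q: "?q (p k) = k" if "k \<in> ?F" for k by (rule the_inv_into_f_f[OF inj' that])
    have "(\<Sum>k\<in>F. c k *\<^sub>C s k *\<^sub>C ket (p k)) = (\<Sum>k\<in>?F. c k *\<^sub>C s k *\<^sub>C ket (p k))"
      using F by (intro sum.mono_neutral_right) auto
    also have "\<dots> = (\<Sum>j\<in>p ` ?F. (c (?q j) * s (?q j)) *\<^sub>C ket j)"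
      unfolding sum.reindex[OF inj'] by (rule sum.cong) (simp_all add: q scaleC_scaleC)
    finally have "norm (\<Sum>k\<in>F. c k *\<^sub>C s k *\<^sub>C ket (p k))
        = L2_set (\<lambda>j. cmod (c (?q j) * s (?q j))) (p ` ?F)"
      by (simp add: norm_sum_ket)
    also have "\<dots> = L2_set (\<lambda>k. cmod (c k * s k)) ?F"
      unfolding L2_set_def sum.reindex[OF inj']
      by (rule arg_cong[where f = sqrt], rule sum.cong) (simp_all add: q)
    also have "\<dots> \<le> L2_set (\<lambda>k. C * cmod (c k)) ?F"
    proof (rule L2_set_mono)
      show "cmod (c k * s k) \<le> C * cmod (c k)" for k
        using mult_left_mono[OF C norm_ge_zero, of "c k" k] by (simp add: norm_mult mult.commute)
    qed simp
    also have "\<dots> \<le> L2_set (\<lambda>k. C * cmod (c k)) F"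
      unfolding L2_set_def using F by (intro real_sqrt_le_mono sum_mono2) auto
    also have "\<dots> = C * L2_set (\<lambda>k. cmod (c k)) F"
      using C0 by (simp add: L2_set_right_distrib)
    finally show ?thesis .
  qed
  from operator_on_kets[OF this] that show thesis by blast
qed

section \<open>Tensor products of vectors and block operators\<close>

lemma Rep_tensor_vec [simp]: "Rep_ell2 (f \<otimes>\<^sub>v g) (i, j) = Rep_ell2 f i * Rep_ell2 g j"
  by (simp add: tensor_vec.rep_eq)

lemma tensor_vec_eqI:
  fixes x y :: "('i \<times> 'j) ell2"
  shows "(\<And>i j. Rep_ell2 x (i, j) = Rep_ell2 y (i, j)) \<Longrightarrow> x = y"
  by (rule ell2_eqI) (metis surj_pair)

lemma tensor_vec_add_left: "(f + f') \<otimes>\<^sub>v g = f \<otimes>\<^sub>v g + f' \<otimes>\<^sub>v g"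
  and tensor_vec_add_right: "f \<otimes>\<^sub>v (g + g') = f \<otimes>\<^sub>v g + f \<otimes>\<^sub>v g'"
  and tensor_vec_scaleC_left: "(c *\<^sub>C f) \<otimes>\<^sub>v g = c *\<^sub>C (f \<otimes>\<^sub>v g)"
  and tensor_vec_scaleC_right: "f \<otimes>\<^sub>v (c *\<^sub>C g) = c *\<^sub>C (f \<otimes>\<^sub>v g)"
  and tensor_vec_zero_left [simp]: "0 \<otimes>\<^sub>v g = 0"
  and tensor_vec_zero_right [simp]: "f \<otimes>\<^sub>v 0 = 0"
  and tensor_vec_ket [simp]: "ket i \<otimes>\<^sub>v ket j = ket (i, j)"
  by (rule tensor_vec_eqI; simp add: algebra_simps)+

lemma norm_tensor_vec_le: "norm (f \<otimes>\<^sub>v g) \<le> norm f * norm g"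
proof -
  have "L2_set (\<lambda>p. cmod (Rep_ell2 (f \<otimes>\<^sub>v g) p)) F \<le> norm f * norm g" if F: "finite F" for F
  proof -
    let ?I = "fst ` F" and ?J = "snd ` F"
    have "L2_set (\<lambda>p. cmod (Rep_ell2 (f \<otimes>\<^sub>v g) p)) F \<le> L2_set (\<lambda>p. cmod (Rep_ell2 (f \<otimes>\<^sub>v g) p)) (?I \<times> ?J)"
      unfolding L2_set_def
      by (intro real_sqrt_le_mono sum_mono2) (use F subset_fst_snd[of F] in auto)
    also have "\<dots> = L2_set (\<lambda>i. cmod (Rep_ell2 f i)) ?I * L2_set (\<lambda>j. cmod (Rep_ell2 g j)) ?J"
      unfolding L2_set_def real_sqrt_mult[symmetric]
      by (simp add: sum_product sum.cartesian_product norm_mult power_mult_distrib case_prod_beta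
          tensor_vec.rep_eq)
    also have "\<dots> \<le> norm f * norm g"
      by (intro mult_mono L2_set_le_norm_ell2) (use F in auto)
    finally show ?thesis .
  qed
  then obtain h where "Rep_ell2 h = Rep_ell2 (f \<otimes>\<^sub>v g)" "norm h \<le> norm f * norm g"
    by (rule ell2_of_bounded)
  then show ?thesis by (metis Rep_ell2_inject)
qed

lemma bounded_linear_tensor_vec_left: "bounded_linear (\<lambda>f. f \<otimes>\<^sub>v g)"
  by (rule bounded_linear_intro[where K = "norm g"])
    (simp_all add: tensor_vec_add_left scaleR_scaleC tensor_vec_scaleC_left norm_tensor_vec_le)

lemma bounded_linear_tensor_vec_right: "bounded_linear (\<lambda>g. f \<otimes>\<^sub>v g)"
  by (rule bounded_linear_intro[where K = "norm f"])
    (use norm_tensor_vec_le[of f] in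
      \<open>simp_all add: tensor_vec_add_right scaleR_scaleC tensor_vec_scaleC_right mult.commute\<close>)

text \<open>Both sides are bounded and linear in \<open>f'\<close> and in \<open>g'\<close>, so each
  of the two can be replaced by a basis vector in turn.\<close>

lemma cinner_tensor_vec: "cinner (f \<otimes>\<^sub>v g) (f' \<otimes>\<^sub>v g') = cinner f f' * cinner g g'"
proof (rule bounded_clinear_eqI[where F = "\<lambda>g'. cinner (f \<otimes>\<^sub>v g) (f' \<otimes>\<^sub>v g')"])
  fix j
  show "cinner (f \<otimes>\<^sub>v g) (f' \<otimes>\<^sub>v ket j) = cinner f f' * cinner g (ket j)"
  proof (rule bounded_clinear_eqI[where F = "\<lambda>f'. cinner (f \<otimes>\<^sub>v g) (f' \<otimes>\<^sub>v ket j)"])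
    show "bounded_linear (\<lambda>f'. cinner (f \<otimes>\<^sub>v g) (f' \<otimes>\<^sub>v ket j))"
      by (rule bounded_linear_compose[OF bounded_linear_cinner_right bounded_linear_tensor_vec_left])
    show "bounded_linear (\<lambda>f'. cinner f f' * cinner g (ket j))"
      by (rule bounded_linear_mult_left[THEN bounded_linear_compose, OF bounded_linear_cinner_right])
  qed (simp_all add: tensor_vec_scaleC_left scaleC_complex_def)
next
  show "bounded_linear (\<lambda>g'. cinner (f \<otimes>\<^sub>v g) (f' \<otimes>\<^sub>v g'))"
    by (rule bounded_linear_compose[OF bounded_linear_cinner_right bounded_linear_tensor_vec_right])
  show "bounded_linear (\<lambda>g'. cinner f f' * cinner g g')"
    by (rule bounded_linear_mult_right[THEN bounded_linear_compose, OF bounded_linear_cinner_right])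
qed (simp_all add: tensor_vec_scaleC_right scaleC_complex_def)

lemma norm_tensor_vec [simp]: "norm (f \<otimes>\<^sub>v g) = norm f * norm g"
proof -
  have "complex_of_real ((norm (f \<otimes>\<^sub>v g))\<^sup>2) = complex_of_real ((norm f * norm g)\<^sup>2)"
    unfolding cinner_self[symmetric] cinner_tensor_vec by (simp add: cinner_self power_mult_distrib)
  then show ?thesis unfolding of_real_eq_iff by (simp add: power2_eq_iff_nonneg)
qed

text \<open>Summands with different second basis vectors are orthogonal.\<close>

lemma norm_sum_tensor_ket:
  "norm (\<Sum>j\<in>J. f j \<otimes>\<^sub>v ket j) = L2_set (\<lambda>j. norm (f j)) J"
proof (cases "finite J")
  case True
  have "cinner (\<Sum>j\<in>J. f j \<otimes>\<^sub>v ket j) (\<Sum>j\<in>J. f j \<otimes>\<^sub>v ket j)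
      = (\<Sum>j\<in>J. \<Sum>l\<in>J. if j = l then complex_of_real ((norm (f j))\<^sup>2) else 0)"
    unfolding cinner_sum_left cinner_sum_right
    by (intro sum.cong) (auto simp: cinner_tensor_vec cinner_self)
  then have "(norm (\<Sum>j\<in>J. f j \<otimes>\<^sub>v ket j))\<^sup>2 = (\<Sum>j\<in>J. (norm (f j))\<^sup>2)"
    unfolding cinner_self using True by (simp add: of_real_sum[symmetric] del: of_real_sum of_real_power)
  then show ?thesis unfolding L2_set_def by (metis norm_ge_zero real_sqrt_unique)
qed simp

text \<open>Padding \<open>F\<close> to a rectangle with zero coefficients collects, for each
  \<open>j\<close>, one vector of the first factor, so that a block operator can be estimated block
  by block.\<close>

lemma sum_over_blocks:
  fixes c :: "'i \<times> 'j \<Rightarrow> complex" and G :: "'i \<Rightarrow> 'j \<Rightarrow> 'b::complex_normed_vector"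
  assumes "finite F"
  shows "(\<Sum>p\<in>F. c p *\<^sub>C G (fst p) (snd p))
    = (\<Sum>j\<in>snd ` F. \<Sum>i\<in>fst ` F. (if (i, j) \<in> F then c (i, j) else 0) *\<^sub>C G i j)"
proof -
  have "(\<Sum>p\<in>F. c p *\<^sub>C G (fst p) (snd p))
      = (\<Sum>p\<in>fst ` F \<times> snd ` F. (if p \<in> F then c p else 0) *\<^sub>C G (fst p) (snd p))"
    using assms subset_fst_snd[of F] by (intro sum.mono_neutral_cong_left) auto
  also have "\<dots> = (\<Sum>i\<in>fst ` F. \<Sum>j\<in>snd ` F. (if (i, j) \<in> F then c (i, j) else 0) *\<^sub>C G i j)"
    unfolding sum.cartesian_product by (rule sum.cong) auto
  also have "\<dots> = (\<Sum>j\<in>snd ` F. \<Sum>i\<in>fst ` F. (if (i, j) \<in> F then c (i, j) else 0) *\<^sub>C G i j)"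
    by (rule sum.swap)
  finally show ?thesis .
qed

text \<open>This is the direct sum of the \<open>A j\<close>, one for each second basis vector. A
  constant family gives \<open>A \<otimes> 1\<close>; a varying one gives the operators that bound
  \<open>tensor_map\<close> in \<open>tensor_map_mult_op\<close>.\<close>

lemma block_operator_exists:
  fixes A :: "'j \<Rightarrow> ('i ell2 \<Rightarrow>\<^sub>L 'k ell2)"
  assumes A: "\<And>j. clinear_op (A j)" and C: "\<And>j. norm (A j) \<le> C"
  obtains X :: "('i \<times> 'j) ell2 \<Rightarrow>\<^sub>L ('k \<times> 'j) ell2"
  where "clinear_op X" "norm X \<le> C" "\<And>f j. X (f \<otimes>\<^sub>v ket j) = A j f \<otimes>\<^sub>v ket j"
proof -
  have C0: "0 \<le> C" using C[of undefined] norm_ge_zero order_trans by blast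
  have bd: "norm (\<Sum>p\<in>F. c p *\<^sub>C (A (snd p) (ket (fst p)) \<otimes>\<^sub>v ket (snd p)))
      \<le> C * L2_set (\<lambda>p. cmod (c p)) F" if F: "finite F" for F c
  proof -
    \<comment> \<open>\<open>v j\<close> is the component of the vector with coefficients
      \<open>c\<close> in block \<open>j\<close>.\<close>
    define v where "v j = (\<Sum>i\<in>fst ` F. (if (i, j) \<in> F then c (i, j) else 0) *\<^sub>C ket i)" for j
    have lin: "(\<Sum>i\<in>fst ` F. d i *\<^sub>C (h i \<otimes>\<^sub>v ket j)) = (\<Sum>i\<in>fst ` F. d i *\<^sub>C h i) \<otimes>\<^sub>v ket j"
      for d and h :: "'i \<Rightarrow> 'x ell2" and j :: 'j
      by (simp add: bounded_linear.linear[OF bounded_linear_tensor_vec_left, THEN linear_sum]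
          tensor_vec_scaleC_left)
    have "(\<Sum>p\<in>F. c p *\<^sub>C (A (snd p) (ket (fst p)) \<otimes>\<^sub>v ket (snd p)))
        = (\<Sum>j\<in>snd ` F. A j (v j) \<otimes>\<^sub>v ket j)"
      unfolding sum_over_blocks[OF F, of c "\<lambda>i j. A j (ket i) \<otimes>\<^sub>v ket j"]
      by (rule sum.cong) (simp_all only: lin v_def blinfun_apply_sum_ket[OF A])
    then have "norm (\<Sum>p\<in>F. c p *\<^sub>C (A (snd p) (ket (fst p)) \<otimes>\<^sub>v ket (snd p)))
        = L2_set (\<lambda>j. norm (A j (v j))) (snd ` F)"
      by (simp only: norm_sum_tensor_ket)
    also have "\<dots> \<le> L2_set (\<lambda>j. C * norm (v j)) (snd ` F)"
    proof (rule L2_set_mono)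
      show "norm (A j (v j)) \<le> C * norm (v j)" for j
        using norm_blinfun[of "A j" "v j"] mult_right_mono[OF C norm_ge_zero, of j "v j"] by linarith
    qed simp
    also have "\<dots> = C * norm (\<Sum>j\<in>snd ` F. v j \<otimes>\<^sub>v ket j)"
      using C0 by (simp add: L2_set_right_distrib norm_sum_tensor_ket)
    also have "(\<Sum>j\<in>snd ` F. v j \<otimes>\<^sub>v ket j) = (\<Sum>p\<in>F. c p *\<^sub>C ket p)"
      using sum_over_blocks[OF F, of c "\<lambda>i j. ket (i, j)"]
      by (simp only: v_def lin[symmetric] tensor_vec_ket prod.collapse)
    finally show ?thesis by (simp only: norm_sum_ket)
  qed
  obtain X :: "('i \<times> 'j) ell2 \<Rightarrow>\<^sub>L ('k \<times> 'j) ell2" where X: "clinear_op X" "norm X \<le> C"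
      "\<And>p. X (ket p) = A (snd p) (ket (fst p)) \<otimes>\<^sub>v ket (snd p)"
    using operator_on_kets[OF bd] by blast
  have "X (f \<otimes>\<^sub>v ket j) = A j f \<otimes>\<^sub>v ket j" for f j
  proof (rule bounded_clinear_eqI[where F = "\<lambda>f. X (f \<otimes>\<^sub>v ket j)"])
    show "bounded_linear (\<lambda>f. X (f \<otimes>\<^sub>v ket j))"
      by (rule bounded_linear_compose[OF blinfun.bounded_linear_right bounded_linear_tensor_vec_left])
    show "bounded_linear (\<lambda>f. A j f \<otimes>\<^sub>v ket j)"
      by (rule bounded_linear_compose[OF bounded_linear_tensor_vec_left blinfun.bounded_linear_right])
  qed (simp_all add: X tensor_vec_scaleC_left clinear_opD[OF A] clinear_opD[OF X(1)])
  with X that show thesis by blast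
qed

lemma tensor_ext_kets:
  assumes X: "clinear_op X" and P: "clinear_op P" and Q: "clinear_op Q"
    and eq: "\<And>i j. X (ket (i, j)) = P (ket i) \<otimes>\<^sub>v Q (ket j)"
  shows "X (f \<otimes>\<^sub>v g) = P f \<otimes>\<^sub>v Q g"
proof (rule bounded_clinear_eqI[where F = "\<lambda>g. X (f \<otimes>\<^sub>v g)"])
  fix j
  show "X (f \<otimes>\<^sub>v ket j) = P f \<otimes>\<^sub>v Q (ket j)"
  proof (rule bounded_clinear_eqI[where F = "\<lambda>f. X (f \<otimes>\<^sub>v ket j)"])
    show "bounded_linear (\<lambda>f. X (f \<otimes>\<^sub>v ket j))"
      by (rule bounded_linear_compose[OF blinfun.bounded_linear_right bounded_linear_tensor_vec_left])
    show "bounded_linear (\<lambda>f. P f \<otimes>\<^sub>v Q (ket j))"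
      by (rule bounded_linear_compose[OF bounded_linear_tensor_vec_left blinfun.bounded_linear_right])
  qed (simp_all add: tensor_vec_scaleC_left clinear_opD[OF X] clinear_opD[OF P] eq)
next
  show "bounded_linear (\<lambda>g. X (f \<otimes>\<^sub>v g))"
    by (rule bounded_linear_compose[OF blinfun.bounded_linear_right bounded_linear_tensor_vec_right])
  show "bounded_linear (\<lambda>g. P f \<otimes>\<^sub>v Q g)"
    by (rule bounded_linear_compose[OF bounded_linear_tensor_vec_right blinfun.bounded_linear_right])
qed (simp_all add: tensor_vec_scaleC_right clinear_opD[OF X] clinear_opD[OF Q])

lemma swap_operator_exists:
  obtains W :: "('i \<times> 'j) ell2 \<Rightarrow>\<^sub>L ('j \<times> 'i) ell2"
  where "clinear_op W" "norm W \<le> 1" "\<And>f g. W (f \<otimes>\<^sub>v g) = g \<otimes>\<^sub>v f"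
proof -
  obtain W :: "('i \<times> 'j) ell2 \<Rightarrow>\<^sub>L ('j \<times> 'i) ell2"
    where W: "clinear_op W" "norm W \<le> 1" "\<And>k. W (ket k) = 1 *\<^sub>C ket (prod.swap k)"
    using weighted_shift_exists[of prod.swap "\<lambda>_. 1" 1] by (auto simp: inj_on_def)
  have "W (f \<otimes>\<^sub>v g) = g \<otimes>\<^sub>v f" for f g
  proof (rule bounded_clinear_eqI[where F = "\<lambda>g. W (f \<otimes>\<^sub>v g)"])
    fix j
    show "W (f \<otimes>\<^sub>v ket j) = ket j \<otimes>\<^sub>v f"
    proof (rule bounded_clinear_eqI[where F = "\<lambda>f. W (f \<otimes>\<^sub>v ket j)"])
      show "bounded_linear (\<lambda>f. W (f \<otimes>\<^sub>v ket j))"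
        by (rule bounded_linear_compose[OF blinfun.bounded_linear_right bounded_linear_tensor_vec_left])
    qed (simp_all add: tensor_vec_scaleC_left tensor_vec_scaleC_right bounded_linear_tensor_vec_right
        clinear_opD[OF W(1)] W(3))
  next
    show "bounded_linear (\<lambda>g. W (f \<otimes>\<^sub>v g))"
      by (rule bounded_linear_compose[OF blinfun.bounded_linear_right bounded_linear_tensor_vec_right])
  qed (simp_all add: tensor_vec_scaleC_left tensor_vec_scaleC_right bounded_linear_tensor_vec_left
        clinear_opD[OF W(1)])
  with W that show thesis by blast
qed

section \<open>Tensor products of operators\<close>

lemma tensor_op_unique:
  fixes X Y :: "('i \<times> 'j) ell2 \<Rightarrow>\<^sub>L 'b::complex_normed_vector"
  assumes "\<And>f g. X (f \<otimes>\<^sub>v g) = Y (f \<otimes>\<^sub>v g)"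
  shows "X = Y"
proof (rule bounded_linear_blinfun_of_ket_eqI)
  fix c :: complex and k :: "'i \<times> 'j"
  have "c *\<^sub>C ket k = (c *\<^sub>C ket (fst k)) \<otimes>\<^sub>v ket (snd k)"
    by (simp add: tensor_vec_scaleC_left)
  then show "X (c *\<^sub>C ket k) = Y (c *\<^sub>C ket k)" by (simp only: assms)
qed

text \<open>Block operators only provide a tensor factor on the left, so the flips \<open>W\<close>
  and \<open>W'\<close> move the second one there:
  \<open>A \<otimes> B = (A \<otimes> 1) W' (B \<otimes> 1) W\<close>.\<close>

lemma tensor_op_exists:
  fixes A :: "'i ell2 \<Rightarrow>\<^sub>L 'i ell2" and B :: "'j ell2 \<Rightarrow>\<^sub>L 'j ell2"
  assumes A: "clinear_op A" and B: "clinear_op B"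
  obtains X where "clinear_op X" "norm X \<le> norm A * norm B" "\<And>f g. X (f \<otimes>\<^sub>v g) = A f \<otimes>\<^sub>v B g"
proof -
  obtain P :: "('i \<times> 'j) ell2 \<Rightarrow>\<^sub>L ('i \<times> 'j) ell2" where P: "clinear_op P" "norm P \<le> norm A"
      "\<And>f j. P (f \<otimes>\<^sub>v ket j) = A f \<otimes>\<^sub>v ket j"
    using block_operator_exists[of "\<lambda>_. A" "norm A"] A by auto
  obtain Q :: "('j \<times> 'i) ell2 \<Rightarrow>\<^sub>L ('j \<times> 'i) ell2" where Q: "clinear_op Q" "norm Q \<le> norm B"
      "\<And>f j. Q (f \<otimes>\<^sub>v ket j) = B f \<otimes>\<^sub>v ket j"
    using block_operator_exists[of "\<lambda>_. B" "norm B"] B by auto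
  obtain W :: "('i \<times> 'j) ell2 \<Rightarrow>\<^sub>L ('j \<times> 'i) ell2"
    where W: "clinear_op W" "norm W \<le> 1" "\<And>f g. W (f \<otimes>\<^sub>v g) = g \<otimes>\<^sub>v f"
    using swap_operator_exists by blast
  obtain W' :: "('j \<times> 'i) ell2 \<Rightarrow>\<^sub>L ('i \<times> 'j) ell2"
    where W': "clinear_op W'" "norm W' \<le> 1" "\<And>f g. W' (f \<otimes>\<^sub>v g) = g \<otimes>\<^sub>v f"
    using swap_operator_exists by blast
  have id: "clinear_op (id_blinfun :: 'x ell2 \<Rightarrow>\<^sub>L 'x ell2)" by (simp add: clinear_op_def)
  have P': "P (f \<otimes>\<^sub>v g) = A f \<otimes>\<^sub>v g" for f g
    using tensor_ext_kets[OF P(1) A id, of f g] P(3)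
    by (metis id_blinfun.rep_eq id_apply tensor_vec_ket)
  have Q': "Q (f \<otimes>\<^sub>v g) = B f \<otimes>\<^sub>v g" for f g
    using tensor_ext_kets[OF Q(1) B id, of f g] Q(3)
    by (metis id_blinfun.rep_eq id_apply tensor_vec_ket)
  show thesis
  proof
    show "clinear_op (P o\<^sub>L W' o\<^sub>L Q o\<^sub>L W)"
      by (intro clinear_op_compose P Q W W')
    show "(P o\<^sub>L W' o\<^sub>L Q o\<^sub>L W) (f \<otimes>\<^sub>v g) = A f \<otimes>\<^sub>v B g" for f g
      by (simp add: W W' P' Q')
    have "norm (P o\<^sub>L W' o\<^sub>L Q o\<^sub>L W) \<le> norm P * norm W' * norm Q * norm W"
      by (meson norm_blinfun_compose order_trans mult_right_mono norm_ge_zero)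
    also have "\<dots> \<le> norm A * 1 * norm B * 1"
      by (intro mult_mono P Q W W') auto
    finally show "norm (P o\<^sub>L W' o\<^sub>L Q o\<^sub>L W) \<le> norm A * norm B" by simp
  qed
qed

lemma
  fixes A :: "'i ell2 \<Rightarrow>\<^sub>L 'i ell2" and B :: "'j ell2 \<Rightarrow>\<^sub>L 'j ell2"
  assumes A: "clinear_op A" and B: "clinear_op B"
  shows tensor_op_apply: "(A \<otimes>\<^sub>o B) (f \<otimes>\<^sub>v g) = A f \<otimes>\<^sub>v B g"
    and clinear_tensor_op: "clinear_op (A \<otimes>\<^sub>o B)"
    and norm_tensor_op_le: "norm (A \<otimes>\<^sub>o B) \<le> norm A * norm B"
proof -
  obtain X where X: "clinear_op X" "norm X \<le> norm A * norm B" "\<And>f g. X (f \<otimes>\<^sub>v g) = A f \<otimes>\<^sub>v B g"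
    using tensor_op_exists[OF A B] by blast
  have "A \<otimes>\<^sub>o B = X"
    unfolding tensor_op_def using X(3) by (intro the_equality allI tensor_op_unique) auto
  with X show "(A \<otimes>\<^sub>o B) (f \<otimes>\<^sub>v g) = A f \<otimes>\<^sub>v B g" "clinear_op (A \<otimes>\<^sub>o B)"
      "norm (A \<otimes>\<^sub>o B) \<le> norm A * norm B"
    by auto
qed

lemma tensor_op_ket:
  "clinear_op A \<Longrightarrow> clinear_op B \<Longrightarrow> (A \<otimes>\<^sub>o B) (ket (i, j)) = A (ket i) \<otimes>\<^sub>v B (ket j)"
  using tensor_op_apply[of A B "ket i" "ket j"] by simp

lemma tensor_op_eqI:
  assumes "clinear_op A" "clinear_op B" "clinear_op X"
    and "\<And>i j. X (ket (i, j)) = A (ket i) \<otimes>\<^sub>v B (ket j)"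
  shows "A \<otimes>\<^sub>o B = X"
proof (rule clinear_op_eqI)
  show "(A \<otimes>\<^sub>o B) (ket k) = X (ket k)" for k
    using assms by (cases k) (simp add: tensor_op_ket)
qed (use assms in \<open>simp_all add: clinear_tensor_op\<close>)

lemma tensor_op_compose:
  assumes "clinear_op A" "clinear_op B" "clinear_op C" "clinear_op D"
  shows "(A \<otimes>\<^sub>o B) o\<^sub>L (C \<otimes>\<^sub>o D) = (A o\<^sub>L C) \<otimes>\<^sub>o (B o\<^sub>L D)"
  by (rule tensor_op_eqI[symmetric])
    (use assms in \<open>simp_all add: clinear_op_compose clinear_tensor_op tensor_op_ket tensor_op_apply\<close>)

lemma adj_tensor_op:
  assumes "clinear_op A" "clinear_op B"
  shows "adj (A \<otimes>\<^sub>o B) = adj A \<otimes>\<^sub>o adj B"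
proof (rule adj_eq_ketI)
  fix k l
  show "Rep_ell2 ((adj A \<otimes>\<^sub>o adj B) (ket k)) l = cnj (Rep_ell2 ((A \<otimes>\<^sub>o B) (ket l)) k)"
  proof (cases k, cases l)
    fix i j i' j' assume "k = (i, j)" "l = (i', j')"
    then show ?thesis using assms by (simp add: tensor_op_ket clinear_op_adj Rep_adj_ket)
  qed
qed (use assms in \<open>simp_all add: clinear_tensor_op clinear_op_adj\<close>)

lemma tensor_op_add_left:
  assumes "clinear_op A" "clinear_op A'" "clinear_op B"
  shows "(A + A') \<otimes>\<^sub>o B = A \<otimes>\<^sub>o B + A' \<otimes>\<^sub>o B"
  by (rule tensor_op_eqI) (use assms in \<open>simp_all add: clinear_op_add clinear_tensor_op tensor_op_ket
    blinfun.add_left tensor_vec_add_left\<close>)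

lemma tensor_op_scaleC_left:
  assumes "clinear_op A" "clinear_op B"
  shows "(c *\<^sub>C A) \<otimes>\<^sub>o B = c *\<^sub>C (A \<otimes>\<^sub>o B)"
  by (rule tensor_op_eqI) (use assms in \<open>simp_all add: clinear_op_scaleC clinear_tensor_op tensor_op_ket
    tensor_vec_scaleC_left\<close>)

section \<open>Rebracketing triple tensor products\<close>

lemma Rep_assoc_ell2 [simp]: "Rep_ell2 (assoc_ell2 f) (i, j, k) = Rep_ell2 f ((i, j), k)"
  by (simp add: assoc_ell2.rep_eq)

lemma assoc_ell2_eqI:
  fixes x y :: "('i \<times> 'j \<times> 'k) ell2"
  shows "(\<And>i j k. Rep_ell2 x (i, j, k) = Rep_ell2 y (i, j, k)) \<Longrightarrow> x = y"
  by (rule ell2_eqI) (metis surj_pair)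

lemma assoc_ell2_tensor_vec: "assoc_ell2 ((f \<otimes>\<^sub>v g) \<otimes>\<^sub>v h) = f \<otimes>\<^sub>v g \<otimes>\<^sub>v h"
  by (rule assoc_ell2_eqI) simp

lemma assoc_ell2_scaleC: "assoc_ell2 (c *\<^sub>C f) = c *\<^sub>C assoc_ell2 f"
  by (rule assoc_ell2_eqI) simp

lemma norm_assoc_ell2: "norm (assoc_ell2 f) = norm f"
proof -
  have bij: "bij_betw (\<lambda>(i, j, k). ((i, j), k)) UNIV (UNIV :: (('i \<times> 'j) \<times> 'k) set)"
    by (rule bij_betwI[where g = "\<lambda>((i, j), k). (i, j, k)"]) auto
  have "(norm (assoc_ell2 f))\<^sup>2 = (norm f)\<^sup>2"
    unfolding norm_ell2_power2
    using infsum_reindex_bij_betw[OF bij, of "\<lambda>p. (cmod (Rep_ell2 f p))\<^sup>2"]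
    by (simp add: assoc_ell2.rep_eq case_prod_beta')
  then show ?thesis by (simp add: power2_eq_iff_nonneg)
qed

lemma bounded_linear_assoc_ell2: "bounded_linear assoc_ell2"
proof (rule bounded_linear_intro[where K = 1])
  show "assoc_ell2 (f + g) = assoc_ell2 f + assoc_ell2 g" for f g :: "(('i \<times> 'j) \<times> 'k) ell2"
    by (rule assoc_ell2_eqI) simp
qed (simp_all add: scaleR_scaleC assoc_ell2_scaleC norm_assoc_ell2)

lemma assoc_ell2_tensor_op:
  assumes "clinear_op A" "clinear_op B" "clinear_op C"
  shows "assoc_ell2 (((A \<otimes>\<^sub>o B) \<otimes>\<^sub>o C) f) = (A \<otimes>\<^sub>o B \<otimes>\<^sub>o C) (assoc_ell2 f)"
proof (rule bounded_clinear_eqI[where F = "\<lambda>f. assoc_ell2 (((A \<otimes>\<^sub>o B) \<otimes>\<^sub>o C) f)"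
      and G = "\<lambda>f. (A \<otimes>\<^sub>o B \<otimes>\<^sub>o C) (assoc_ell2 f)"])
  note [simp] = assms clinear_tensor_op
  show "bounded_linear (\<lambda>f. assoc_ell2 (((A \<otimes>\<^sub>o B) \<otimes>\<^sub>o C) f))"
    by (rule bounded_linear_compose[OF bounded_linear_assoc_ell2 blinfun.bounded_linear_right])
  show "bounded_linear (\<lambda>f. (A \<otimes>\<^sub>o B \<otimes>\<^sub>o C) (assoc_ell2 f))"
    by (rule bounded_linear_compose[OF blinfun.bounded_linear_right bounded_linear_assoc_ell2])
  show "assoc_ell2 (((A \<otimes>\<^sub>o B) \<otimes>\<^sub>o C) (ket p)) = (A \<otimes>\<^sub>o B \<otimes>\<^sub>o C) (assoc_ell2 (ket p))" for p
  proof -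
    obtain i j k where p: "ket p = (ket i \<otimes>\<^sub>v ket j) \<otimes>\<^sub>v ket k"
      by (metis tensor_vec_ket surj_pair)
    show ?thesis
      unfolding p assoc_ell2_tensor_vec
      by (simp add: tensor_op_apply assoc_ell2_tensor_vec del: tensor_vec_ket)
  qed
qed (use assms in \<open>simp_all add: assoc_ell2_scaleC clinear_opD[OF clinear_tensor_op] clinear_tensor_op\<close>)

section \<open>Linear maps on closed spans and on tensor products\<close>

lemma subset_closure_cspan: "D \<subseteq> closure (cspan D)"
  unfolding cspan_def using complex_vs.span_superset closure_subset by blast

lemma subspace_closure:
  fixes A :: "'a::complex_normed_vector set"
  assumes "complex_vs.subspace A"
  shows "complex_vs.subspace (closure A)"
proof (rule complex_vs.subspaceI)
  show "0 \<in> closure A"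
    using complex_vs.subspace_0[OF assms] closure_subset by blast
  show "x + y \<in> closure A" if "x \<in> closure A" "y \<in> closure A" for x y
  proof -
    obtain s where "\<forall>n. s n \<in> A" "s \<longlonglongrightarrow> x"
      using \<open>x \<in> closure A\<close> unfolding closure_sequential by blast
    moreover obtain t where "\<forall>n. t n \<in> A" "t \<longlonglongrightarrow> y"
      using \<open>y \<in> closure A\<close> unfolding closure_sequential by blast
    ultimately have "\<forall>n. s n + t n \<in> A" "(\<lambda>n. s n + t n) \<longlonglongrightarrow> x + y"
      using complex_vs.subspace_add[OF assms] by (auto intro: tendsto_add)
    then show ?thesis
      unfolding closure_sequential by (intro exI[of _ "\<lambda>n. s n + t n"]) simp
  qed
  show "c *\<^sub>C x \<in> closure A" if "x \<in> closure A" for c x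
  proof -
    obtain s where "\<forall>n. s n \<in> A" "s \<longlonglongrightarrow> x"
      using \<open>x \<in> closure A\<close> unfolding closure_sequential by blast
    then have "\<forall>n. c *\<^sub>C s n \<in> A" "(\<lambda>n. c *\<^sub>C s n) \<longlonglongrightarrow> c *\<^sub>C x"
      using complex_vs.subspace_scale[OF assms]
      by (auto intro: bounded_linear.tendsto[OF bounded_linear_scaleC_right])
    then show ?thesis
      unfolding closure_sequential by (intro exI[of _ "\<lambda>n. c *\<^sub>C s n"]) simp
  qed
qed

lemma subspace_closure_cspan [simp]: "complex_vs.subspace (closure (cspan D))"
  unfolding cspan_def by (rule subspace_closure[OF complex_vs.subspace_span])

lemma closure_cspan_minimal:
  "D \<subseteq> T \<Longrightarrow> complex_vs.subspace T \<Longrightarrow> closed T \<Longrightarrow> closure (cspan D) \<subseteq> T"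
  unfolding cspan_def by (intro closure_minimal complex_vs.span_minimal)

lemma clinear_onD:
  assumes "clinear_on A F"
  shows clinear_on_add: "x \<in> A \<Longrightarrow> y \<in> A \<Longrightarrow> F (x + y) = F x + F y"
    and clinear_on_scaleC: "x \<in> A \<Longrightarrow> F (c *\<^sub>C x) = c *\<^sub>C F x"
  using assms by (auto simp: clinear_on_def)

lemma clinear_on_0:
  "complex_vs.subspace A \<Longrightarrow> clinear_on A F \<Longrightarrow> F 0 = 0"
  using clinear_on_scaleC[of A F 0 0] complex_vs.subspace_0[of A] by simp

lemma clinear_on_diff:
  assumes "complex_vs.subspace A" "clinear_on A F" "x \<in> A" "y \<in> A"
  shows "F (x - y) = F x - F y"
proof -
  have "F (x + (- 1) *\<^sub>C y) = F x + F ((- 1) *\<^sub>C y)"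
    by (rule clinear_on_add[OF assms(2,3) complex_vs.subspace_scale[OF assms(1,4)]])
  also have "F ((- 1) *\<^sub>C y) = (- 1) *\<^sub>C F y"
    by (rule clinear_on_scaleC[OF assms(2,4)])
  finally show ?thesis by simp
qed

lemma clinear_on_subset: "clinear_on A F \<Longrightarrow> B \<subseteq> A \<Longrightarrow> clinear_on B F"
  unfolding clinear_on_def by blast

lemma clinear_on_closure_cspan_in:
  assumes F: "clinear_on (closure (cspan D)) F" "continuous_on (closure (cspan D)) F"
    and T: "complex_vs.subspace T" "closed T"
    and D: "\<And>d. d \<in> D \<Longrightarrow> F d \<in> T"
    and x: "x \<in> closure (cspan D)"
  shows "F x \<in> T"
proof -
  \<comment> \<open>Linearity of \<open>F\<close> is only available on the closed span, so
    membership in it is carried through the induction.\<close>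
  have "y \<in> closure (cspan D) \<and> F y \<in> T" if "y \<in> cspan D" for y
    using that unfolding cspan_def
  proof (induction rule: complex_vs.span_induct_alt)
    case base
    show ?case
      using clinear_on_0[OF subspace_closure_cspan F(1)] complex_vs.subspace_0[OF T(1)]
        complex_vs.subspace_0[OF subspace_closure_cspan[of D]]
      unfolding cspan_def by simp
  next
    case (step c x y)
    note sub = subspace_closure_cspan[of D, unfolded cspan_def]
    have x: "x \<in> closure (complex_vs.span D)"
      using step subset_closure_cspan[of D] unfolding cspan_def by blast
    then have "F (c *\<^sub>C x + y) = c *\<^sub>C F x + F y"
      using step complex_vs.subspace_scale[OF sub x]
      by (simp add: clinear_onD[OF F(1)[unfolded cspan_def]])
    moreover have "c *\<^sub>C F x + F y \<in> T"
      using step D by (intro complex_vs.subspace_add[OF T(1)] complex_vs.subspace_scale[OF T(1)]) auto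
    moreover have "c *\<^sub>C x + y \<in> closure (complex_vs.span D)"
      using step x by (intro complex_vs.subspace_add[OF sub] complex_vs.subspace_scale[OF sub]) auto
    ultimately show ?case by simp
  qed
  then have "F ` closure (cspan D) \<subseteq> T"
    by (intro image_closure_subset F T) auto
  then show ?thesis using x by blast
qed

lemma clinear_on_closure_cspan_eqI:
  assumes F: "clinear_on (closure (cspan D)) F" "continuous_on (closure (cspan D)) F"
    and G: "clinear_on (closure (cspan D)) G" "continuous_on (closure (cspan D)) G"
    and D: "\<And>d. d \<in> D \<Longrightarrow> F d = G d"
    and x: "x \<in> closure (cspan D)"
  shows "F x = G x"
proof -
  have "(\<lambda>x. F x - G x) x \<in> {0}"
  proof (rule clinear_on_closure_cspan_in[OF _ _ _ _ _ x])
    show "clinear_on (closure (cspan D)) (\<lambda>x. F x - G x)"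
      using F(1) G(1) unfolding clinear_on_def by (simp add: complex_vs.scale_right_diff_distrib)
    show "continuous_on (closure (cspan D)) (\<lambda>x. F x - G x)"
      by (intro continuous_intros F G)
  qed (use D in auto)
  then show ?thesis by simp
qed

text \<open>Elements of \<open>dual_space\<close> are given by continuity alone, while the estimates
  on tensor products need an explicit constant.\<close>

lemma clinear_on_bounded:
  assumes A: "complex_vs.subspace A" and F: "clinear_on A F" "continuous_on A F"
  obtains K where "0 \<le> K" "\<And>x. x \<in> A \<Longrightarrow> norm (F x) \<le> K * norm x"
proof -
  have F0: "F 0 = 0" by (rule clinear_on_0[OF A F(1)])
  obtain d where d: "d > 0" "\<And>x. x \<in> A \<Longrightarrow> dist x 0 < d \<Longrightarrow> dist (F x) (F 0) < 1"
    using F(2) complex_vs.subspace_0[OF A] unfolding continuous_on_iff by (metis zero_less_one)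
  have "norm (F x) \<le> 2 / d * norm x" if x: "x \<in> A" for x
  proof (cases "x = 0")
    case False
    \<comment> \<open>This factor scales \<open>x\<close> to norm \<open>d / 2\<close>, inside the
      ball on which \<open>F\<close> stays below 1.\<close>
    define c where "c = d / (2 * norm x)"
    have c: "c > 0" using d(1) False by (simp add: c_def)
    have "norm (complex_of_real c *\<^sub>C x) = c * norm x"
      using c by (simp add: norm_scaleC)
    also have "\<dots> < d" using d(1) False by (simp add: c_def)
    finally have "dist (complex_of_real c *\<^sub>C x) 0 < d" by simp
    with d(2) complex_vs.subspace_scale[OF A x] have "norm (F (complex_of_real c *\<^sub>C x)) < 1"
      by (simp add: F0)
    then have "c * norm (F x) < 1"
      using c by (simp add: clinear_on_scaleC[OF F(1) x] norm_scaleC)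
    then show ?thesis using d(1) False by (simp add: c_def field_simps)
  qed (simp add: F0)
  with d(1) that[of "2 / d"] show thesis by simp
qed

lemma clinear_on_continuousI:
  assumes A: "complex_vs.subspace A" and F: "clinear_on A F"
    and K: "\<And>x. x \<in> A \<Longrightarrow> norm (F x) \<le> K * norm x"
  shows "continuous_on A F"
proof (rule lipschitz_on_continuous_on)
  show "\<bar>K\<bar>-lipschitz_on A F"
  proof (rule lipschitz_onI)
    fix x y assume xy: "x \<in> A" "y \<in> A"
    have "dist (F x) (F y) \<le> K * dist x y"
      unfolding dist_norm clinear_on_diff[OF A F xy, symmetric]
      by (rule K[OF complex_vs.subspace_diff[OF A xy]])
    also have "\<dots> \<le> \<bar>K\<bar> * dist x y" by (simp add: mult_right_mono)
    finally show "dist (F x) (F y) \<le> \<bar>K\<bar> * dist x y" .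
  qed simp
qed

text \<open>
  Finite sums of elements of \<open>u ` P\<close> are indexed by lists, so that no choice of coefficients is needed.
\<close>

lemma bounded_clinear_extension:
  fixes u :: "'p \<Rightarrow> 'a::complex_normed_vector" and v :: "'p \<Rightarrow> 'b::{complex_normed_vector,banach}"
  assumes scale: "\<And>c p. p \<in> P \<Longrightarrow> \<exists>q\<in>P. u q = c *\<^sub>C u p \<and> v q = c *\<^sub>C v p"
    and bound: "\<And>ps. set ps \<subseteq> P \<Longrightarrow> norm (\<Sum>p\<leftarrow>ps. v p) \<le> K * norm (\<Sum>p\<leftarrow>ps. u p)"
  obtains F where "clinear_on (closure (cspan (u ` P))) F" "continuous_on (closure (cspan (u ` P))) F"
    "\<And>p. p \<in> P \<Longrightarrow> F (u p) = v p"
proof -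
  let ?S = "cspan (u ` P)"
  \<comment> \<open>\<open>R\<close> is the graph of the wanted map on the span; one list supplies
    both entries of a pair.\<close>
  define R where "R x y \<longleftrightarrow> (\<exists>ps. set ps \<subseteq> P \<and> x = (\<Sum>p\<leftarrow>ps. u p) \<and> y = (\<Sum>p\<leftarrow>ps. v p))" for x y
  have R_0: "R 0 0" unfolding R_def by (rule exI[of _ "[]"]) simp
  have R_add: "R (x + x') (y + y')" if "R x y" "R x' y'" for x x' y y'
  proof -
    obtain ps ps' where "set ps \<subseteq> P" "x = (\<Sum>p\<leftarrow>ps. u p)" "y = (\<Sum>p\<leftarrow>ps. v p)"
        "set ps' \<subseteq> P" "x' = (\<Sum>p\<leftarrow>ps'. u p)" "y' = (\<Sum>p\<leftarrow>ps'. v p)"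
      using \<open>R x y\<close> \<open>R x' y'\<close> unfolding R_def by blast
    then show ?thesis unfolding R_def by (intro exI[of _ "ps @ ps'"]) simp
  qed
  have R_scale: "R (c *\<^sub>C x) (c *\<^sub>C y)" if "R x y" for c x y
  proof -
    obtain ps where "set ps \<subseteq> P" "x = (\<Sum>p\<leftarrow>ps. u p)" "y = (\<Sum>p\<leftarrow>ps. v p)"
      using \<open>R x y\<close> unfolding R_def by blast
    moreover have "set ps \<subseteq> P \<Longrightarrow> R (c *\<^sub>C (\<Sum>p\<leftarrow>ps. u p)) (c *\<^sub>C (\<Sum>p\<leftarrow>ps. v p))"
    proof (induction ps)
      case (Cons p ps)
      then obtain q where "q \<in> P" "u q = c *\<^sub>C u p" "v q = c *\<^sub>C v p" using scale[of p c] by auto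
      then have "R (c *\<^sub>C u p) (c *\<^sub>C v p)"
        unfolding R_def by (intro exI[of _ "[q]"]) simp
      with Cons show ?case by (simp add: scaleC_add_right R_add)
    qed (simp add: R_0)
    ultimately show ?thesis by blast
  qed
  have R_norm: "norm y \<le> K * norm x" if "R x y" for x y
    using that bound unfolding R_def by auto
  have R_diff: "R (x - x') (y - y')" if "R x y" "R x' y'" for x x' y y'
    using R_add[OF that(1) R_scale[OF that(2), of "- 1"]] by simp
  \<comment> \<open>The norm bound, applied to a difference of two pairs with equal first entry,
    makes the graph single-valued.\<close>
  have R_unique: "y = y'" if "R x y" "R x y'" for x y y'
    using R_norm[OF R_diff[OF that]] by simp
  have R_u: "R (u p) (v p)" if "p \<in> P" for p
    unfolding R_def using that by (intro exI[of _ "[p]"]) simp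
  have "\<exists>y. R x y" if "x \<in> ?S" for x
    using that unfolding cspan_def
    by (induction rule: complex_vs.span_induct_alt) (use R_0 R_add R_scale R_u in blast)+
  then obtain F0 where F0: "\<And>x. x \<in> ?S \<Longrightarrow> R x (F0 x)" by metis
  have sub: "complex_vs.subspace ?S" unfolding cspan_def by (rule complex_vs.subspace_span)
  have lin: "clinear_on ?S F0"
    unfolding clinear_on_def
  proof (intro conjI ballI allI)
    show "F0 (x + y) = F0 x + F0 y" if "x \<in> ?S" "y \<in> ?S" for x y
      by (rule R_unique[OF F0 R_add[OF F0 F0]]) (use that complex_vs.subspace_add[OF sub] in auto)
    show "F0 (c *\<^sub>C x) = c *\<^sub>C F0 x" if "x \<in> ?S" for c x
      by (rule R_unique[OF F0 R_scale[OF F0]]) (use that complex_vs.subspace_scale[OF sub] in auto)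
  qed
  have "uniformly_continuous_on ?S F0"
  proof (rule lipschitz_on_uniformly_continuous)
    show "\<bar>K\<bar>-lipschitz_on ?S F0"
    proof (rule lipschitz_onI)
      fix x y assume "x \<in> ?S" "y \<in> ?S"
      then have "dist (F0 x) (F0 y) \<le> K * dist x y"
        unfolding dist_norm by (intro R_norm R_diff F0)
      also have "\<dots> \<le> \<bar>K\<bar> * dist x y" by (simp add: mult_right_mono)
      finally show "dist (F0 x) (F0 y) \<le> \<bar>K\<bar> * dist x y" .
    qed simp
  qed
  then obtain F where F: "uniformly_continuous_on (closure ?S) F" "\<And>x. x \<in> ?S \<Longrightarrow> F0 x = F x"
    by (rule uniformly_continuous_on_extension_on_closure) blast
  have cont: "continuous_on (closure ?S) F"
    by (rule uniformly_continuous_imp_continuous[OF F(1)])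
  have lim: "(\<lambda>n. F (s n)) \<longlonglongrightarrow> F x" if "s \<longlonglongrightarrow> x" "\<forall>n. s n \<in> ?S" "x \<in> closure ?S" for s x
    by (rule continuous_on_tendsto_compose[OF cont])
      (use that closure_subset[of ?S] in \<open>auto intro: always_eventually\<close>)
  have "clinear_on (closure ?S) F"
    unfolding clinear_on_def
  proof (intro conjI ballI allI)
    fix x y assume xy: "x \<in> closure ?S" "y \<in> closure ?S"
    then obtain s t where s: "\<forall>n. s n \<in> ?S" "s \<longlonglongrightarrow> x" and t: "\<forall>n. t n \<in> ?S" "t \<longlonglongrightarrow> y"
      unfolding closure_sequential by blast
    have "(\<lambda>n. F (s n + t n)) \<longlonglongrightarrow> F (x + y)"
      by (rule lim) (use s t xy complex_vs.subspace_add[OF sub]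
          complex_vs.subspace_add[OF subspace_closure_cspan] in \<open>auto intro: tendsto_add\<close>)
    moreover have "(\<lambda>n. F (s n + t n)) \<longlonglongrightarrow> F x + F y"
    proof -
      have "F (s n + t n) = F (s n) + F (t n)" for n
        using s t complex_vs.subspace_add[OF sub] by (simp add: F(2)[symmetric] clinear_onD[OF lin])
      then show ?thesis using lim s t xy by (auto intro: tendsto_add)
    qed
    ultimately show "F (x + y) = F x + F y" by (rule LIMSEQ_unique)
  next
    fix c x assume x: "x \<in> closure ?S"
    then obtain s where s: "\<forall>n. s n \<in> ?S" "s \<longlonglongrightarrow> x"
      unfolding closure_sequential by blast
    have "(\<lambda>n. F (c *\<^sub>C s n)) \<longlonglongrightarrow> F (c *\<^sub>C x)"
      by (rule lim) (use s x complex_vs.subspace_scale[OF sub]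
          complex_vs.subspace_scale[OF subspace_closure_cspan]
          in \<open>auto intro: bounded_linear.tendsto[OF bounded_linear_scaleC_right]\<close>)
    moreover have "(\<lambda>n. F (c *\<^sub>C s n)) \<longlonglongrightarrow> c *\<^sub>C F x"
    proof -
      have "F (c *\<^sub>C s n) = c *\<^sub>C F (s n)" for n
        using s complex_vs.subspace_scale[OF sub] by (simp add: F(2)[symmetric] clinear_onD[OF lin])
      then show ?thesis
        using lim s x by (auto intro: bounded_linear.tendsto[OF bounded_linear_scaleC_right])
    qed
    ultimately show "F (c *\<^sub>C x) = c *\<^sub>C F x" by (rule LIMSEQ_unique)
  qed
  moreover have "F (u p) = v p" if "p \<in> P" for p
  proof -
    have "u p \<in> ?S" unfolding cspan_def using that by (simp add: complex_vs.span_base)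
    then show ?thesis using F(2) F0 R_u[OF that] R_unique by metis
  qed
  ultimately show thesis using that cont by blast
qed

section \<open>Multiplication operators and their symbols\<close>

lemma
  assumes "\<And>k. k \<in> K \<Longrightarrow> cmod (f k) \<le> C"
  shows mult_op_ket: "mult_op K f (ket k) = (if k \<in> K then f k *\<^sub>C ket k else 0)"
    and clinear_mult_op: "clinear_op (mult_op K f)"
    and norm_mult_op_le: "0 \<le> C \<Longrightarrow> norm (mult_op K f) \<le> C"
proof -
  have "clinear_op (mult_op K f) \<and>
    (\<forall>k. mult_op K f (ket k) = (if k \<in> K then f k *\<^sub>C ket k else 0)) \<and> norm (mult_op K f) \<le> max C 0"
  proof -
    let ?s = "\<lambda>k. if k \<in> K then f k else 0"
    \<comment> \<open>The weight is 0 outside \<open>K\<close>, and \<open>C\<close> may be negative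
      if \<open>K\<close> is empty; hence the maximum with 0.\<close>
    have "cmod (?s k) \<le> max C 0" for k using assms[of k] by auto
    then obtain X :: "'a ell2 \<Rightarrow>\<^sub>L 'a ell2"
      where X: "clinear_op X" "norm X \<le> max C 0" "\<And>k. X (ket k) = ?s k *\<^sub>C ket (id k)"
      using weighted_shift_exists[of id ?s "max C 0"] by auto
    have "mult_op K f = X"
      unfolding mult_op_def by (rule the_equality) (use X in \<open>auto intro!: clinear_op_eqI\<close>)
    then show ?thesis using X by auto
  qed
  then show "mult_op K f (ket k) = (if k \<in> K then f k *\<^sub>C ket k else 0)" "clinear_op (mult_op K f)"
      "0 \<le> C \<Longrightarrow> norm (mult_op K f) \<le> C"
    by auto
qed

lemma mult_op_eqI:
  assumes "clinear_op X" "\<And>k. X (ket k) = (if k \<in> K then f k *\<^sub>C ket k else 0)"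
  shows "mult_op K f = X"
  unfolding mult_op_def
  by (rule the_equality) (use assms in \<open>auto intro!: clinear_op_eqI\<close>)

lemma mult_op_cong: "(\<And>k. k \<in> K \<Longrightarrow> f k = g k) \<Longrightarrow> mult_op K f = mult_op K g"
  unfolding mult_op_def by (rule arg_cong[where f = The]) (auto cong: if_cong)

lemma symbol_mult_op:
  assumes "\<And>k. k \<in> K \<Longrightarrow> cmod (f k) \<le> C" "k \<in> K"
  shows "symbol (mult_op K f) k = f k"
  using assms by (simp add: symbol_def mult_op_ket[where C = C])

lemma norm_symbol_le: "cmod (symbol X k) \<le> norm X"
proof -
  have "cmod (symbol X k) \<le> norm (X (ket k))"
    unfolding symbol_def using norm_cinner_le[of "ket k" "X (ket k)"] by (simp del: cinner_ket_left)
  also have "\<dots> \<le> norm X" using norm_blinfun[of X "ket k"] by simp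
  finally show ?thesis .
qed

lemma symbol_add: "symbol (X + Y) k = symbol X k + symbol Y k"
  and symbol_scaleC: "symbol (c *\<^sub>C X) k = c * symbol X k"
  by (simp_all add: symbol_def blinfun.add_left)

text \<open>Any symbol is bounded by the norm of its operator, so no continuity or compactness is
  involved. The map \<open>h\<close> is the identity for the diagonal compression, and the
  multiplication of characters for \<open>dual_comult\<close>.\<close>

lemma mult_op_symbol_ket:
  "mult_op K (\<lambda>k. symbol X (h k)) (ket k) = (if k \<in> K then symbol X (h k) *\<^sub>C ket k else 0)"
  and clinear_mult_op_symbol: "clinear_op (mult_op K (\<lambda>k. symbol X (h k)))"
  and norm_mult_op_symbol_le: "norm (mult_op K (\<lambda>k. symbol X (h k))) \<le> norm X"
  by (rule mult_op_ket[where C = "norm X"] clinear_mult_op[where C = "norm X"] norm_mult_op_le,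
      rule norm_symbol_le, simp?)+

lemma mult_op_symbol_add:
  "mult_op K (\<lambda>k. symbol (X + Y) (h k)) = mult_op K (\<lambda>k. symbol X (h k)) + mult_op K (\<lambda>k. symbol Y (h k))"
  by (rule mult_op_eqI)
    (simp_all add: clinear_op_add clinear_mult_op_symbol blinfun.add_left symbol_add
      mult_op_symbol_ket scaleC_add_left)

lemma mult_op_symbol_scaleC:
  "mult_op K (\<lambda>k. symbol (c *\<^sub>C X) (h k)) = c *\<^sub>C mult_op K (\<lambda>k. symbol X (h k))"
  by (rule mult_op_eqI)
    (simp_all add: clinear_op_scaleC clinear_mult_op_symbol symbol_scaleC mult_op_symbol_ket
      scaleC_scaleC)

section \<open>Minimal tensor products and slice maps\<close>

lemma min_tensor_eq: "A \<otimes>\<^sub>m B = closure (cspan ((\<lambda>p. fst p \<otimes>\<^sub>o snd p) ` (A \<times> B)))"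
proof -
  have "{a \<otimes>\<^sub>o b |a b. a \<in> A \<and> b \<in> B} = (\<lambda>p. fst p \<otimes>\<^sub>o snd p) ` (A \<times> B)"
    unfolding image_def Bex_def split_paired_Ex mem_Times_iff fst_conv snd_conv by blast
  then show ?thesis by (simp only: min_tensor_def)
qed

lemma tensor_in_min_tensor: "a \<in> A \<Longrightarrow> b \<in> B \<Longrightarrow> a \<otimes>\<^sub>o b \<in> A \<otimes>\<^sub>m B"
  unfolding min_tensor_def by (rule subsetD[OF subset_closure_cspan]) blast

lemma subspace_min_tensor [simp]: "complex_vs.subspace (A \<otimes>\<^sub>m B)"
  unfolding min_tensor_def by simp

lemma closed_min_tensor [simp]: "closed (A \<otimes>\<^sub>m B)"
  unfolding min_tensor_def by simp

text \<open>The slice map \<open>a \<otimes> b \<mapsto> \<langle>f, a g\<rangle> b\<close>.\<close>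

definition slice :: "'i ell2 \<Rightarrow> 'i ell2 \<Rightarrow> (('i \<times> 'j) ell2 \<Rightarrow>\<^sub>L ('i \<times> 'j) ell2) \<Rightarrow> ('j ell2 \<Rightarrow>\<^sub>L 'j ell2)"
  where "slice f g X = adj (Blinfun (\<lambda>h. f \<otimes>\<^sub>v h)) o\<^sub>L X o\<^sub>L Blinfun (\<lambda>h. g \<otimes>\<^sub>v h)"

lemma slice_add: "slice f g (X + Y) = slice f g X + slice f g Y"
  by (rule blinfun_eqI) (simp add: slice_def blinfun.add_left blinfun.add_right)

lemma slice_0 [simp]: "slice f g 0 = 0"
  by (rule blinfun_eqI) (simp add: slice_def)

lemma clinear_op_tensor_vec: "clinear_op (Blinfun (\<lambda>h. f \<otimes>\<^sub>v h))"
  by (simp add: clinear_op_def bounded_linear_Blinfun_apply[OF bounded_linear_tensor_vec_right]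
      tensor_vec_scaleC_right)

lemma norm_Blinfun_tensor_vec: "norm (Blinfun (\<lambda>h. f \<otimes>\<^sub>v h)) \<le> norm f"
  by (rule norm_blinfun_bound)
    (simp_all add: bounded_linear_Blinfun_apply[OF bounded_linear_tensor_vec_right])

lemma norm_slice_le:
  fixes f g :: "'i ell2" and X :: "('i \<times> 'j) ell2 \<Rightarrow>\<^sub>L ('i \<times> 'j) ell2"
  shows "norm (slice f g X) \<le> norm f * norm X * norm g"
proof -
  have "norm (slice f g X)
      \<le> norm (adj (Blinfun (\<lambda>h. f \<otimes>\<^sub>v h) :: 'j ell2 \<Rightarrow>\<^sub>L ('i \<times> 'j) ell2)) * norm X
        * norm (Blinfun (\<lambda>h. g \<otimes>\<^sub>v h) :: 'j ell2 \<Rightarrow>\<^sub>L ('i \<times> 'j) ell2)"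
    unfolding slice_def by (meson norm_blinfun_compose order_trans mult_right_mono norm_ge_zero)
  also have "\<dots> \<le> norm f * norm X * norm g"
    by (intro mult_mono norm_Blinfun_tensor_vec order_refl
        order_trans[OF norm_adj_le[OF clinear_op_tensor_vec] norm_Blinfun_tensor_vec]) auto
  finally show ?thesis .
qed

lemma slice_tensor_op:
  assumes a: "clinear_op a" and b: "clinear_op b"
  shows "slice f g (a \<otimes>\<^sub>o b) = cinner f (a g) *\<^sub>C b"
proof (rule blinfun_eqI, rule cinner_eqI)
  fix h k
  have "cinner h (slice f g (a \<otimes>\<^sub>o b) k) = cinner (f \<otimes>\<^sub>v h) ((a \<otimes>\<^sub>o b) (g \<otimes>\<^sub>v k))"
    by (simp add: slice_def cinner_adj_right[OF clinear_op_tensor_vec]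
        bounded_linear_Blinfun_apply[OF bounded_linear_tensor_vec_right])
  also have "\<dots> = cinner h ((cinner f (a g) *\<^sub>C b) k)"
    by (simp add: tensor_op_apply[OF a b] cinner_tensor_vec)
  finally show "cinner h (slice f g (a \<otimes>\<^sub>o b) k) = cinner h ((cinner f (a g) *\<^sub>C b) k)" .
qed

lemma norm_right_slice_le:
  assumes A: "\<And>a. a \<in> A \<Longrightarrow> clinear_op a" and B: "\<And>b. b \<in> B \<Longrightarrow> clinear_op b" "complex_vs.subspace B"
    and \<eta>: "clinear_on B \<eta>" "\<And>b. b \<in> B \<Longrightarrow> cmod (\<eta> b) \<le> L * norm b" and L: "0 \<le> L"
    and ps: "set ps \<subseteq> A \<times> B"
  shows "norm (\<Sum>p\<leftarrow>ps. \<eta> (snd p) *\<^sub>C fst p) \<le> L * norm (\<Sum>p\<leftarrow>ps. fst p \<otimes>\<^sub>o snd p)"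
    (is "norm ?y \<le> L * norm ?X")
proof (rule norm_blinfun_bound)
  fix g
  have "cmod (cinner f (?y g)) \<le> L * norm ?X * norm g * norm f" for f
  proof -
    \<comment> \<open>Compression turns each simple tensor into a multiple of its second factor, so
      a finite sum stays in \<open>B\<close>, the only place where \<open>\<eta>\<close> is
      controlled.\<close>
    have "slice f g ?X \<in> B \<and> \<eta> (slice f g ?X) = cinner f (?y g)"
      using ps
    proof (induction ps)
      case Nil
      show ?case using B(2) by (simp add: clinear_on_0[OF B(2) \<eta>(1)] complex_vs.subspace_0)
    next
      case (Cons p ps)
      obtain a b where p: "p = (a, b)" by (cases p)
      with Cons.prems have ab: "a \<in> A" "b \<in> B" by auto
      let ?X = "\<Sum>p\<leftarrow>ps. fst p \<otimes>\<^sub>o snd p"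
      have IH: "slice f g ?X \<in> B" "\<eta> (slice f g ?X) = cinner f ((\<Sum>p\<leftarrow>ps. \<eta> (snd p) *\<^sub>C fst p) g)"
        using Cons by auto
      have s: "slice f g (a \<otimes>\<^sub>o b) = cinner f (a g) *\<^sub>C b"
        by (rule slice_tensor_op) (use ab A B in auto)
      have cb: "cinner f (a g) *\<^sub>C b \<in> B" by (rule complex_vs.subspace_scale[OF B(2) ab(2)])
      have "\<eta> (slice f g (a \<otimes>\<^sub>o b + ?X)) = cinner f (a g) * \<eta> b + \<eta> (slice f g ?X)"
        unfolding slice_add s
        by (simp only: clinear_on_add[OF \<eta>(1) cb IH(1)] clinear_on_scaleC[OF \<eta>(1) ab(2)]
            scaleC_complex_def)
      then show ?case
        using complex_vs.subspace_add[OF B(2) cb IH(1)]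
        by (simp add: p IH(2) slice_add s blinfun.add_left cinner_add_right mult.commute)
    qed
    then have "cmod (cinner f (?y g)) \<le> L * norm (slice f g ?X)"
      using \<eta>(2)[of "slice f g ?X"] by (elim conjE) (simp only:)
    also have "\<dots> \<le> L * (norm f * norm ?X * norm g)"
      by (rule mult_left_mono[OF norm_slice_le L])
    finally show ?thesis by (simp add: ac_simps)
  qed
  then show "norm (?y g) \<le> L * norm ?X * norm g" by (rule norm_leI)
qed (use L in simp)

text \<open>The product functional is \<open>\<xi>\<close> after the slice map by
  \<open>\<eta>\<close>, so the bounds of the two functionals multiply. Once a candidate exists, the
  choice in the definition has its properties.\<close>

lemma tensor_functional:
  assumes A: "\<And>a. a \<in> A \<Longrightarrow> clinear_op a" "complex_vs.subspace A"
    and B: "\<And>b. b \<in> B \<Longrightarrow> clinear_op b" "complex_vs.subspace B"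
    and \<xi>: "\<xi> \<in> dual_space A" and \<eta>: "\<eta> \<in> dual_space B"
  shows "clinear_on (A \<otimes>\<^sub>m B) (tensor_functional A B \<xi> \<eta>)"
    and "continuous_on (A \<otimes>\<^sub>m B) (tensor_functional A B \<xi> \<eta>)"
    and "a \<in> A \<Longrightarrow> b \<in> B \<Longrightarrow> tensor_functional A B \<xi> \<eta> (a \<otimes>\<^sub>o b) = \<xi> a * \<eta> b"
proof -
  have \<xi>': "clinear_on A \<xi>" "continuous_on A \<xi>" and \<eta>': "clinear_on B \<eta>" "continuous_on B \<eta>"
    using \<xi> \<eta> by (auto simp: dual_space_def)
  obtain K where K: "0 \<le> K" "\<And>a. a \<in> A \<Longrightarrow> norm (\<xi> a) \<le> K * norm a"
    using clinear_on_bounded[OF A(2) \<xi>'] by blast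
  obtain L where L: "0 \<le> L" "\<And>b. b \<in> B \<Longrightarrow> norm (\<eta> b) \<le> L * norm b"
    using clinear_on_bounded[OF B(2) \<eta>'] by blast
  have "norm (\<Sum>p\<leftarrow>ps. \<xi> (fst p) * \<eta> (snd p)) \<le> K * L * norm (\<Sum>p\<leftarrow>ps. fst p \<otimes>\<^sub>o snd p)"
    if ps: "set ps \<subseteq> A \<times> B" for ps
  proof -
    let ?y = "\<Sum>p\<leftarrow>ps. \<eta> (snd p) *\<^sub>C fst p"
    have "?y \<in> A \<and> \<xi> ?y = (\<Sum>p\<leftarrow>ps. \<xi> (fst p) * \<eta> (snd p))"
      using ps
    proof (induction ps)
      case (Cons p ps)
      then have "fst p \<in> A" by auto
      with Cons show ?case
        using complex_vs.subspace_add[OF A(2)] complex_vs.subspace_scale[OF A(2)]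
        by (simp add: clinear_onD[OF \<xi>'(1)] scaleC_complex_def mult.commute)
    qed (use A in \<open>simp add: complex_vs.subspace_0 clinear_on_0[OF A(2) \<xi>'(1)]\<close>)
    then have "norm (\<Sum>p\<leftarrow>ps. \<xi> (fst p) * \<eta> (snd p)) \<le> K * norm ?y" using K(2)[of ?y] by simp
    also have "\<dots> \<le> K * (L * norm (\<Sum>p\<leftarrow>ps. fst p \<otimes>\<^sub>o snd p))"
      by (intro mult_left_mono norm_right_slice_le[OF A(1) B \<eta>'(1) L(2,1) ps] K)
    finally show ?thesis by simp
  qed
  moreover have "\<exists>q\<in>A \<times> B. fst q \<otimes>\<^sub>o snd q = c *\<^sub>C (fst p \<otimes>\<^sub>o snd p) \<and>
      \<xi> (fst q) * \<eta> (snd q) = c *\<^sub>C (\<xi> (fst p) * \<eta> (snd p))" if "p \<in> A \<times> B" for c p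
    \<comment> \<open>Scalars are absorbed into the left factor, so lists of pairs without
      coefficients suffice.\<close>
    by (rule bexI[of _ "(c *\<^sub>C fst p, snd p)"])
      (use that in \<open>auto simp: tensor_op_scaleC_left A B clinear_onD[OF \<xi>'(1)] scaleC_complex_def
        complex_vs.subspace_scale[OF A(2)]\<close>)
  ultimately obtain F where F: "clinear_on (A \<otimes>\<^sub>m B) F" "continuous_on (A \<otimes>\<^sub>m B) F"
      "\<And>p. p \<in> A \<times> B \<Longrightarrow> F (fst p \<otimes>\<^sub>o snd p) = \<xi> (fst p) * \<eta> (snd p)"
    unfolding min_tensor_eq
    using bounded_clinear_extension[of "A \<times> B" "\<lambda>p. fst p \<otimes>\<^sub>o snd p" "\<lambda>p. \<xi> (fst p) * \<eta> (snd p)" "K * L"]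
    by blast
  have "\<exists>F. clinear_on (A \<otimes>\<^sub>m B) F \<and> continuous_on (A \<otimes>\<^sub>m B) F \<and>
      (\<forall>a\<in>A. \<forall>b\<in>B. F (a \<otimes>\<^sub>o b) = \<xi> a * \<eta> b)"
    using F by (intro exI[of _ F]) force
  from someI_ex[OF this] show "clinear_on (A \<otimes>\<^sub>m B) (tensor_functional A B \<xi> \<eta>)"
      "continuous_on (A \<otimes>\<^sub>m B) (tensor_functional A B \<xi> \<eta>)"
      "a \<in> A \<Longrightarrow> b \<in> B \<Longrightarrow> tensor_functional A B \<xi> \<eta> (a \<otimes>\<^sub>o b) = \<xi> a * \<eta> b"
    unfolding tensor_functional_def by blast+
qed

text \<open>
  The second factor has values in multiplication operators, so norms on the target are suprema over
  \<open>M\<close> of norms of slices.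
\<close>

lemma tensor_map_mult_op:
  fixes \<phi> :: "('i ell2 \<Rightarrow>\<^sub>L 'i ell2) \<Rightarrow> ('k ell2 \<Rightarrow>\<^sub>L 'k ell2)" and h :: "'l \<Rightarrow> ('j ell2 \<Rightarrow>\<^sub>L 'j ell2) \<Rightarrow> complex"
  assumes A: "\<And>a. a \<in> A \<Longrightarrow> clinear_op a" "complex_vs.subspace A"
    and B: "\<And>b. b \<in> B \<Longrightarrow> clinear_op b" "complex_vs.subspace B"
    and \<phi>: "clinear_on A \<phi>" "\<And>a. a \<in> A \<Longrightarrow> norm (\<phi> a) \<le> C * norm a" "\<And>a. a \<in> A \<Longrightarrow> clinear_op (\<phi> a)"
    and C: "0 \<le> C"
    and h: "\<And>k. k \<in> M \<Longrightarrow> clinear_on B (h k)" "\<And>k b. k \<in> M \<Longrightarrow> b \<in> B \<Longrightarrow> cmod (h k b) \<le> norm b"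
    and \<psi>: "\<And>b. b \<in> B \<Longrightarrow> \<psi> b = mult_op M (\<lambda>k. h k b)"
  shows "clinear_on (A \<otimes>\<^sub>m B) (tensor_map A B \<phi> \<psi>)"
    and "continuous_on (A \<otimes>\<^sub>m B) (tensor_map A B \<phi> \<psi>)"
    and "a \<in> A \<Longrightarrow> b \<in> B \<Longrightarrow> tensor_map A B \<phi> \<psi> (a \<otimes>\<^sub>o b) = \<phi> a \<otimes>\<^sub>o \<psi> b"
proof -
  have \<psi>_ket: "\<psi> b (ket k) = (if k \<in> M then h k b *\<^sub>C ket k else 0)" if "b \<in> B" for b k
    unfolding \<psi>[OF that] by (rule mult_op_ket[OF h(2)[OF _ that]])
  have \<psi>_clinear: "clinear_op (\<psi> b)" if "b \<in> B" for b
    unfolding \<psi>[OF that] by (rule clinear_mult_op[OF h(2)[OF _ that]])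
  have "norm (\<Sum>p\<leftarrow>ps. \<phi> (fst p) \<otimes>\<^sub>o \<psi> (snd p)) \<le> C * norm (\<Sum>p\<leftarrow>ps. fst p \<otimes>\<^sub>o snd p)"
    if ps: "set ps \<subseteq> A \<times> B" for ps
  proof -
    let ?X = "\<Sum>p\<leftarrow>ps. fst p \<otimes>\<^sub>o snd p" and ?Y = "\<Sum>p\<leftarrow>ps. \<phi> (fst p) \<otimes>\<^sub>o \<psi> (snd p)"
    let ?y = "\<lambda>k. \<Sum>p\<leftarrow>ps. h k (snd p) *\<^sub>C fst p"
    have y: "?y k \<in> A" if "k \<in> M" for k
      using ps
    proof (induction ps)
      case (Cons p ps)
      then show ?case
        using complex_vs.subspace_add[OF A(2)] complex_vs.subspace_scale[OF A(2)] by auto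
    qed (use A in \<open>simp add: complex_vs.subspace_0\<close>)
    \<comment> \<open>\<open>Z k\<close> is what the tensor map must produce at the point
      \<open>k\<close>: the map \<open>\<phi>\<close> applied to the slice of \<open>?X\<close> by
      \<open>h k\<close>. Identifying \<open>?Y\<close> with the block operator of the family
      \<open>Z\<close> yields its norm bound.\<close>
    define Z where "Z k = (if k \<in> M then \<phi> (?y k) else 0)" for k
    have "norm (Z k) \<le> C * norm ?X" for k
    proof (cases "k \<in> M")
      case True
      have "norm (\<phi> (?y k)) \<le> C * norm (?y k)" by (rule \<phi>(2)[OF y[OF True]])
      also have "\<dots> \<le> C * (1 * norm ?X)"
        by (rule mult_left_mono[OF norm_right_slice_le[OF A(1) B h(1)[OF True]] C])
          (use ps h(2)[OF True] in auto)
      finally show ?thesis by (simp add: Z_def True)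
    qed (use C in \<open>simp add: Z_def\<close>)
    moreover have "clinear_op (Z k)" for k
      unfolding Z_def using \<phi>(3) y by simp
    ultimately obtain W where W: "clinear_op W" "norm W \<le> C * norm ?X"
        "\<And>f k. W (f \<otimes>\<^sub>v ket k) = Z k f \<otimes>\<^sub>v ket k"
      using block_operator_exists[of Z "C * norm ?X"] by blast
    have Y: "clinear_op ?Y \<and> ?Y (f \<otimes>\<^sub>v ket k) = Z k f \<otimes>\<^sub>v ket k" for f k
      using ps unfolding Z_def
    proof (induction ps)
      case (Cons p ps)
      obtain a b where p: "p = (a, b)" by (cases p)
      with Cons.prems have ab: "a \<in> A" "b \<in> B" by auto
      have yA: "k \<in> M \<Longrightarrow> (\<Sum>p\<leftarrow>ps. h k (snd p) *\<^sub>C fst p) \<in> A"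
        using Cons.prems
      proof (induction ps)
        case (Cons q ps)
        then show ?case
          using complex_vs.subspace_add[OF A(2)] complex_vs.subspace_scale[OF A(2)] by auto
      qed (use A in \<open>simp add: complex_vs.subspace_0\<close>)
      have "(\<phi> a \<otimes>\<^sub>o \<psi> b) (f \<otimes>\<^sub>v ket k) = \<phi> a f \<otimes>\<^sub>v \<psi> b (ket k)"
        by (rule tensor_op_apply[OF \<phi>(3)[OF ab(1)] \<psi>_clinear[OF ab(2)]])
      moreover have "k \<in> M \<Longrightarrow> \<phi> (h k b *\<^sub>C a + (\<Sum>p\<leftarrow>ps. h k (snd p) *\<^sub>C fst p))
          = h k b *\<^sub>C \<phi> a + \<phi> (\<Sum>p\<leftarrow>ps. h k (snd p) *\<^sub>C fst p)"
        using ab yA complex_vs.subspace_scale[OF A(2) ab(1)] by (simp add: clinear_onD[OF \<phi>(1)])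
      moreover have "clinear_op (\<phi> a \<otimes>\<^sub>o \<psi> b)"
        by (rule clinear_tensor_op[OF \<phi>(3)[OF ab(1)] \<psi>_clinear[OF ab(2)]])
      ultimately show ?case
        using Cons ab
        by (auto simp: p clinear_op_add blinfun.add_left \<psi>_ket tensor_vec_scaleC_right
            tensor_vec_scaleC_left tensor_vec_add_left)
    qed (simp add: clinear_on_0[OF A(2) \<phi>(1)])
    have "?Y = W"
    proof (rule clinear_op_eqI)
      show "?Y (ket p) = W (ket p)" for p
        using Y[of "ket (fst p)" "snd p"] W(3)[of "ket (fst p)" "snd p"] by simp
    qed (use W Y in auto)
    with W show ?thesis by simp
  qed
  moreover have "\<exists>q\<in>A \<times> B. fst q \<otimes>\<^sub>o snd q = c *\<^sub>C (fst p \<otimes>\<^sub>o snd p) \<and>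
      \<phi> (fst q) \<otimes>\<^sub>o \<psi> (snd q) = c *\<^sub>C (\<phi> (fst p) \<otimes>\<^sub>o \<psi> (snd p))" if "p \<in> A \<times> B" for c p
    by (rule bexI[of _ "(c *\<^sub>C fst p, snd p)"])
      (use that in \<open>auto simp: tensor_op_scaleC_left A B \<phi>(3) \<psi>_clinear clinear_onD[OF \<phi>(1)]
        complex_vs.subspace_scale[OF A(2)]\<close>)
  ultimately obtain F where F: "clinear_on (A \<otimes>\<^sub>m B) F" "continuous_on (A \<otimes>\<^sub>m B) F"
      "\<And>p. p \<in> A \<times> B \<Longrightarrow> F (fst p \<otimes>\<^sub>o snd p) = \<phi> (fst p) \<otimes>\<^sub>o \<psi> (snd p)"
    unfolding min_tensor_eq
    using bounded_clinear_extension[of "A \<times> B" "\<lambda>p. fst p \<otimes>\<^sub>o snd p" "\<lambda>p. \<phi> (fst p) \<otimes>\<^sub>o \<psi> (snd p)" C]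
    by blast
  have "\<exists>F. clinear_on (A \<otimes>\<^sub>m B) F \<and> continuous_on (A \<otimes>\<^sub>m B) F \<and>
      (\<forall>a\<in>A. \<forall>b\<in>B. F (a \<otimes>\<^sub>o b) = \<phi> a \<otimes>\<^sub>o \<psi> b)"
    using F by (intro exI[of _ F]) force
  from someI_ex[OF this] show "clinear_on (A \<otimes>\<^sub>m B) (tensor_map A B \<phi> \<psi>)"
      "continuous_on (A \<otimes>\<^sub>m B) (tensor_map A B \<phi> \<psi>)"
      "a \<in> A \<Longrightarrow> b \<in> B \<Longrightarrow> tensor_map A B \<phi> \<psi> (a \<otimes>\<^sub>o b) = \<phi> a \<otimes>\<^sub>o \<psi> b"
    unfolding tensor_map_def by blast+
qed

section \<open>Star homomorphisms and group-like elements\<close>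

lemma closed_Collect_clinear_op: "closed {X :: 'a::complex_normed_vector \<Rightarrow>\<^sub>L 'b::complex_normed_vector. clinear_op X}"
  unfolding closed_sequential_limits
proof (intro allI impI, elim conjE)
  fix s and X :: "'a \<Rightarrow>\<^sub>L 'b"
  assume s: "\<forall>n. s n \<in> {X. clinear_op X}" "s \<longlonglongrightarrow> X"
  have lim: "(\<lambda>n. s n f) \<longlonglongrightarrow> X f" for f
    by (intro tendsto_intros s)
  have "X (c *\<^sub>C f) = c *\<^sub>C X f" for c f
  proof (rule LIMSEQ_unique[OF lim])
    have "s n (c *\<^sub>C f) = c *\<^sub>C s n f" for n using s(1) by (auto simp: clinear_op_def)
    then show "(\<lambda>n. s n (c *\<^sub>C f)) \<longlonglongrightarrow> c *\<^sub>C X f"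
      using bounded_linear.tendsto[OF bounded_linear_scaleC_right lim, of c f] by simp
  qed
  then show "X \<in> {X. clinear_op X}" by (simp add: clinear_op_def)
qed

lemma subspace_Collect_clinear_op: "complex_vs.subspace {X. clinear_op X}"
  by (rule complex_vs.subspaceI) (simp_all add: clinear_op_add clinear_op_scaleC)

lemma clinear_op_closure_cspan:
  "(\<And>d. d \<in> D \<Longrightarrow> clinear_op d) \<Longrightarrow> x \<in> closure (cspan D) \<Longrightarrow> clinear_op x"
  using closure_cspan_minimal[OF _ subspace_Collect_clinear_op closed_Collect_clinear_op, of D] by auto

lemma clinear_op_min_tensor:
  assumes "\<And>a. a \<in> A \<Longrightarrow> clinear_op a" "\<And>b. b \<in> B \<Longrightarrow> clinear_op b" "x \<in> A \<otimes>\<^sub>m B"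
  shows "clinear_op x"
  using assms(3) unfolding min_tensor_def
  by (rule clinear_op_closure_cspan[rotated]) (use assms(1,2) in \<open>auto simp: clinear_tensor_op\<close>)

lemma clinear_op_diff: "clinear_op A \<Longrightarrow> clinear_op B \<Longrightarrow> clinear_op (A - B)"
  using complex_vs.subspace_diff[OF subspace_Collect_clinear_op, of A B] by simp

lemma norm_adj:
  fixes x :: "'i ell2 \<Rightarrow>\<^sub>L 'j ell2"
  assumes x: "clinear_op x"
  shows "norm (adj x) = norm x"
  using norm_adj_le[OF x] norm_adj_le[OF clinear_op_adj[OF x]] by (simp add: adj_adj[OF x])

lemma adj_diff:
  fixes x y :: "'i ell2 \<Rightarrow>\<^sub>L 'j ell2"
  assumes "clinear_op x" "clinear_op y"
  shows "adj (x - y) = adj x - adj y"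
  by (rule adj_eqI)
    (simp add: cinner_adj_left assms blinfun.diff_left cinner_diff_left cinner_diff_right)

lemma clinear_on_compose_left: "clinear_on A (\<lambda>x. a o\<^sub>L x)" if "clinear_op a"
  unfolding clinear_on_def
  by (auto intro!: blinfun_eqI simp: blinfun.add_left blinfun.add_right clinear_opD[OF that])

lemma clinear_on_compose_right: "clinear_on A (\<lambda>x. x o\<^sub>L a)"
  unfolding clinear_on_def by (auto intro!: blinfun_eqI simp: blinfun.add_left)

lemma continuous_on_compose_left: "continuous_on A (\<lambda>x. a o\<^sub>L x)"
  and continuous_on_compose_right: "continuous_on A (\<lambda>x. x o\<^sub>L a)"
  by (rule bounded_linear.continuous_on[OF bounded_bilinear.bounded_linear_right[OF
          bounded_bilinear_blinfun_compose] continuous_on_id]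
        bounded_linear.continuous_on[OF bounded_bilinear.bounded_linear_left[OF
          bounded_bilinear_blinfun_compose] continuous_on_id])+

section \<open>Closed spans of self-adjoint multiplicative sets\<close>

lemma cstar_subalgebraD:
  assumes "cstar_subalgebra A"
  shows "a \<in> A \<Longrightarrow> clinear_op a" "complex_vs.subspace A" "a \<in> A \<Longrightarrow> b \<in> A \<Longrightarrow> a o\<^sub>L b \<in> A"
    "a \<in> A \<Longrightarrow> adj a \<in> A" "closed A"
proof -
  note * = assms[unfolded cstar_subalgebra_def]
  show "complex_vs.subspace A"
    by (rule complex_vs.subspaceI) (simp_all add: *)
qed (simp_all add: assms[unfolded cstar_subalgebra_def])

text \<open>On complex-linear operators \<open>adj\<close> is isometric, so adjoints of a convergent
  sequence converge. Complex linearity belongs to the set because \<open>adj\<close> is uncontrolled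
  without it.\<close>

lemma closed_Collect_adj_in:
  assumes "closed A"
  shows "closed {x :: 'i ell2 \<Rightarrow>\<^sub>L 'j ell2. clinear_op x \<and> adj x \<in> A}"
  unfolding closed_sequential_limits
proof (intro allI impI, elim conjE)
  fix s :: "nat \<Rightarrow> 'i ell2 \<Rightarrow>\<^sub>L 'j ell2" and x
  assume s: "\<forall>n. s n \<in> {x. clinear_op x \<and> adj x \<in> A}" "s \<longlonglongrightarrow> x"
  have x: "clinear_op x"
    using closed_sequentially[OF closed_Collect_clinear_op _ s(2)] s(1) by simp
  have "norm (adj (s n) - adj x) = norm (s n - x)" for n
  proof -
    have "clinear_op (s n)" using s(1) by simp
    then show ?thesis
      by (simp only: adj_diff[OF _ x, symmetric] norm_adj[OF clinear_op_diff[OF _ x]])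
  qed
  then have "(\<lambda>n. adj (s n)) \<longlonglongrightarrow> adj x"
    using tendsto_norm_zero[OF LIM_zero[OF s(2)]]
    by (simp only: LIM_zero_cancel[OF tendsto_norm_zero_cancel])
  from closed_sequentially[OF assms _ this] have "adj x \<in> A"
    using s(1) by simp
  with x show "x \<in> {x. clinear_op x \<and> adj x \<in> A}" by simp
qed

context
  fixes D :: "('i ell2 \<Rightarrow>\<^sub>L 'i ell2) set"
  assumes D_clinear: "\<And>d. d \<in> D \<Longrightarrow> clinear_op d"
    and D_compose: "\<And>d e. d \<in> D \<Longrightarrow> e \<in> D \<Longrightarrow> d o\<^sub>L e \<in> D"
    and D_adj: "\<And>d. d \<in> D \<Longrightarrow> adj d \<in> D"
begin

lemma closure_cspan_compose:
  assumes x: "x \<in> closure (cspan D)" and y: "y \<in> closure (cspan D)"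
  shows "x o\<^sub>L y \<in> closure (cspan D)"
proof (rule clinear_on_closure_cspan_in[where F = "\<lambda>y. x o\<^sub>L y" and D = D])
  show "clinear_on (closure (cspan D)) (\<lambda>y. x o\<^sub>L y)"
    by (rule clinear_on_compose_left[OF clinear_op_closure_cspan[OF D_clinear x]])
  fix d assume d: "d \<in> D"
  show "x o\<^sub>L d \<in> closure (cspan D)"
    by (rule clinear_on_closure_cspan_in[where F = "\<lambda>x. x o\<^sub>L d" and D = D])
      (use d x D_compose subset_closure_cspan[of D] in
        \<open>auto intro: clinear_on_compose_right continuous_on_compose_right\<close>)
qed (use y in \<open>auto intro: continuous_on_compose_left\<close>)

lemma closure_cspan_adj:
  assumes x: "x \<in> closure (cspan D)"
  shows "adj x \<in> closure (cspan D)"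
proof -
  have "complex_vs.subspace {x. clinear_op x \<and> adj x \<in> closure (cspan D)}"
    by (rule complex_vs.subspaceI)
      (simp_all add: clinear_op_add clinear_op_scaleC adj_add adj_scaleC
        complex_vs.subspace_0[OF subspace_closure_cspan] complex_vs.subspace_add[OF subspace_closure_cspan]
        complex_vs.subspace_scale[OF subspace_closure_cspan])
  from closure_cspan_minimal[OF _ this closed_Collect_adj_in, of D] show ?thesis
    using x D_clinear D_adj subset_closure_cspan[of D] by auto
qed

lemma cstar_subalgebra_closure_cspan: "cstar_subalgebra (closure (cspan D))"
  unfolding cstar_subalgebra_def
  using clinear_op_closure_cspan[OF D_clinear] closure_cspan_compose closure_cspan_adj
    complex_vs.subspace_0[OF subspace_closure_cspan[of D]]
    complex_vs.subspace_add[OF subspace_closure_cspan[of D]]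
    complex_vs.subspace_scale[OF subspace_closure_cspan[of D]]
  by auto

lemma star_hom_closure_cspan:
  assumes F: "clinear_on (closure (cspan D)) F" "continuous_on (closure (cspan D)) F"
    and T: "complex_vs.subspace T" "closed T" "\<And>t. t \<in> T \<Longrightarrow> clinear_op t"
    and F_in: "\<And>d. d \<in> D \<Longrightarrow> F d \<in> T"
    and F_compose: "\<And>d e. d \<in> D \<Longrightarrow> e \<in> D \<Longrightarrow> F (d o\<^sub>L e) = F d o\<^sub>L F e"
    and F_adj: "\<And>d. d \<in> D \<Longrightarrow> F (adj d) = adj (F d)"
  shows "star_hom (closure (cspan D)) T F"
proof -
  let ?A = "closure (cspan D)"
  have FT: "F x \<in> T" if "x \<in> ?A" for x
    by (rule clinear_on_closure_cspan_in[OF F T(1,2) F_in that])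
  have F_clinear: "clinear_op (F x)" if "x \<in> ?A" for x by (rule T(3)[OF FT[OF that]])
  have DA: "d \<in> ?A" if "d \<in> D" for d using that subset_closure_cspan by blast
  \<comment> \<open>Multiplicativity is extended one factor at a time, since the density argument is
    for linear maps of one variable.\<close>
  have mult_D: "F (x o\<^sub>L e) = F x o\<^sub>L F e" if "x \<in> ?A" "e \<in> D" for x e
  proof (rule clinear_on_closure_cspan_eqI[OF _ _ _ _ _ \<open>x \<in> ?A\<close>])
    show "clinear_on ?A (\<lambda>x. F (x o\<^sub>L e))"
      using clinear_on_compose_right[of ?A e] closure_cspan_compose[OF _ DA[OF \<open>e \<in> D\<close>]]
      by (simp add: clinear_on_def clinear_onD[OF F(1)])
    show "clinear_on ?A (\<lambda>x. F x o\<^sub>L F e)"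
      unfolding clinear_on_def
      by (auto intro!: blinfun_eqI simp: clinear_onD[OF F(1)] blinfun.add_left)
    show "continuous_on ?A (\<lambda>x. F (x o\<^sub>L e))"
      by (rule continuous_on_compose2[OF F(2) continuous_on_compose_right])
        (use closure_cspan_compose DA that in blast)
    show "continuous_on ?A (\<lambda>x. F x o\<^sub>L F e)"
      by (rule continuous_on_compose2[OF continuous_on_compose_right F(2) subset_UNIV])
  qed (use F_compose that in auto)
  have mult: "F (x o\<^sub>L y) = F x o\<^sub>L F y" if "x \<in> ?A" "y \<in> ?A" for x y
  proof (rule clinear_on_closure_cspan_eqI[OF _ _ _ _ _ \<open>y \<in> ?A\<close>])
    show "clinear_on ?A (\<lambda>y. F (x o\<^sub>L y))"
      using clinear_on_compose_left[OF clinear_op_closure_cspan[OF D_clinear \<open>x \<in> ?A\<close>], of ?A]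
        closure_cspan_compose[OF \<open>x \<in> ?A\<close>]
      by (simp add: clinear_on_def clinear_onD[OF F(1)])
    show "clinear_on ?A (\<lambda>y. F x o\<^sub>L F y)"
      unfolding clinear_on_def
      by (auto intro!: blinfun_eqI
          simp: clinear_onD[OF F(1)] blinfun.add_left blinfun.add_right clinear_opD[OF F_clinear[OF \<open>x \<in> ?A\<close>]])
    show "continuous_on ?A (\<lambda>y. F (x o\<^sub>L y))"
      by (rule continuous_on_compose2[OF F(2) continuous_on_compose_left])
        (use closure_cspan_compose that in blast)
    show "continuous_on ?A (\<lambda>y. F x o\<^sub>L F y)"
      by (rule continuous_on_compose2[OF continuous_on_compose_left F(2) subset_UNIV])
  qed (use mult_D that in auto)
  obtain K where K: "0 \<le> K" "\<And>x. x \<in> ?A \<Longrightarrow> norm (F x) \<le> K * norm x"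
    using clinear_on_bounded[OF subspace_closure_cspan F] by blast
  have star: "F (adj x) = adj (F x)" if x: "x \<in> ?A" for x
  proof -
    \<comment> \<open>Taking adjoints is conjugate-linear, so the density argument is applied to the
      linear map that conjugates \<open>F\<close> by \<open>adj\<close> on both sides.\<close>
    have "adj (F (adj x)) = F x"
    proof (rule clinear_on_closure_cspan_eqI[OF _ _ F _ x])
      show lin: "clinear_on ?A (\<lambda>x. adj (F (adj x)))"
        unfolding clinear_on_def
        using closure_cspan_adj clinear_op_closure_cspan[OF D_clinear] F_clinear
        by (simp add: adj_add adj_scaleC clinear_onD[OF F(1)])
      show "continuous_on ?A (\<lambda>x. adj (F (adj x)))"
      proof (rule clinear_on_continuousI[OF subspace_closure_cspan lin])
        show "norm (adj (F (adj x))) \<le> K * norm x" if "x \<in> ?A" for x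
          using K(2)[OF closure_cspan_adj[OF that]] closure_cspan_adj[OF that] F_clinear
            clinear_op_closure_cspan[OF D_clinear that]
          by (simp add: norm_adj)
      qed
      show "adj (F (adj d)) = F d" if "d \<in> D" for d
        using that DA F_clinear by (simp add: F_adj adj_adj)
    qed
    then show ?thesis using adj_adj[OF F_clinear[OF closure_cspan_adj[OF x]]] by simp
  qed
  show ?thesis
    unfolding star_hom_def using FT F(1) mult star by auto
qed

end

section \<open>Units, and contractivity of star homomorphisms\<close>

lemma unit_of_eq: "is_unit_of u A \<Longrightarrow> unit_of A = u"
  unfolding unit_of_def by (rule the_equality) (auto simp: is_unit_of_def)

lemma is_unit_of_closure_cspan:
  assumes D: "\<And>d. d \<in> D \<Longrightarrow> clinear_op d" and u: "u \<in> closure (cspan D)"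
    and ud: "\<And>d. d \<in> D \<Longrightarrow> u o\<^sub>L d = d" "\<And>d. d \<in> D \<Longrightarrow> d o\<^sub>L u = d"
  shows "is_unit_of u (closure (cspan D))"
proof -
  have id: "clinear_on X (\<lambda>x :: 'a ell2 \<Rightarrow>\<^sub>L 'a ell2. x)" for X by (simp add: clinear_on_def)
  have "u o\<^sub>L x = x" if "x \<in> closure (cspan D)" for x
    by (rule clinear_on_closure_cspan_eqI[OF
          clinear_on_compose_left[OF clinear_op_closure_cspan[OF D u]] continuous_on_compose_left
          id continuous_on_id _ that]) (simp_all add: ud)
  moreover have "x o\<^sub>L u = x" if "x \<in> closure (cspan D)" for x
    by (rule clinear_on_closure_cspan_eqI[OF clinear_on_compose_right continuous_on_compose_right
          id continuous_on_id _ that]) (simp_all add: ud)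
  ultimately show ?thesis using u by (simp add: is_unit_of_def)
qed

lemma is_unit_of_min_tensor:
  assumes A: "\<And>a. a \<in> A \<Longrightarrow> clinear_op a" and B: "\<And>b. b \<in> B \<Longrightarrow> clinear_op b"
    and u: "is_unit_of u A" and v: "is_unit_of v B"
  shows "is_unit_of (u \<otimes>\<^sub>o v) (A \<otimes>\<^sub>m B)"
  unfolding min_tensor_def
proof (rule is_unit_of_closure_cspan)
  have uA: "u \<in> A" and vB: "v \<in> B" using u v by (auto simp: is_unit_of_def)
  show "u \<otimes>\<^sub>o v \<in> closure (cspan {a \<otimes>\<^sub>o b |a b. a \<in> A \<and> b \<in> B})"
    using tensor_in_min_tensor[OF uA vB] unfolding min_tensor_def .
  fix d assume "d \<in> {a \<otimes>\<^sub>o b |a b. a \<in> A \<and> b \<in> B}"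
  then obtain a b where d: "d = a \<otimes>\<^sub>o b" "a \<in> A" "b \<in> B" by blast
  show "clinear_op d" using d A B by (simp add: clinear_tensor_op)
  show "(u \<otimes>\<^sub>o v) o\<^sub>L d = d" "d o\<^sub>L (u \<otimes>\<^sub>o v) = d"
    using d u v A B uA vB by (simp_all add: tensor_op_compose is_unit_of_def)
qed

text \<open>
  Otherwise \<open>\<mu> = \<parallel>\<phi> a\<parallel>\<^sup>2 > \<parallel>a\<^sup>* a\<parallel>\<close>, so \<open>1 - a\<^sup>* a / \<mu>\<close> is invertible, hence so is its image
  \<open>1 - (\<phi> a)\<^sup>* (\<phi> a) / \<mu>\<close>; but the latter is not bounded below, as \<open>\<phi> a\<close> almost attains its norm.
\<close>

lemma star_hom_norm_le:
  fixes A :: "('i ell2 \<Rightarrow>\<^sub>L 'i ell2) set" and \<phi> :: "('i ell2 \<Rightarrow>\<^sub>L 'i ell2) \<Rightarrow> ('j ell2 \<Rightarrow>\<^sub>L 'j ell2)"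
  assumes A: "cstar_subalgebra A" and B: "\<And>b. b \<in> B \<Longrightarrow> clinear_op b" and \<phi>: "star_hom A B \<phi>" and a: "a \<in> A"
  shows "norm (\<phi> a) \<le> norm a"
proof (rule ccontr)
  assume "\<not> norm (\<phi> a) \<le> norm a"
  then have less: "norm a < norm (\<phi> a)" by simp
  define y where "y = \<phi> a"
  define \<mu> where "\<mu> = (norm y)\<^sup>2"
  have y: "clinear_op y" unfolding y_def using \<phi> a B by (auto simp: star_hom_def)
  have y_pos: "norm y > 0" using less norm_ge_zero[of a] unfolding y_def by linarith
  then have \<mu>: "\<mu> > 0" by (simp add: \<mu>_def)
  note [simp] = cstar_subalgebraD[OF A]
  have lin: "clinear_on A \<phi>" and mult: "\<And>x y. x \<in> A \<Longrightarrow> y \<in> A \<Longrightarrow> \<phi> (x o\<^sub>L y) = \<phi> x o\<^sub>L \<phi> y"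
    using \<phi> by (auto simp: star_hom_def)
  define z where "z = complex_of_real (1 / \<mu>) *\<^sub>C (adj a o\<^sub>L a)"
  have z: "z \<in> A" unfolding z_def using a by (intro complex_vs.subspace_scale) auto
  have "norm z = (1 / \<mu>) * norm (adj a o\<^sub>L a)" using \<mu> by (simp add: z_def norm_scaleC norm_divide)
  also have "\<dots> \<le> (1 / \<mu>) * (norm a * norm a)"
    using \<mu> norm_blinfun_compose[of "adj a" a] a by (intro mult_left_mono) (auto simp: norm_adj)
  also have "\<dots> < 1"
    using \<mu> less y_pos mult_strict_mono[OF less less] by (simp add: \<mu>_def y_def power2_eq_square)
  finally have z1: "norm z < 1" .
  \<comment> \<open>The equation says \<open>(1 + b) (1 - z) = 1\<close>. Solving for
    \<open>b\<close> instead of \<open>1 + b\<close> keeps the solution in \<open>A\<close>, whose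
    unit, if any, need not be the identity operator.\<close>
  have "\<exists>!b. b \<in> A \<and> z + (b o\<^sub>L z) = b"
  proof (rule Banach_fix[of A "norm z" "\<lambda>b. z + (b o\<^sub>L z)"])
    show "complete A" by (simp add: complete_eq_closed)
    show "(\<lambda>b. z + (b o\<^sub>L z)) ` A \<subseteq> A"
      using z by (auto intro!: complex_vs.subspace_add[OF cstar_subalgebraD(2)[OF A]])
    have "dist (z + (x o\<^sub>L z)) (z + (y o\<^sub>L z)) \<le> norm z * dist x y" for x y
    proof -
      have "z + (x o\<^sub>L z) - (z + (y o\<^sub>L z)) = (x - y) o\<^sub>L z"
        by (rule blinfun_eqI) (simp add: blinfun.diff_left blinfun.add_left)
      then show ?thesis
        using norm_blinfun_compose[of "x - y" z] by (simp add: dist_norm mult.commute)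
    qed
    then show "dist (z + (x o\<^sub>L z)) (z + (y o\<^sub>L z)) \<le> norm z * dist x y"
      if "x \<in> A" "y \<in> A" for x y by blast
  qed (use z z1 in auto)
  then obtain b where b: "b \<in> A" "z + (b o\<^sub>L z) = b" by blast
  define c w where "c = \<phi> b" and "w = \<phi> z"
  have w: "w = complex_of_real (1 / \<mu>) *\<^sub>C (adj y o\<^sub>L y)"
    using \<phi> a by (simp add: w_def z_def y_def clinear_onD[OF lin] mult star_hom_def)
  have "c = \<phi> (z + (b o\<^sub>L z))" using b by (simp add: c_def)
  also have "\<dots> = w + (c o\<^sub>L w)"
    using b(1) z by (simp add: clinear_onD[OF lin] mult w_def c_def)
  finally have c: "c = w + (c o\<^sub>L w)" .
  \<comment> \<open>The equation for \<open>c\<close> makes \<open>1 + c\<close> a left inverse of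
    \<open>1 - w\<close>, and \<open>K\<close> bounds its norm.\<close>
  define K where "K = 1 + norm c"
  have K: "K \<ge> 1" by (simp add: K_def)
  \<comment> \<open>As \<open>w\<close> is a contraction, the squared norm of \<open>f - w f\<close>
    is at most twice that of \<open>f\<close> minus \<open>2 / \<mu>\<close> times that of
    \<open>y f\<close>. It is also at least that of \<open>f\<close> divided by
    \<open>K\<^sup>2\<close>. Solving for \<open>y f\<close> produces the factor, which is below 1
    and so contradicts the choice of \<open>\<mu>\<close>.\<close>
  have "(norm (y f))\<^sup>2 \<le> \<mu> * (1 - 1 / (2 * K\<^sup>2)) * (norm f)\<^sup>2" for f
  proof -
    have "c f = w f + c (w f)"
      by (subst c) (simp add: blinfun.add_left)
    then have "f = (f - w f) + c (f - w f)"
      by (simp add: blinfun.diff_right)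
    then have "norm f \<le> norm (f - w f) + norm (c (f - w f))"
      by (metis norm_triangle_ineq)
    also have "\<dots> \<le> K * norm (f - w f)"
      using norm_blinfun[of c "f - w f"] by (simp add: K_def algebra_simps)
    finally have f1: "(norm f)\<^sup>2 \<le> K\<^sup>2 * (norm (f - w f))\<^sup>2"
      by (metis norm_ge_zero power_mono power_mult_distrib)
    have fw: "cinner f (w f) = complex_of_real ((norm (y f))\<^sup>2 / \<mu>)"
      by (simp add: w cinner_adj_right[OF y] cinner_self)
    have "norm (w f) \<le> norm w * norm f" by (rule norm_blinfun)
    also have "norm w \<le> 1"
    proof -
      have "norm w = (1 / \<mu>) * norm (adj y o\<^sub>L y)" using \<mu> by (simp add: w norm_scaleC norm_divide)
      also have "\<dots> \<le> (1 / \<mu>) * (norm y * norm y)"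
        using \<mu> norm_blinfun_compose[of "adj y" y] y by (intro mult_left_mono) (auto simp: norm_adj)
      also have "\<dots> = 1" using \<mu> y_pos by (simp add: \<mu>_def power2_eq_square)
      finally show ?thesis .
    qed
    finally have wf: "(norm (w f))\<^sup>2 \<le> (norm f)\<^sup>2" by (simp add: mult_right_mono power_mono)
    have "complex_of_real ((norm (f - w f))\<^sup>2)
        = cinner f f - cinner f (w f) - cnj (cinner f (w f)) + cinner (w f) (w f)"
      unfolding cinner_self[symmetric] cinner_diff_left cinner_diff_right cinner_commute[of "w f" f]
      by simp
    also have "\<dots> = complex_of_real ((norm f)\<^sup>2 - 2 * ((norm (y f))\<^sup>2 / \<mu>) + (norm (w f))\<^sup>2)"
      unfolding fw cinner_self by simp
    finally have "(norm (f - w f))\<^sup>2 = (norm f)\<^sup>2 - 2 * ((norm (y f))\<^sup>2 / \<mu>) + (norm (w f))\<^sup>2"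
      unfolding of_real_eq_iff .
    then have "(norm (f - w f))\<^sup>2 \<le> 2 * (norm f)\<^sup>2 - 2 * ((norm (y f))\<^sup>2 / \<mu>)"
      using wf by linarith
    then have "K\<^sup>2 * (norm (f - w f))\<^sup>2 \<le> K\<^sup>2 * (2 * (norm f)\<^sup>2 - 2 * ((norm (y f))\<^sup>2 / \<mu>))"
      by (rule mult_left_mono) simp
    with f1 have "(norm f)\<^sup>2 \<le> K\<^sup>2 * (2 * (norm f)\<^sup>2 - 2 * ((norm (y f))\<^sup>2 / \<mu>))" by linarith
    then show ?thesis using K \<mu> by (simp add: field_simps)
  qed
  note ineq = this
  have K': "0 \<le> 1 - 1 / (2 * K\<^sup>2)" "1 - 1 / (2 * K\<^sup>2) < 1"
    using K by (auto simp: field_simps one_le_power intro: order_trans[of 1 "K\<^sup>2"])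
  have "norm y \<le> sqrt (\<mu> * (1 - 1 / (2 * K\<^sup>2)))"
  proof (rule norm_blinfun_bound)
    show "norm (y f) \<le> sqrt (\<mu> * (1 - 1 / (2 * K\<^sup>2))) * norm f" for f
      using real_sqrt_le_mono[OF ineq[of f]] by (simp add: real_sqrt_mult)
  qed (use K' \<mu> in simp)
  then have "(norm y)\<^sup>2 \<le> \<mu> * (1 - 1 / (2 * K\<^sup>2))"
    using K' \<mu> by (metis norm_ge_zero power_mono real_sqrt_pow2 mult_nonneg_nonneg less_imp_le)
  then show False using K' \<mu> by (simp add: \<mu>_def[symmetric])
qed

lemma vector_functional_in_dual_space:
  fixes f :: "'i ell2" and g :: "'j ell2" and A :: "('j ell2 \<Rightarrow>\<^sub>L 'i ell2) set"
  shows "(\<lambda>x. cinner f (blinfun_apply x g)) \<in> dual_space A"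
proof -
  have "bounded_linear (\<lambda>x :: 'j ell2 \<Rightarrow>\<^sub>L 'i ell2. cinner f (x g))"
    by (rule bounded_linear_compose[OF bounded_linear_cinner_right blinfun.bounded_linear_left])
  then have "continuous_on A (\<lambda>x :: 'j ell2 \<Rightarrow>\<^sub>L 'i ell2. cinner f (x g))"
    using linear_continuous_on by blast
  then show ?thesis
    by (simp add: dual_space_def clinear_on_def blinfun.add_left cinner_add_right scaleC_complex_def)
qed

text \<open>Applied to the characters, to all monomials and to the monomials of index 0. On
  \<open>D\<close> convolution is the pointwise product of functionals, hence associative there and
  then on the closed span.\<close>

lemma compact_quantum_semigroup_of_group_like:
  fixes A D :: "('i ell2 \<Rightarrow>\<^sub>L 'i ell2) set"
  assumes A: "A = closure (cspan D)"
    and D_clinear: "\<And>d. d \<in> D \<Longrightarrow> clinear_op d"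
    and D_compose: "\<And>d e. d \<in> D \<Longrightarrow> e \<in> D \<Longrightarrow> d o\<^sub>L e \<in> D"
    and D_adj: "\<And>d. d \<in> D \<Longrightarrow> adj d \<in> D"
    and u: "u \<in> D" "\<And>d. d \<in> D \<Longrightarrow> u o\<^sub>L d = d" "\<And>d. d \<in> D \<Longrightarrow> d o\<^sub>L u = d"
    and \<Delta>: "clinear_on A \<Delta>" "continuous_on A \<Delta>" "\<And>d. d \<in> D \<Longrightarrow> \<Delta> d = d \<otimes>\<^sub>o d"
    and counit: "\<epsilon> \<in> dual_space A" "\<And>d. d \<in> D \<Longrightarrow> \<epsilon> d = 1"
  shows "compact_quantum_semigroup A \<Delta>"
proof -
  have cstar: "cstar_subalgebra A"
    unfolding A by (rule cstar_subalgebra_closure_cspan[OF D_clinear D_compose D_adj])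
  note A_clinear = cstar_subalgebraD(1)[OF cstar] and A_sub = cstar_subalgebraD(2)[OF cstar]
  have DA: "D \<subseteq> A" unfolding A by (rule subset_closure_cspan)
  have unit: "is_unit_of u A"
    unfolding A by (rule is_unit_of_closure_cspan) (use D_clinear u DA A in auto)
  have hom: "star_hom A (A \<otimes>\<^sub>m A) \<Delta>"
    unfolding A
  proof (rule star_hom_closure_cspan[OF D_clinear D_compose D_adj])
    show "clinear_on (closure (cspan D)) \<Delta>" "continuous_on (closure (cspan D)) \<Delta>"
      using \<Delta> A by auto
    show "clinear_op t" if "t \<in> closure (cspan D) \<otimes>\<^sub>m closure (cspan D)" for t
      using clinear_op_min_tensor[OF A_clinear A_clinear] that A by auto
    show "\<Delta> d \<in> closure (cspan D) \<otimes>\<^sub>m closure (cspan D)" if "d \<in> D" for d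
      using \<Delta>(3)[OF that] DA that A by (auto intro: tensor_in_min_tensor)
  qed (auto simp: \<Delta>(3) D_compose D_adj D_clinear tensor_op_compose adj_tensor_op)
  have \<Delta>_in: "\<Delta> x \<in> A \<otimes>\<^sub>m A" if "x \<in> A" for x using hom that by (auto simp: star_hom_def)
  have conv_dual: "conv A \<Delta> \<xi> \<eta> \<in> dual_space A" and conv_D: "\<And>d. d \<in> D \<Longrightarrow> conv A \<Delta> \<xi> \<eta> d = \<xi> d * \<eta> d"
    if "\<xi> \<in> dual_space A" "\<eta> \<in> dual_space A" for \<xi> \<eta>
  proof -
    note TF = tensor_functional[OF A_clinear A_sub A_clinear A_sub that]
    have "clinear_on A (conv A \<Delta> \<xi> \<eta>)"
      using \<Delta>(1) \<Delta>_in unfolding clinear_on_def conv_def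
      by (simp add: clinear_onD[OF TF(1)])
    moreover have "continuous_on A (conv A \<Delta> \<xi> \<eta>)"
      unfolding conv_def by (rule continuous_on_compose2[OF TF(2) \<Delta>(2)]) (use \<Delta>_in in auto)
    ultimately show "conv A \<Delta> \<xi> \<eta> \<in> dual_space A" by (simp add: dual_space_def)
    show "conv A \<Delta> \<xi> \<eta> d = \<xi> d * \<eta> d" if "d \<in> D" for d
      unfolding conv_def \<Delta>(3)[OF that] by (rule TF(3)) (use that DA in auto)
  qed
  have dual_eqI: "\<xi> x = \<eta> x"
    if "\<xi> \<in> dual_space A" "\<eta> \<in> dual_space A" "\<And>d. d \<in> D \<Longrightarrow> \<xi> d = \<eta> d" "x \<in> A" for \<xi> \<eta> x
    by (rule clinear_on_closure_cspan_eqI[of D \<xi> \<eta>]) (use that in \<open>auto simp: A dual_space_def\<close>)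
  have "inj_on \<Delta> A"
  proof (rule inj_onI, rule blinfun_eqI, rule cinner_eqI)
    fix x y f g assume xy: "x \<in> A" "y \<in> A" "\<Delta> x = \<Delta> y"
    let ?\<xi> = "\<lambda>x :: 'i ell2 \<Rightarrow>\<^sub>L 'i ell2. cinner f (blinfun_apply x g)"
    \<comment> \<open>Convolution with the counit returns \<open>?\<xi>\<close>, so
      \<open>\<Delta> x\<close> determines every matrix coefficient of \<open>x\<close>.\<close>
    have e: "conv A \<Delta> ?\<xi> \<epsilon> x = ?\<xi> x" if "x \<in> A" for x
      by (rule dual_eqI[OF conv_dual _ _ that])
        (auto simp: vector_functional_in_dual_space counit conv_D)
    have "conv A \<Delta> ?\<xi> \<epsilon> x = conv A \<Delta> ?\<xi> \<epsilon> y" by (simp only: conv_def xy(3))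
    then show "cinner f (x g) = cinner f (y g)" by (simp only: e xy(1,2))
  qed
  moreover have "conv A \<Delta> (conv A \<Delta> \<xi> \<eta>) \<zeta> x = conv A \<Delta> \<xi> (conv A \<Delta> \<eta> \<zeta>) x"
    if "\<xi> \<in> dual_space A" "\<eta> \<in> dual_space A" "\<zeta> \<in> dual_space A" "x \<in> A" for \<xi> \<eta> \<zeta> x
    by (rule dual_eqI) (use that conv_dual conv_D in \<open>simp_all add: mult.assoc\<close>)
  moreover have "\<Delta> (unit_of A) = unit_of (A \<otimes>\<^sub>m A)"
    using unit_of_eq[OF unit] unit_of_eq[OF is_unit_of_min_tensor[OF A_clinear A_clinear unit unit]]
      \<Delta>(3)[OF u(1)] by simp
  ultimately show ?thesis
    unfolding compact_quantum_semigroup_def unital_cstar_algebra_def unital_star_hom_def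
    using cstar unit hom by (intro conjI exI[of _ u]) auto
qed

section \<open>Characters\<close>

lemma dual_groupD:
  assumes "\<alpha> \<in> dual_group"
  shows "cmod (\<alpha> a) = 1" "\<alpha> (a + b) = \<alpha> a * \<alpha> b" "\<alpha> 0 = 1" "\<alpha> (- a) = cnj (\<alpha> a)"
proof -
  show norm: "cmod (\<alpha> a) = 1" and add: "\<alpha> (a + b) = \<alpha> a * \<alpha> b" for a b
    using assms by (auto simp: dual_group_def)
  have "\<alpha> 0 \<noteq> 0" using norm[of 0] by auto
  then show zero: "\<alpha> 0 = 1" using add[of 0 0] by simp
  have "\<alpha> (- a) * \<alpha> a = 1" using add[of "- a" a] zero by simp
  moreover have "cnj (\<alpha> a) * \<alpha> a = 1"
    using complex_norm_square[of "\<alpha> a"] norm[of a] by (simp add: mult.commute)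
  moreover have "\<alpha> a \<noteq> 0" using norm[of a] by auto
  ultimately show "\<alpha> (- a) = cnj (\<alpha> a)" by (metis mult_right_cancel)
qed

lemma one_in_dual_group: "(\<lambda>_. 1) \<in> dual_group"
  and mult_in_dual_group: "\<alpha> \<in> dual_group \<Longrightarrow> \<beta> \<in> dual_group \<Longrightarrow> (\<lambda>a. \<alpha> a * \<beta> a) \<in> dual_group"
  by (auto simp: dual_group_def norm_mult)

lemma continuous_on_character: "continuous_on X (\<lambda>\<alpha>. \<alpha> a)"
  for X :: "('g::ab_group_add \<Rightarrow> complex) set"
  by (rule continuous_on_subset[OF continuous_on_product_coordinates]) simp

text \<open>A closed subset of a product of circles, which is compact by Tychonoff.\<close>

lemma compact_dual_group: "compact (dual_group :: ('g::ab_group_add \<Rightarrow> complex) set)"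
proof -
  let ?P = "PiE UNIV (\<lambda>_ :: 'g. sphere (0 :: complex) 1)"
  have "compactin (product_topology (\<lambda>_. euclidean) UNIV) ?P"
    unfolding compactin_PiE by (simp add: compactin_euclidean_iff)
  then have "compact ?P"
    unfolding euclidean_product_topology compactin_euclidean_iff .
  moreover have "closed (\<Inter>a :: 'g. \<Inter>b. {\<alpha> :: 'g \<Rightarrow> complex. \<alpha> (a + b) = \<alpha> a * \<alpha> b})"
    by (intro closed_INT ballI closed_Collect_eq continuous_intros continuous_on_product_coordinates)
  ultimately have "compact (?P \<inter> (\<Inter>a. \<Inter>b. {\<alpha>. \<alpha> (a + b) = \<alpha> a * \<alpha> b}))"
    by (rule compact_Int_closed)
  moreover have "?P \<inter> (\<Inter>a. \<Inter>b. {\<alpha>. \<alpha> (a + b) = \<alpha> a * \<alpha> b}) = dual_group"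
    by (auto simp: dual_group_def PiE_def Pi_def)
  ultimately show ?thesis by simp
qed

section \<open>Extending characters from subgroups\<close>

lemma sum_const_add: "(\<Sum>i<m + n. x) = (\<Sum>i<m. x) + (\<Sum>i<n. x)" for x :: "'a::comm_monoid_add" and m n :: nat
  by (induction n) (simp_all add: add.assoc)

text \<open>Natural multiples of a group element are written as constant sums, to match the
  hypothesis of torsion-freeness; this is the law (m n) x = m (n x).\<close>

lemma sum_const_mult: "(\<Sum>i<m * n. x) = (\<Sum>i<m. \<Sum>i<n. x)" for x :: "'a::comm_monoid_add" and m n :: nat
  by (induction m) (simp_all add: sum_const_add add.commute)

text \<open>Graphs of unitary characters of subgroups, as subgroups of \<open>\<Gamma> \<times> \<complex>\<^sup>\<times>\<close>.\<close>

definition partial_character :: "('g::ab_group_add \<times> complex) set \<Rightarrow> bool"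
  where "partial_character R \<longleftrightarrow> (0, 1) \<in> R \<and> (\<forall>x w. (x, w) \<in> R \<longrightarrow> cmod w = 1) \<and>
    (\<forall>x w y v. (x, w) \<in> R \<longrightarrow> (y, v) \<in> R \<longrightarrow> (x - y, w / v) \<in> R) \<and> (\<forall>w. (0, w) \<in> R \<longrightarrow> w = 1)"

context
  fixes R :: "('g::ab_group_add \<times> complex) set"
  assumes R: "partial_character R"
begin

lemma partial_character_0: "(0, 1) \<in> R"
  and partial_character_norm: "(x, w) \<in> R \<Longrightarrow> cmod w = 1"
  and partial_character_diff: "(x, w) \<in> R \<Longrightarrow> (y, v) \<in> R \<Longrightarrow> (x - y, w / v) \<in> R"
  and partial_character_at_0: "(0, w) \<in> R \<Longrightarrow> w = 1"
  using R unfolding partial_character_def by blast+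

lemma partial_character_unique: "(x, w) \<in> R \<Longrightarrow> (x, v) \<in> R \<Longrightarrow> w = v"
  using partial_character_at_0[of "w / v"] partial_character_diff[of x w x v] by auto

lemma partial_character_uminus: "(x, w) \<in> R \<Longrightarrow> (- x, 1 / w) \<in> R"
  using partial_character_diff[OF partial_character_0, of x w] by simp

lemma partial_character_add: "(x, w) \<in> R \<Longrightarrow> (y, v) \<in> R \<Longrightarrow> (x + y, w * v) \<in> R"
  using partial_character_diff[OF _ partial_character_uminus, of x w y v] by simp

lemma partial_character_multiple: "(x, w) \<in> R \<Longrightarrow> ((\<Sum>i<n. x), w ^ n) \<in> R"
  by (induction n) (simp_all add: partial_character_0 partial_character_add mult.commute[of w])

text \<open>The value \<open>z\<close> at \<open>x\<close> is admissible as soon as it agrees with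
  \<open>R\<close> on those multiples of \<open>x\<close> that already lie in the domain.\<close>

lemma partial_character_extend:
  assumes z: "cmod z = 1" and mult: "\<And>k v. ((\<Sum>i<k. x), v) \<in> R \<Longrightarrow> v = z ^ k"
  obtains R' where "partial_character R'" "R \<subseteq> R'" "(x, z) \<in> R'"
proof -
  \<comment> \<open>An integer multiple of \<open>x\<close> is encoded as a difference of two
    natural multiples.\<close>
  define R' where "R' = {(y + (\<Sum>i<n. x) - (\<Sum>i<m. x), w * z ^ n / z ^ m) | y w n m. (y, w) \<in> R}"
  have R'I: "(y + (\<Sum>i<n. x) - (\<Sum>i<m. x), w * z ^ n / z ^ m) \<in> R'" if "(y, w) \<in> R" for y w n m
    unfolding R'_def using that by blast
  have z0: "z \<noteq> 0" using z by auto
  have "partial_character R'"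
    unfolding partial_character_def
  proof (intro conjI allI impI)
    show "(0, 1) \<in> R'" using R'I[OF partial_character_0, of 0 0] by simp
    show "cmod w = 1" if "(x, w) \<in> R'" for x w
      using that partial_character_norm by (auto simp: R'_def norm_mult norm_divide norm_power z)
    show "(a - b, w / v) \<in> R'" if a: "(a, w) \<in> R'" and b: "(b, v) \<in> R'" for a w b v
    proof -
      obtain y w' n m where a': "a = y + (\<Sum>i<n. x) - (\<Sum>i<m. x)" "w = w' * z ^ n / z ^ m" "(y, w') \<in> R"
        using a unfolding R'_def by blast
      obtain y' v' n' m' where b': "b = y' + (\<Sum>i<n'. x) - (\<Sum>i<m'. x)" "v = v' * z ^ n' / z ^ m'" "(y', v') \<in> R"
        using b unfolding R'_def by blast
      have "(a - b, w / v) = (y - y' + (\<Sum>i<n + m'. x) - (\<Sum>i<m + n'. x), w' / v' * z ^ (n + m') / z ^ (m + n'))"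
        unfolding a' b' sum_const_add by (simp add: power_add field_simps)
      then show ?thesis using R'I[OF partial_character_diff[OF a'(3) b'(3)]] by metis
    qed
    show "w = 1" if w: "(0, w) \<in> R'" for w
    proof -
      obtain y w' n m where y: "0 = y + (\<Sum>i<n. x) - (\<Sum>i<m. x)" "w = w' * z ^ n / z ^ m" "(y, w') \<in> R"
        using w unfolding R'_def by blast
      have w': "w' \<noteq> 0" using partial_character_norm[OF y(3)] by auto
      show ?thesis
      \<comment> \<open>According to the sign of \<open>n - m\<close>, the relation says that
        \<open>- y\<close> or \<open>y\<close> is a natural multiple of \<open>x\<close>, where
        \<open>mult\<close> applies.\<close>
      proof (cases "m \<le> n")
        case True
        then obtain k where k: "n = k + m" by (metis add.commute le_Suc_ex)
        with y(1) have "- y = (\<Sum>i<k. x)"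
          unfolding k sum_const_add by (simp add: minus_unique)
        then have "1 / w' = z ^ k" using mult partial_character_uminus[OF y(3)] by simp
        then show ?thesis using y(2) w' z0 by (simp add: k power_add field_simps)
      next
        case False
        then obtain k where k: "m = k + n" by (metis add.commute le_Suc_ex nat_le_linear)
        with y(1) have "y = (\<Sum>i<k. x)" unfolding k sum_const_add by simp
        then have "w' = z ^ k" using mult y(3) by simp
        then show ?thesis using y(2) z0 by (simp add: k power_add)
      qed
    qed
  qed
  moreover have "R \<subseteq> R'" using R'I[of _ _ 0 0] by auto
  moreover have "(x, z) \<in> R'" using R'I[OF partial_character_0, of 1 0] by simp
  ultimately show thesis using that by blast
qed

text \<open>The circle is divisible: if \<open>k\<close> is the least positive integer with
  \<open>k x\<close> in the domain, any \<open>k\<close>-th root of the value there may be taken at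
  \<open>x\<close>.\<close>

lemma partial_character_extend_exists:
  obtains R' z where "partial_character R'" "R \<subseteq> R'" "(x, z) \<in> R'"
proof (cases "\<exists>k::nat. k > 0 \<and> (\<exists>v. ((\<Sum>i<k. x), v) \<in> R)")
  case True
  define k :: nat where "k = (LEAST k. k > 0 \<and> (\<exists>v. ((\<Sum>i<k. x), v) \<in> R))"
  obtain v where k: "k > 0" "((\<Sum>i<k. x), v) \<in> R"
    using LeastI_ex[OF True] unfolding k_def by blast
  define z where "z = cis (Arg v / real k)"
  have "z ^ k = cis (Arg v)" using k(1) by (simp add: z_def Complex.DeMoivre)
  also have "\<dots> = v"
    using partial_character_norm[OF k(2)] cis_Arg[of v]
    by (cases "v = 0") (auto simp: sgn_div_norm)
  finally have z: "z ^ k = v" .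
  have "w = z ^ l" if l: "((\<Sum>i<l. x), w) \<in> R" for l :: nat and w
  proof -
    \<comment> \<open>Otherwise the remainder would give a smaller positive multiple of
      \<open>x\<close> in the domain.\<close>
    have "l mod k = 0"
    proof (rule ccontr)
      assume "l mod k \<noteq> 0"
      have "(\<Sum>i<l. x) = (\<Sum>i<l div k. \<Sum>i<k. x) + (\<Sum>i<l mod k. x)"
        by (simp flip: sum_const_mult sum_const_add)
      then have "(\<Sum>i<l mod k. x) = (\<Sum>i<l. x) - (\<Sum>i<l div k. \<Sum>i<k. x)" by simp
      then have "\<exists>u. ((\<Sum>i<l mod k. x), u) \<in> R"
        using partial_character_diff[OF l partial_character_multiple[OF k(2)]] by metis
      then have "k \<le> l mod k"
        unfolding k_def using \<open>l mod k \<noteq> 0\<close> by (intro Least_le) (auto simp: k_def)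
      then show False using mod_less_divisor[OF k(1), of l] by simp
    qed
    then obtain q where q: "l = q * k" by (metis mod_0_imp_dvd dvd_def mult.commute)
    have "((\<Sum>i<l. x), v ^ q) \<in> R"
      unfolding q sum_const_mult by (rule partial_character_multiple[OF k(2)])
    then have "w = v ^ q" using l partial_character_unique by blast
    then show ?thesis by (simp add: z[symmetric] q mult.commute flip: power_mult)
  qed
  moreover have "cmod z = 1" by (simp add: z_def)
  ultimately show ?thesis using partial_character_extend that by blast
next
  case False
  \<comment> \<open>No positive multiple of \<open>x\<close> lies in the domain, so only
    \<open>k = 0\<close> is to be checked and the value 1 can be chosen.\<close>
  have "v = 1 ^ k" if v: "((\<Sum>i<k. x), v) \<in> R" for k v
  proof -
    have "k = 0" using v False by (metis gr0I)
    then have "(0, v) \<in> R" using v by simp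
    from partial_character_at_0[OF this] show ?thesis by simp
  qed
  from partial_character_extend[OF norm_one this] show ?thesis using that by blast
qed

end

text \<open>Torsion-freeness leaves no relation on the multiples of \<open>g\<close>, so the value
  -1 is consistent. Zorn's lemma gives a maximal partial character with this value, and one-step
  extension forces it to be defined everywhere.\<close>

lemma characters_separate:
  fixes g :: "'g::ab_group_add"
  assumes tf: "\<And>(n::nat) (x::'g). n > 0 \<Longrightarrow> (\<Sum>i<n. x) = 0 \<Longrightarrow> x = 0" and g: "g \<noteq> 0"
  obtains \<alpha> where "\<alpha> \<in> dual_group" "\<alpha> g \<noteq> 1"
proof -
  let ?\<A> = "{R :: ('g \<times> complex) set. partial_character R \<and> (g, - 1) \<in> R}"
  have "partial_character {(0 :: 'g, 1)}" by (simp add: partial_character_def)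
  moreover have "v = (- 1) ^ k" if "((\<Sum>i<k. g), v) \<in> {(0 :: 'g, 1)}" for k v
    using that tf[of k g] g by (cases "k = 0") auto
  ultimately obtain R where "partial_character R" "(g, - 1) \<in> R"
    using partial_character_extend[of "{(0, 1)}" "- 1" g] by auto
  then have "?\<A> \<noteq> {}" by blast
  moreover have "\<Union>C \<in> ?\<A>" if C: "C \<noteq> {}" "subset.chain ?\<A> C" for C
  proof -
    have C_in: "partial_character R" "(g, - 1) \<in> R" if "R \<in> C" for R
      using C(2) that unfolding subset_chain_def by auto
    have "partial_character (\<Union>C)"
      unfolding partial_character_def
    proof (intro conjI allI impI)
      show "(0, 1) \<in> \<Union>C" using C(1) C_in(1) partial_character_0 by blast
      show "cmod w = 1" if "(x, w) \<in> \<Union>C" for x w using that C_in(1) partial_character_norm by blast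
      show "w = 1" if "(0, w) \<in> \<Union>C" for w using that C_in(1) partial_character_at_0 by blast
      show "(x - y, w / v) \<in> \<Union>C" if "(x, w) \<in> \<Union>C" "(y, v) \<in> \<Union>C" for x w y v
      proof -
        from that obtain R R' where R: "R \<in> C" "(x, w) \<in> R" "R' \<in> C" "(y, v) \<in> R'" by blast
        then have "R \<subseteq> R' \<or> R' \<subseteq> R" using C(2) unfolding subset_chain_def by blast
        then obtain R'' where "R'' \<in> C" "(x, w) \<in> R''" "(y, v) \<in> R''" using R by blast
        then show ?thesis using C_in(1) partial_character_diff by blast
      qed
    qed
    then show ?thesis using C(1) C_in(2) by blast
  qed
  ultimately obtain M where M: "M \<in> ?\<A>" "\<forall>X\<in>?\<A>. M \<subseteq> X \<longrightarrow> X = M"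
    using subset_Zorn_nonempty[of ?\<A>] by blast
  have pM: "partial_character M" and gM: "(g, - 1) \<in> M" using M(1) by auto
  have "\<exists>w. (x, w) \<in> M" for x
  proof -
    obtain R' z where R': "partial_character R'" "M \<subseteq> R'" "(x, z) \<in> R'"
      by (rule partial_character_extend_exists[OF pM])
    then show ?thesis using M(2) gM by blast
  qed
  then obtain \<alpha> where \<alpha>: "\<And>x. (x, \<alpha> x) \<in> M" by metis
  show thesis
  proof
    show "\<alpha> \<in> dual_group"
      unfolding dual_group_def
      using partial_character_norm[OF pM \<alpha>]
        partial_character_unique[OF pM \<alpha> partial_character_add[OF pM \<alpha> \<alpha>]] by blast
    show "\<alpha> g \<noteq> 1" using partial_character_unique[OF pM \<alpha> gM] by simp
  qed
qed

section \<open>The algebra of continuous functions on the dual group\<close>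

abbreviation (input) char_op :: "'g::ab_group_add \<Rightarrow> ('g \<Rightarrow> complex) ell2 \<Rightarrow>\<^sub>L ('g \<Rightarrow> complex) ell2"
  where "char_op g \<equiv> mult_op dual_group (\<lambda>\<alpha>. \<alpha> g)"

lemma char_op_ket: "char_op g (ket \<alpha>) = (if \<alpha> \<in> dual_group then \<alpha> g *\<^sub>C ket \<alpha> else 0)"
  and clinear_char_op: "clinear_op (char_op g)"
  by (rule mult_op_ket[where C = 1] clinear_mult_op[where C = 1]; simp add: dual_groupD)+

lemma symbol_char_op: "\<alpha> \<in> dual_group \<Longrightarrow> symbol (char_op g) \<alpha> = \<alpha> g"
  by (rule symbol_mult_op[where C = 1]) (simp_all add: dual_groupD)

lemma char_op_compose: "char_op g o\<^sub>L char_op h = char_op (g + h)"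
  by (rule mult_op_eqI[symmetric])
    (auto simp: clinear_op_compose clinear_char_op char_op_ket clinear_opD[OF clinear_char_op]
      dual_groupD scaleC_scaleC mult.commute)

lemma adj_char_op: "adj (char_op g) = char_op (- g)"
  by (rule adj_eq_ketI[OF clinear_char_op clinear_char_op]) (auto simp: char_op_ket dual_groupD)

text \<open>Compactness bounds the representing function, and boundedness is what makes
  \<open>mult_op\<close> an actual operator with that symbol.\<close>

lemma cont_algebraD:
  fixes K :: "'k::topological_space set"
  assumes K: "compact K" and X: "X \<in> cont_algebra K"
  shows "clinear_op X" "mult_op K (symbol X) = X" "continuous_on K (symbol X)"
proof -
  obtain f where f: "X = mult_op K f" "continuous_on K f" using X by (auto simp: cont_algebra_def)
  have "bounded (f ` K)" by (rule compact_imp_bounded[OF compact_continuous_image[OF f(2) K]])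
  then obtain C where C: "\<And>k. k \<in> K \<Longrightarrow> cmod (f k) \<le> C" unfolding bounded_iff by blast
  show "clinear_op X" unfolding f by (rule clinear_mult_op[OF C])
  have sym: "symbol X k = f k" if "k \<in> K" for k unfolding f by (rule symbol_mult_op[OF C that])
  show "mult_op K (symbol X) = X" unfolding f(1) by (rule mult_op_cong) (simp add: sym[unfolded f(1)])
  show "continuous_on K (symbol X)" using f(2) sym by (simp cong: continuous_on_cong)
qed

text \<open>Symbols are contractive in the operator, so norm convergence of operators is uniform
  convergence of symbols.\<close>

lemma closed_Collect_continuous_symbol: "closed {X. continuous_on K (symbol X)}"
  unfolding closed_sequential_limits
proof (intro allI impI, elim conjE)
  fix s X assume s: "\<forall>n. s n \<in> {X. continuous_on K (symbol X)}" "s \<longlonglongrightarrow> X"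
  have "uniform_limit K (\<lambda>n. symbol (s n)) (symbol X) sequentially"
  proof (rule uniform_limitI)
    fix e :: real assume "e > 0"
    then have "\<forall>\<^sub>F n in sequentially. dist (s n) X < e" using s(2) by (rule tendstoD[rotated])
    then show "\<forall>\<^sub>F n in sequentially. \<forall>k\<in>K. dist (symbol (s n) k) (symbol X k) < e"
    proof eventually_elim
      case (elim n)
      have "symbol (s n) k - symbol X k = symbol (s n - X) k" for k
        by (simp add: symbol_def blinfun.diff_left)
      then show ?case
        using elim norm_symbol_le[of "s n - X"] by (auto simp: dist_norm intro: le_less_trans)
    qed
  qed
  then have "continuous_on K (symbol X)"
    by (rule uniform_limit_theorem[rotated]) (use s(1) in auto)
  then show "X \<in> {X. continuous_on K (symbol X)}" by simp
qed

text \<open>The easy half of the density of characters; the converse is \<open>CG_eq\<close>, where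
  the surjection \<open>\<pi>\<close> is available.\<close>

lemma closure_cspan_char_op_subset:
  "closure (cspan (range char_op)) \<subseteq> cont_algebra (dual_group :: ('g::ab_group_add \<Rightarrow> complex) set)"
proof
  fix X :: "('g \<Rightarrow> complex) ell2 \<Rightarrow>\<^sub>L ('g \<Rightarrow> complex) ell2"
  assume X: "X \<in> closure (cspan (range char_op))"
  have "complex_vs.subspace {X. continuous_on dual_group (symbol X)}"
    by (rule complex_vs.subspaceI)
      (auto simp: symbol_add symbol_scaleC symbol_def[of 0] intro!: continuous_intros)
  moreover have "range char_op \<subseteq> {X. continuous_on dual_group (symbol X)}"
    by (auto simp: symbol_char_op continuous_on_character cong: continuous_on_cong)
  ultimately have "continuous_on dual_group (symbol X)"
    using closure_cspan_minimal[OF _ _ closed_Collect_continuous_symbol] X by blast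
  moreover have "mult_op dual_group (symbol X) = X"
  proof (rule clinear_on_closure_cspan_eqI[OF _ _ _ continuous_on_id _ X])
    show lin: "clinear_on (closure (cspan (range char_op))) (\<lambda>X. mult_op dual_group (symbol X))"
      by (simp add: clinear_on_def mult_op_symbol_add[where h = "\<lambda>k. k"] mult_op_symbol_scaleC[where h = "\<lambda>k. k"])
    show "continuous_on (closure (cspan (range char_op))) (\<lambda>X. mult_op dual_group (symbol X))"
      by (rule clinear_on_continuousI[OF subspace_closure_cspan lin, of 1])
        (use norm_mult_op_symbol_le[where h = "\<lambda>k. k"] in auto)
    show "mult_op dual_group (symbol d) = d" if d: "d \<in> range char_op" for d
    proof -
      obtain g where "d = char_op g" using d by blast
      then show ?thesis by (auto intro!: mult_op_cong simp: symbol_char_op)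
    qed
  qed (simp add: clinear_on_def)
  ultimately show "X \<in> cont_algebra dual_group"
    unfolding cont_algebra_def by (metis (mono_tags, lifting) mem_Collect_eq)
qed

lemma dual_comult_eq: "dual_comult X = mult_op (dual_group \<times> dual_group) (\<lambda>p. symbol X (\<lambda>a. fst p a * snd p a))"
  unfolding dual_comult_def by (simp add: case_prod_beta')

lemma clinear_on_dual_comult: "clinear_on A dual_comult"
  unfolding clinear_on_def dual_comult_eq
  by (simp add: mult_op_symbol_add mult_op_symbol_scaleC)

lemma continuous_on_dual_comult: "complex_vs.subspace A \<Longrightarrow> continuous_on A dual_comult"
  by (rule clinear_on_continuousI[OF _ clinear_on_dual_comult, of _ 1])
    (simp_all add: dual_comult_eq norm_mult_op_symbol_le)

lemma dual_comult_char_op: "dual_comult (char_op g) = char_op g \<otimes>\<^sub>o char_op g"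
proof (rule tensor_op_eqI[symmetric, OF clinear_char_op clinear_char_op])
  show "clinear_op (dual_comult (char_op g))"
    unfolding dual_comult_eq by (rule clinear_mult_op_symbol)
  show "dual_comult (char_op g) (ket (\<alpha>, \<beta>)) = char_op g (ket \<alpha>) \<otimes>\<^sub>v char_op g (ket \<beta>)" for \<alpha> \<beta>
    by (auto simp: dual_comult_eq mult_op_symbol_ket char_op_ket symbol_char_op mult_in_dual_group
        tensor_vec_scaleC_left tensor_vec_scaleC_right scaleC_scaleC mult.commute)
qed

lemma symbol_in_dual_space: "(\<lambda>X. symbol X k) \<in> dual_space A"
  unfolding symbol_def by (rule vector_functional_in_dual_space)

lemma is_unit_of_closure_cspan_char_op: "is_unit_of (char_op 0) (closure (cspan (range char_op)))"
  by (rule is_unit_of_closure_cspan)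
    (use clinear_char_op subset_closure_cspan[of "range char_op"] in \<open>auto simp: char_op_compose\<close>)

text \<open>Stated for the closed span of the characters, because its equality with
  \<open>cont_algebra dual_group\<close> is established only later.\<close>

lemma compact_quantum_semigroup_char_op:
  "compact_quantum_semigroup (closure (cspan (range char_op))) dual_comult"
proof (rule compact_quantum_semigroup_of_group_like[where D = "range char_op" and u = "char_op 0"
      and \<epsilon> = "\<lambda>X. symbol X (\<lambda>_. 1)"])
  show "symbol d (\<lambda>_. 1) = 1" if "d \<in> range char_op" for d :: "('a \<Rightarrow> complex) ell2 \<Rightarrow>\<^sub>L _"
    using that by (auto simp: symbol_char_op one_in_dual_group)
qed (auto simp: clinear_char_op char_op_compose adj_char_op clinear_on_dual_comult
    continuous_on_dual_comult dual_comult_char_op symbol_in_dual_space)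

section \<open>Monomials\<close>

lemma ket_eq_iff [simp]: "ket i = ket j \<longleftrightarrow> i = j"
proof
  assume "ket i = ket j"
  then have "Rep_ell2 (ket i) i = Rep_ell2 (ket j) i" by simp
  then show "i = j" by (simp split: if_splits)
qed simp

lemma ket_neq_0 [simp]: "ket i \<noteq> 0"
proof
  assume "ket i = 0"
  then have "Rep_ell2 (ket i) i = Rep_ell2 0 i" by simp
  then show False by simp
qed

lemma trans_op_exists:
  fixes S :: "'g::ab_group_add set"
  shows "clinear_op (trans_op S a) \<and> (\<forall>b. trans_op S a (ket b) = (if b \<in> S then ket (a + b) else 0))"
proof -
  let ?s = "\<lambda>b. if b \<in> S then 1 else 0 :: complex"
  have "inj_on (\<lambda>b. a + b) {b. ?s b \<noteq> 0}" "\<And>b. cmod (?s b) \<le> 1" by simp_all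
  then obtain X :: "'g ell2 \<Rightarrow>\<^sub>L 'g ell2"
    where X: "clinear_op X" "\<And>b. X (ket b) = ?s b *\<^sub>C ket (a + b)"
    using weighted_shift_exists[of "\<lambda>b. a + b" ?s 1] by blast
  have "trans_op S a = X"
    unfolding trans_op_def by (rule the_equality) (use X in \<open>auto intro!: clinear_op_eqI\<close>)
  with X show ?thesis by auto
qed

lemma trans_op_ket: "trans_op S a (ket b) = (if b \<in> S then ket (a + b) else 0)"
  and clinear_trans_op: "clinear_op (trans_op S a)"
  using trans_op_exists[of S a] by auto

lemma adj_trans_op_ket: "adj (trans_op S a) (ket b) = (if b - a \<in> S then ket (b - a) else 0)"
  by (rule ell2_eqI) (auto simp: Rep_adj_ket[OF clinear_trans_op] trans_op_ket)

lemma clinear_adj_trans_op: "clinear_op (adj (trans_op S a))"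
  by (rule clinear_op_adj[OF clinear_trans_op])

lemma clinear_monomial: "V \<in> monomials S \<Longrightarrow> clinear_op V"
  by (induction rule: monomials.induct)
    (auto intro: clinear_trans_op clinear_adj_trans_op clinear_op_compose)

lemma adj_monomial: "V \<in> monomials S \<Longrightarrow> adj V \<in> monomials S"
proof (induction rule: monomials.induct)
  case (adj_trans a)
  then show ?case by (simp add: adj_adj[OF clinear_trans_op] monomials.trans)
next
  case (comp V W)
  then show ?case by (simp add: adj_compose clinear_monomial monomials.comp)
qed (rule monomials.adj_trans)

lemma reduced_cstar_eq: "reduced_cstar S = closure (cspan (monomials S))"
proof
  show "reduced_cstar S \<subseteq> closure (cspan (monomials S))"
    unfolding reduced_cstar_def
    using subset_closure_cspan[of "monomials S"]
    by (intro hull_minimal cstar_subalgebra_closure_cspan clinear_monomial adj_monomial monomials.comp)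
      (auto intro: monomials.trans)
  show "closure (cspan (monomials S)) \<subseteq> reduced_cstar S"
    unfolding reduced_cstar_def hull_def
  proof (rule Inter_greatest)
    fix A assume "A \<in> {t. cstar_subalgebra t \<and> trans_op S ` S \<subseteq> t}"
    then have A: "cstar_subalgebra A" "trans_op S ` S \<subseteq> A" by auto
    note A' = cstar_subalgebraD[OF A(1)]
    have "V \<in> A" if "V \<in> monomials S" for V
      using that by (induction rule: monomials.induct) (use A(2) A'(3,4) in auto)
    then show "closure (cspan (monomials S)) \<subseteq> A"
      by (intro closure_cspan_minimal A') auto
  qed
qed

text \<open>The second clause, a translation on some translate c + S, is what pins down
  \<open>g\<close>: by the first clause alone the zero operator would shift by every
  element.\<close>

definition shifts_by :: "'g::ab_group_add set \<Rightarrow> ('g ell2 \<Rightarrow>\<^sub>L 'g ell2) \<Rightarrow> 'g \<Rightarrow> bool"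
  where "shifts_by S V g \<longleftrightarrow>
    (\<forall>x. V (ket x) = 0 \<or> x \<in> S \<and> x + g \<in> S \<and> V (ket x) = ket (x + g)) \<and>
    (\<exists>c\<in>S. \<forall>x\<in>S. V (ket (c + x)) = ket (c + x + g))"

lemma shifts_by_cases:
  assumes "shifts_by S V g"
  obtains "V (ket x) = 0" | "x \<in> S" "x + g \<in> S" "V (ket x) = ket (x + g)"
  using assms unfolding shifts_by_def by blast

lemma shifts_by_zero_diagonal:
  assumes "shifts_by S V 0"
  shows "V (ket x) = (if V (ket x) = 0 then 0 else 1) *\<^sub>C ket x"
  by (rule shifts_by_cases[OF assms, of x]) auto

locale generating_semigroup =
  fixes S :: "'g::ab_group_add set"
  assumes zero_in: "0 \<in> S"
    and add_in: "\<And>a b. a \<in> S \<Longrightarrow> b \<in> S \<Longrightarrow> a + b \<in> S"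
    and generates: "\<And>g. \<exists>a\<in>S. \<exists>b\<in>S. g = a - b"
begin

lemma shifts_by_trans: "a \<in> S \<Longrightarrow> shifts_by S (trans_op S a) a"
  unfolding shifts_by_def
  by (intro conjI bexI[of _ 0]) (auto simp: trans_op_ket zero_in add_in add.commute)

lemma shifts_by_adj_trans:
  assumes a: "a \<in> S"
  shows "shifts_by S (adj (trans_op S a)) (- a)"
  unfolding shifts_by_def
proof (intro conjI bexI[of _ a] allI ballI)
  show "adj (trans_op S a) (ket x) = 0 \<or>
      x \<in> S \<and> x + - a \<in> S \<and> adj (trans_op S a) (ket x) = ket (x + - a)" for x
    using add_in[OF a, of "x - a"] by (auto simp: adj_trans_op_ket)
qed (use a in \<open>auto simp: adj_trans_op_ket\<close>)

text \<open>The index is additive once both operators are translations on a common translate of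
  \<open>S\<close>.\<close>

lemma shifts_by_compose:
  assumes V: "shifts_by S V g" and W: "shifts_by S W h"
  shows "shifts_by S (V o\<^sub>L W) (g + h)"
proof -
  obtain c where c: "c \<in> S" "\<And>x. x \<in> S \<Longrightarrow> V (ket (c + x)) = ket (c + x + g)"
    using V unfolding shifts_by_def by blast
  obtain d where d: "d \<in> S" "\<And>x. x \<in> S \<Longrightarrow> W (ket (d + x)) = ket (d + x + h)"
    using W unfolding shifts_by_def by blast
  obtain p q where pq: "p \<in> S" "q \<in> S" "h = p - q" using generates by blast
  \<comment> \<open>The summand \<open>d\<close> lets \<open>W\<close> act as a translation. Adding
    \<open>h = p - q\<close> cancels \<open>q\<close> and leaves an element of c + S, where
    \<open>V\<close> does too.\<close>
  have "(V o\<^sub>L W) (ket (d + c + q + x)) = ket (d + c + q + x + (g + h))" if x: "x \<in> S" for x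
  proof -
    have e: "d + c + q + x = d + (c + q + x)" by (simp add: algebra_simps)
    have f: "d + (c + q + x) + h = c + (d + p + x)" by (simp add: pq(3) algebra_simps)
    have gh: "c + (d + p + x) + g = d + c + q + x + (g + h)" by (simp add: pq(3) algebra_simps)
    have "W (ket (d + c + q + x)) = ket (c + (d + p + x))"
      unfolding e f[symmetric] by (rule d(2)) (use x c(1) pq(2) add_in in simp)
    moreover have "V (ket (c + (d + p + x))) = ket (d + c + q + x + (g + h))"
      unfolding gh[symmetric] by (rule c(2)) (use x d(1) pq(1) add_in in simp)
    ultimately show ?thesis by (simp only: blinfun_apply_blinfun_compose)
  qed
  moreover have "d + c + q \<in> S" using c d pq add_in by simp
  moreover have "(V o\<^sub>L W) (ket x) = 0 \<or>
      x \<in> S \<and> x + (g + h) \<in> S \<and> (V o\<^sub>L W) (ket x) = ket (x + (g + h))" for x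
  proof (rule shifts_by_cases[OF W, of x])
    assume W': "x \<in> S" "x + h \<in> S" "W (ket x) = ket (x + h)"
    have e: "x + h + g = x + (g + h)" by (simp add: algebra_simps)
    show ?thesis
      by (rule shifts_by_cases[OF V, of "x + h"]) (use W' e in simp_all)
  qed simp
  ultimately show ?thesis unfolding shifts_by_def by blast
qed

text \<open>The adjoint is carried through the same induction, which gives its index without a
  discussion of partial isometries.\<close>

lemma monomial_shifts_by: "V \<in> monomials S \<Longrightarrow> \<exists>g. shifts_by S V g \<and> shifts_by S (adj V) (- g)"
proof (induction rule: monomials.induct)
  case (trans a)
  then show ?case using shifts_by_trans shifts_by_adj_trans by blast
next
  case (adj_trans a)
  then show ?case
    using shifts_by_trans[of a] shifts_by_adj_trans[of a]
    by (intro exI[of _ "- a"]) (simp add: adj_adj[OF clinear_trans_op])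
next
  case (comp V W)
  then obtain g h where "shifts_by S V g" "shifts_by S (adj V) (- g)" "shifts_by S W h"
      "shifts_by S (adj W) (- h)"
    by blast
  moreover have "adj (V o\<^sub>L W) = adj W o\<^sub>L adj V"
    using comp by (simp add: adj_compose clinear_monomial)
  ultimately show ?case
    using shifts_by_compose[of V g W h] shifts_by_compose[of "adj W" "- h" "adj V" "- g"]
    by (intro exI[of _ "g + h"]) (simp add: algebra_simps)
qed

lemma adj_trans_op_compose_trans_op_ket:
  assumes "a \<in> S" "b \<in> S"
  shows "(adj (trans_op S a) o\<^sub>L trans_op S b) (ket x)
    = (if x \<in> S \<and> x + (b - a) \<in> S then ket (x + (b - a)) else 0)"
  by (auto simp: trans_op_ket adj_trans_op_ket algebra_simps)

text \<open>Compressing \<open>V\<close> by a translation far enough into \<open>S\<close> leaves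
  the truncated shift by \<open>g\<close>. It equals
  \<open>adj (trans_op S a) o\<^sub>L trans_op S b\<close> whenever \<open>b - a = g\<close>, so the
  choice of the pair does not matter.\<close>

lemma monomial_index_eq:
  assumes V: "clinear_op V" "shifts_by S V g"
  shows "monomial_index S V = g"
  unfolding monomial_index_def
proof (rule the_equality)
  obtain c where c: "c \<in> S" "\<And>x. x \<in> S \<Longrightarrow> V (ket (c + x)) = ket (c + x + g)"
    using V(2) unfolding shifts_by_def by blast
  have compress: "(adj (trans_op S d) o\<^sub>L V o\<^sub>L trans_op S d) (ket x)
      = (if x \<in> S \<and> x + g \<in> S then ket (x + g) else 0)" if d: "d - c \<in> S" for d x
  proof (cases "x \<in> S")
    case True
    have "V (ket (d + x)) = ket (d + x + g)" using c(2)[OF add_in[OF d True]] by simp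
    moreover have "d + x + g - d = x + g" by simp
    ultimately show ?thesis using True by (simp add: trans_op_ket adj_trans_op_ket)
  qed (simp add: trans_op_ket)
  obtain b a where ab: "b \<in> S" "a \<in> S" "g = b - a" using generates by blast
  have "adj (trans_op S d) o\<^sub>L V o\<^sub>L trans_op S d = adj (trans_op S a) o\<^sub>L trans_op S b"
    if "d - c \<in> S" for d
    by (rule clinear_op_eqI)
      (simp_all only: compress[OF that] adj_trans_op_compose_trans_op_ket[OF ab(2,1)] ab(3)
        clinear_op_compose clinear_trans_op clinear_adj_trans_op V)
  with ab c show "\<exists>a\<in>S. \<exists>b\<in>S. g = b - a \<and> (\<exists>c\<^sub>0\<in>S. \<forall>c\<in>S. c - c\<^sub>0 \<in> S \<longrightarrow>
       adj (trans_op S c) o\<^sub>L V o\<^sub>L trans_op S c = adj (trans_op S a) o\<^sub>L trans_op S b)"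
    by blast
  fix h assume "\<exists>a\<in>S. \<exists>b\<in>S. h = b - a \<and> (\<exists>c\<^sub>0\<in>S. \<forall>c\<in>S. c - c\<^sub>0 \<in> S \<longrightarrow>
       adj (trans_op S c) o\<^sub>L V o\<^sub>L trans_op S c = adj (trans_op S a) o\<^sub>L trans_op S b)"
  then obtain a' b' c' where h: "a' \<in> S" "b' \<in> S" "h = b' - a'" "c' \<in> S"
    "\<And>c. c \<in> S \<Longrightarrow> c - c' \<in> S \<Longrightarrow>
       adj (trans_op S c) o\<^sub>L V o\<^sub>L trans_op S c = adj (trans_op S a') o\<^sub>L trans_op S b'"
    by blast
  \<comment> \<open>The element \<open>c + c'\<close> lies above both thresholds, so both
    descriptions of the compression hold there. They are then compared on the basis vector at
    \<open>a\<close>, where the left side is non-zero because a + g = b is in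
    \<open>S\<close>.\<close>
  have "adj (trans_op S (c + c')) o\<^sub>L V o\<^sub>L trans_op S (c + c') = adj (trans_op S a') o\<^sub>L trans_op S b'"
    by (rule h(5)) (use c h(4) add_in in auto)
  then have "(if a \<in> S \<and> a + g \<in> S then ket (a + g) else 0)
      = (if a \<in> S \<and> a + h \<in> S then ket (a + h) else 0)"
    using compress[of "c + c'" a] h(4) by (simp only: adj_trans_op_compose_trans_op_ket[OF h(1,2)] h(3)) simp
  then show "h = g" using ab by (simp split: if_splits)
qed

lemma monomial_shifts_by_index:
  assumes "V \<in> monomials S"
  shows "shifts_by S V (monomial_index S V)"
  using monomial_shifts_by[OF assms] monomial_index_eq[OF clinear_monomial[OF assms]] by auto

lemma monomial_index_compose:
  assumes "V \<in> monomials S" "W \<in> monomials S"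
  shows "monomial_index S (V o\<^sub>L W) = monomial_index S V + monomial_index S W"
  by (rule monomial_index_eq[OF clinear_op_compose shifts_by_compose])
    (use assms in \<open>auto intro: clinear_monomial monomial_shifts_by_index\<close>)

lemma monomial_index_adj:
  assumes "V \<in> monomials S"
  shows "monomial_index S (adj V) = - monomial_index S V"
proof -
  obtain g where g: "shifts_by S V g" "shifts_by S (adj V) (- g)"
    using monomial_shifts_by[OF assms] by blast
  have "monomial_index S (adj V) = - g"
    by (rule monomial_index_eq[OF clinear_monomial[OF adj_monomial[OF assms]] g(2)])
  also have "g = monomial_index S V"
    by (rule monomial_index_eq[OF clinear_monomial[OF assms] g(1), symmetric])
  finally show ?thesis .
qed

lemma monomial_index_trans: "a \<in> S \<Longrightarrow> monomial_index S (trans_op S a) = a"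
  by (intro monomial_index_eq clinear_trans_op shifts_by_trans)

text \<open>\<open>trans_op S 0\<close> is the projection onto the square-summable families on
  \<open>S\<close>, the unit of the algebra.\<close>

lemma trans_op_0_compose:
  assumes "V \<in> monomials S"
  shows "trans_op S 0 o\<^sub>L V = V" "V o\<^sub>L trans_op S 0 = V"
proof -
  note V = clinear_monomial[OF assms] and cases = shifts_by_cases[OF monomial_shifts_by_index[OF assms]]
  show "trans_op S 0 o\<^sub>L V = V"
  proof (rule clinear_op_eqI)
    show "(trans_op S 0 o\<^sub>L V) (ket x) = V (ket x)" for x
      by (rule cases[of x]) (auto simp: trans_op_ket)
  qed (auto intro: clinear_op_compose clinear_trans_op V)
  show "V o\<^sub>L trans_op S 0 = V"
  proof (rule clinear_op_eqI)
    show "(V o\<^sub>L trans_op S 0) (ket x) = V (ket x)" for x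
      by (rule cases[of x]) (auto simp: trans_op_ket)
  qed (auto intro: clinear_op_compose clinear_trans_op V)
qed

text \<open>Monomials of index 0 are diagonal in the canonical basis.\<close>

lemma index_zero_compose_commute:
  assumes V: "V \<in> monomials S" "monomial_index S V = 0" and W: "W \<in> monomials S" "monomial_index S W = 0"
  shows "V o\<^sub>L W = W o\<^sub>L V"
proof (rule clinear_op_eqI)
  fix x
  have d: "U (ket x) = (if U (ket x) = 0 then 0 else 1) *\<^sub>C ket x"
    if "U \<in> monomials S" "monomial_index S U = 0" for U
    by (rule shifts_by_zero_diagonal) (use monomial_shifts_by_index[OF that(1)] that(2) in simp)
  have "(V o\<^sub>L W) (ket x) = (if W (ket x) = 0 then 0 else 1) *\<^sub>C (if V (ket x) = 0 then 0 else 1) *\<^sub>C ket x"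
    using d[OF V] d[OF W] clinear_opD[OF clinear_monomial[OF V(1)]] by (metis blinfun_apply_blinfun_compose)
  moreover have "(W o\<^sub>L V) (ket x) = (if V (ket x) = 0 then 0 else 1) *\<^sub>C (if W (ket x) = 0 then 0 else 1) *\<^sub>C ket x"
    using d[OF V] d[OF W] clinear_opD[OF clinear_monomial[OF W(1)]] by (metis blinfun_apply_blinfun_compose)
  ultimately show "(V o\<^sub>L W) (ket x) = (W o\<^sub>L V) (ket x)" by auto
qed (use assms in \<open>auto intro: clinear_op_compose clinear_monomial\<close>)

end

section \<open>The natural action of the dual group\<close>

lemma clinear_on_comp:
  assumes "clinear_on A F" "clinear_on B G" "\<And>x. x \<in> A \<Longrightarrow> F x \<in> B"
  shows "clinear_on A (\<lambda>x. G (F x))"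
  using assms unfolding clinear_on_def by simp

lemma continuous_on_comp:
  "continuous_on A F \<Longrightarrow> continuous_on B G \<Longrightarrow> (\<And>x. x \<in> A \<Longrightarrow> F x \<in> B) \<Longrightarrow> continuous_on A (\<lambda>x. G (F x))"
  by (rule continuous_on_compose2[of B G]) auto

lemma clinear_on_id: "clinear_on A id" and clinear_on_ident: "clinear_on A (\<lambda>x. x)"
  by (simp_all add: clinear_on_def)

lemma clinear_on_blinfun_apply: "clinear_on A (\<lambda>x. blinfun_apply x f)"
  by (simp add: clinear_on_def blinfun.add_left)

lemma continuous_on_blinfun_apply: "continuous_on A (\<lambda>x. blinfun_apply x f)"
  by (rule bounded_linear.continuous_on[OF blinfun.bounded_linear_left continuous_on_id])

lemma tensor_ket_right_cancel:
  assumes "f \<otimes>\<^sub>v ket k = g \<otimes>\<^sub>v ket k"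
  shows "f = g"
proof (rule ell2_eqI)
  show "Rep_ell2 f i = Rep_ell2 g i" for i
    using arg_cong[OF assms, of "\<lambda>v. Rep_ell2 v (i, k)"] by simp
qed

locale semigroup_action = generating_semigroup S
  for S :: "'g::ab_group_add set" +
  fixes \<Delta> :: "('g ell2 \<Rightarrow>\<^sub>L 'g ell2) \<Rightarrow> (('g \<times> 'g) ell2 \<Rightarrow>\<^sub>L ('g \<times> 'g) ell2)"
    and \<pi> :: "('g ell2 \<Rightarrow>\<^sub>L 'g ell2) \<Rightarrow> (('g \<Rightarrow> complex) ell2 \<Rightarrow>\<^sub>L ('g \<Rightarrow> complex) ell2)"
    and \<tau> :: "('g \<Rightarrow> complex) \<Rightarrow> ('g ell2 \<Rightarrow>\<^sub>L 'g ell2) \<Rightarrow> ('g ell2 \<Rightarrow>\<^sub>L 'g ell2)"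
  assumes torsion_free: "\<And>(n::nat) (x::'g). n > 0 \<Longrightarrow> (\<Sum>i<n. x) = 0 \<Longrightarrow> x = 0"
    and \<Delta>_linear: "clinear_on (reduced_cstar S) \<Delta>"
    and \<Delta>_continuous: "continuous_on (reduced_cstar S) \<Delta>"
    and \<Delta>_monomial: "\<And>V. V \<in> monomials S \<Longrightarrow> \<Delta> V = V \<otimes>\<^sub>o V"
    and \<pi>_hom: "star_hom (reduced_cstar S) (cont_algebra dual_group) \<pi>"
    and \<pi>_surj: "\<pi> ` reduced_cstar S = cont_algebra dual_group"
    and \<pi>_trans: "\<And>a. a \<in> S \<Longrightarrow> \<pi> (trans_op S a) = mult_op dual_group (\<lambda>\<alpha>. \<alpha> a)"
    and \<tau>_hom: "\<And>\<alpha>. \<alpha> \<in> dual_group \<Longrightarrow> star_hom (reduced_cstar S) (reduced_cstar S) (\<tau> \<alpha>)"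
    and \<tau>_trans: "\<And>\<alpha> a. \<alpha> \<in> dual_group \<Longrightarrow> a \<in> S \<Longrightarrow> \<tau> \<alpha> (trans_op S a) = \<alpha> a *\<^sub>C trans_op S a"
begin

section \<open>The algebra, its quotient C(G) and the automorphisms\<close>

abbreviation "A \<equiv> reduced_cstar S"
abbreviation "CG \<equiv> cont_algebra (dual_group :: ('g \<Rightarrow> complex) set)"
abbreviation "ind V \<equiv> monomial_index S V"
abbreviation "\<delta> \<equiv> natural_action A \<Delta> \<pi>"
abbreviation "D0 \<equiv> {V \<in> monomials S. ind V = 0}"

lemma cstar_A: "cstar_subalgebra A"
  unfolding reduced_cstar_eq
  by (rule cstar_subalgebra_closure_cspan) (auto intro: clinear_monomial adj_monomial monomials.comp)

lemmas A_clinear = cstar_subalgebraD(1)[OF cstar_A]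
  and A_subspace = cstar_subalgebraD(2)[OF cstar_A]
  and A_compose = cstar_subalgebraD(3)[OF cstar_A]
  and A_adj = cstar_subalgebraD(4)[OF cstar_A]
  and A_closed = cstar_subalgebraD(5)[OF cstar_A]

lemma monomial_in_A: "V \<in> monomials S \<Longrightarrow> V \<in> A"
  unfolding reduced_cstar_eq using subset_closure_cspan by (rule subsetD)

lemma clinear_on_A_eqI:
  assumes "clinear_on A F" "continuous_on A F" "clinear_on A G" "continuous_on A G"
    and "\<And>V. V \<in> monomials S \<Longrightarrow> F V = G V" "a \<in> A"
  shows "F a = G a"
  using assms unfolding reduced_cstar_eq by (rule clinear_on_closure_cspan_eqI)

lemma \<pi>_linear: "clinear_on A \<pi>" and \<pi>_in: "a \<in> A \<Longrightarrow> \<pi> a \<in> CG"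
  and \<pi>_compose: "a \<in> A \<Longrightarrow> b \<in> A \<Longrightarrow> \<pi> (a o\<^sub>L b) = \<pi> a o\<^sub>L \<pi> b"
  and \<pi>_adj: "a \<in> A \<Longrightarrow> \<pi> (adj a) = adj (\<pi> a)"
  using \<pi>_hom unfolding star_hom_def by auto

lemma CG_clinear: "X \<in> CG \<Longrightarrow> clinear_op X"
  by (rule cont_algebraD(1)[OF compact_dual_group])

lemma CG_mult_op: "X \<in> CG \<Longrightarrow> mult_op dual_group (symbol X) = X"
  by (rule cont_algebraD(2)[OF compact_dual_group])

lemma norm_\<pi>_le: "a \<in> A \<Longrightarrow> norm (\<pi> a) \<le> norm a"
  by (rule star_hom_norm_le[OF cstar_A CG_clinear \<pi>_hom])

lemma \<pi>_continuous: "continuous_on A \<pi>"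
  by (rule clinear_on_continuousI[OF A_subspace \<pi>_linear, of 1]) (simp add: norm_\<pi>_le)

lemma \<pi>_monomial: "V \<in> monomials S \<Longrightarrow> \<pi> V = char_op (ind V)"
proof (induction rule: monomials.induct)
  case (trans a)
  then show ?case by (simp add: \<pi>_trans monomial_index_trans)
next
  case (adj_trans a)
  then have "trans_op S a \<in> monomials S" by (rule monomials.trans)
  with adj_trans show ?case
    by (simp add: \<pi>_adj monomial_in_A \<pi>_trans adj_char_op monomial_index_adj monomial_index_trans)
next
  case (comp V W)
  then show ?case
    by (simp add: \<pi>_compose monomial_in_A monomial_index_compose char_op_compose)
qed

text \<open>Since \<open>\<pi>\<close> is onto, continuous and maps monomials to characters, every
  continuous function is a limit of combinations of characters.\<close>

lemma CG_eq: "CG = closure (cspan (range char_op))"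
proof
  show "CG \<subseteq> closure (cspan (range char_op))"
  proof
    fix X assume "X \<in> CG"
    then obtain a where a: "a \<in> A" "X = \<pi> a" using \<pi>_surj by blast
    show "X \<in> closure (cspan (range char_op))"
      unfolding a(2)
    proof (rule clinear_on_closure_cspan_in[OF \<pi>_linear[unfolded reduced_cstar_eq]
          \<pi>_continuous[unfolded reduced_cstar_eq] _ _ _ a(1)[unfolded reduced_cstar_eq]])
      show "\<pi> V \<in> closure (cspan (range char_op))" if "V \<in> monomials S" for V
        unfolding \<pi>_monomial[OF that] by (rule subsetD[OF subset_closure_cspan rangeI])
    qed simp_all
  qed
qed (rule closure_cspan_char_op_subset)

lemma CG_subspace: "complex_vs.subspace CG"
  unfolding CG_eq by simp

lemma CG_unit: "is_unit_of (char_op 0) CG"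
  unfolding CG_eq by (rule is_unit_of_closure_cspan_char_op)

lemma char_op_in_CG: "char_op g \<in> CG"
  unfolding CG_eq by (rule subsetD[OF subset_closure_cspan rangeI])

lemma CG_quantum_semigroup: "compact_quantum_semigroup CG dual_comult"
  unfolding CG_eq by (rule compact_quantum_semigroup_char_op)

context
  fixes \<alpha> :: "'g \<Rightarrow> complex"
  assumes \<alpha>: "\<alpha> \<in> dual_group"
begin

lemma \<tau>_linear: "clinear_on A (\<tau> \<alpha>)" and \<tau>_in: "a \<in> A \<Longrightarrow> \<tau> \<alpha> a \<in> A"
  and \<tau>_compose: "a \<in> A \<Longrightarrow> b \<in> A \<Longrightarrow> \<tau> \<alpha> (a o\<^sub>L b) = \<tau> \<alpha> a o\<^sub>L \<tau> \<alpha> b"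
  and \<tau>_adj: "a \<in> A \<Longrightarrow> \<tau> \<alpha> (adj a) = adj (\<tau> \<alpha> a)"
  using \<tau>_hom[OF \<alpha>] unfolding star_hom_def by auto

lemma norm_\<tau>_le: "a \<in> A \<Longrightarrow> norm (\<tau> \<alpha> a) \<le> norm a"
  by (rule star_hom_norm_le[OF cstar_A A_clinear \<tau>_hom[OF \<alpha>]])

lemma \<tau>_continuous: "continuous_on A (\<tau> \<alpha>)"
  by (rule clinear_on_continuousI[OF A_subspace \<tau>_linear, of 1]) (simp add: norm_\<tau>_le)

lemma \<tau>_monomial: "V \<in> monomials S \<Longrightarrow> \<tau> \<alpha> V = \<alpha> (ind V) *\<^sub>C V"
proof (induction rule: monomials.induct)
  case (trans a)
  then show ?case by (simp add: \<tau>_trans \<alpha> monomial_index_trans)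
next
  case (adj_trans a)
  then have "trans_op S a \<in> monomials S" by (rule monomials.trans)
  with adj_trans show ?case
    by (simp add: \<tau>_adj monomial_in_A \<tau>_trans \<alpha> adj_scaleC clinear_trans_op monomial_index_adj
        monomial_index_trans dual_groupD)
next
  case (comp V W)
  have "(\<alpha> (ind V) *\<^sub>C V) o\<^sub>L (\<alpha> (ind W) *\<^sub>C W) = (\<alpha> (ind V) * \<alpha> (ind W)) *\<^sub>C (V o\<^sub>L W)"
    by (rule blinfun_eqI) (simp add: clinear_opD[OF clinear_monomial[OF comp(1)]] scaleC_scaleC)
  with comp show ?case
    by (simp add: \<tau>_compose monomial_in_A monomial_index_compose dual_groupD[OF \<alpha>])
qed

text \<open>A monomial has non-zero matrix entries only at positions (x, y) with x - y equal to its
  index, so its scalar \<alpha>(ind V) can be read off from the position. In this form the identity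
  is linear and continuous in the operator.\<close>

lemma Rep_\<tau>_ket:
  assumes "a \<in> A"
  shows "Rep_ell2 (\<tau> \<alpha> a (ket y)) x = \<alpha> (x - y) * Rep_ell2 (a (ket y)) x"
proof -
  let ?e = "\<lambda>b :: 'g ell2 \<Rightarrow>\<^sub>L 'g ell2. cinner (ket x) (blinfun_apply b (ket y))"
  have e: "clinear_on B ?e" "continuous_on B ?e" for B
    using vector_functional_in_dual_space[of "ket x" "ket y" B] by (simp_all only: dual_space_def mem_Collect_eq)
  have "?e (\<tau> \<alpha> a) = \<alpha> (x - y) * ?e a"
  proof (rule clinear_on_A_eqI[OF _ _ _ _ _ assms])
    show "clinear_on A (\<lambda>a. ?e (\<tau> \<alpha> a))" by (rule clinear_on_comp[OF \<tau>_linear e(1)[of UNIV]]) simp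
    show "continuous_on A (\<lambda>a. ?e (\<tau> \<alpha> a))" by (rule continuous_on_comp[OF \<tau>_continuous e(2)[of UNIV]]) simp
    show "clinear_on A (\<lambda>a. \<alpha> (x - y) * ?e a)"
      using e(1)[of A] by (simp add: clinear_on_def scaleC_complex_def distrib_left mult.left_commute)
    show "continuous_on A (\<lambda>a. \<alpha> (x - y) * ?e a)"
      by (intro continuous_on_mult continuous_on_const e(2))
    fix V assume V: "V \<in> monomials S"
    show "?e (\<tau> \<alpha> V) = \<alpha> (x - y) * ?e V"
      using shifts_by_cases[OF monomial_shifts_by_index[OF V], of y]
      by cases (auto simp: \<tau>_monomial[OF V])
  qed
  then show ?thesis by simp
qed

end

section \<open>The counit and the quantum subsemigroup C(G)\<close>

lemma counit_in_dual_space: "(\<lambda>a. symbol (\<pi> a) \<alpha>) \<in> dual_space A"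
proof -
  have e: "clinear_on UNIV (\<lambda>X. symbol X \<alpha>)" "continuous_on UNIV (\<lambda>X. symbol X \<alpha>)"
    using symbol_in_dual_space[of \<alpha> UNIV] by (simp_all add: dual_space_def)
  show ?thesis
    unfolding dual_space_def
    using clinear_on_comp[OF \<pi>_linear e(1)] continuous_on_comp[OF \<pi>_continuous e(2)] by simp
qed

lemma counit_monomial: "V \<in> monomials S \<Longrightarrow> symbol (\<pi> V) (\<lambda>_. 1) = 1"
  by (simp add: \<pi>_monomial symbol_char_op one_in_dual_group)

lemma trans_op_0_monomial: "trans_op S 0 \<in> monomials S"
  by (rule monomials.trans[OF zero_in])

lemma A_unit: "is_unit_of (trans_op S 0) A"
  unfolding reduced_cstar_eq
  by (rule is_unit_of_closure_cspan)
    (use trans_op_0_monomial subset_closure_cspan[of "monomials S"] in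
      \<open>auto simp: clinear_monomial trans_op_0_compose\<close>)

lemma A_quantum_semigroup: "compact_quantum_semigroup A \<Delta>"
  by (rule compact_quantum_semigroup_of_group_like[where D = "monomials S" and u = "trans_op S 0",
        OF reduced_cstar_eq _ _ _ trans_op_0_monomial _ _ \<Delta>_linear \<Delta>_continuous _
          counit_in_dual_space[of "\<lambda>_. 1"]])
    (simp_all add: clinear_monomial adj_monomial monomials.comp trans_op_0_compose \<Delta>_monomial counit_monomial)

lemma \<Delta>_in: "a \<in> A \<Longrightarrow> \<Delta> a \<in> A \<otimes>\<^sub>m A"
  using A_quantum_semigroup
  by (auto simp: compact_quantum_semigroup_def unital_star_hom_def star_hom_def)

lemma clinear_on_symbol_\<pi>: "clinear_on A (\<lambda>b. symbol (\<pi> b) k)"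
  using counit_in_dual_space by (simp add: dual_space_def)

lemma norm_symbol_\<pi>_le: "b \<in> A \<Longrightarrow> cmod (symbol (\<pi> b) k) \<le> norm b"
  using norm_symbol_le[of "\<pi> b" k] norm_\<pi>_le[of b] by linarith

text \<open>Each \<open>\<pi> b\<close> is multiplication by its symbol; the functionals that
  \<open>tensor_map_mult_op\<close> asks for are the points of G pulled back along
  \<open>\<pi>\<close>.\<close>

lemma tensor_map_id_\<pi>_linear: "clinear_on (A \<otimes>\<^sub>m A) (tensor_map A A id \<pi>)"
  and tensor_map_id_\<pi>_continuous: "continuous_on (A \<otimes>\<^sub>m A) (tensor_map A A id \<pi>)"
  and tensor_map_id_\<pi>_apply: "a \<in> A \<Longrightarrow> b \<in> A \<Longrightarrow> tensor_map A A id \<pi> (a \<otimes>\<^sub>o b) = id a \<otimes>\<^sub>o \<pi> b"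
  by (rule tensor_map_mult_op[where \<phi> = id and \<psi> = \<pi> and C = 1 and M = "dual_group"
        and h = "\<lambda>k b. symbol (\<pi> b) k"];
      simp add: A_clinear A_subspace clinear_on_id clinear_on_symbol_\<pi> norm_symbol_\<pi>_le CG_mult_op \<pi>_in)+

lemma tensor_map_\<pi>_\<pi>_linear: "clinear_on (A \<otimes>\<^sub>m A) (tensor_map A A \<pi> \<pi>)"
  and tensor_map_\<pi>_\<pi>_continuous: "continuous_on (A \<otimes>\<^sub>m A) (tensor_map A A \<pi> \<pi>)"
  and tensor_map_\<pi>_\<pi>_apply: "a \<in> A \<Longrightarrow> b \<in> A \<Longrightarrow> tensor_map A A \<pi> \<pi> (a \<otimes>\<^sub>o b) = \<pi> a \<otimes>\<^sub>o \<pi> b"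
  by (rule tensor_map_mult_op[where \<phi> = \<pi> and \<psi> = \<pi> and C = 1 and M = "dual_group"
        and h = "\<lambda>k b. symbol (\<pi> b) k"];
      simp add: A_clinear A_subspace \<pi>_linear norm_\<pi>_le CG_clinear
        clinear_on_symbol_\<pi> norm_symbol_\<pi>_le CG_mult_op \<pi>_in)+

lemma quantum_subsemigroup: "compact_quantum_subsemigroup A \<Delta> CG dual_comult \<pi>"
proof -
  have "dual_comult (\<pi> a) = tensor_map A A \<pi> \<pi> (\<Delta> a)" if "a \<in> A" for a
  proof (rule clinear_on_A_eqI[OF _ _ _ _ _ that])
    show "clinear_on A (\<lambda>a. dual_comult (\<pi> a))"
      by (rule clinear_on_comp[OF \<pi>_linear clinear_on_dual_comult \<pi>_in])
    show "continuous_on A (\<lambda>a. dual_comult (\<pi> a))"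
      by (rule continuous_on_comp[OF \<pi>_continuous continuous_on_dual_comult[OF CG_subspace] \<pi>_in])
    show "clinear_on A (\<lambda>a. tensor_map A A \<pi> \<pi> (\<Delta> a))"
      by (rule clinear_on_comp[OF \<Delta>_linear tensor_map_\<pi>_\<pi>_linear \<Delta>_in])
    show "continuous_on A (\<lambda>a. tensor_map A A \<pi> \<pi> (\<Delta> a))"
      by (rule continuous_on_comp[OF \<Delta>_continuous tensor_map_\<pi>_\<pi>_continuous \<Delta>_in])
    show "dual_comult (\<pi> V) = tensor_map A A \<pi> \<pi> (\<Delta> V)" if "V \<in> monomials S" for V
      using that
      by (simp add: \<Delta>_monomial tensor_map_\<pi>_\<pi>_apply monomial_in_A \<pi>_monomial dual_comult_char_op)
  qed
  then show ?thesis
    unfolding compact_quantum_subsemigroup_def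
    using A_quantum_semigroup CG_quantum_semigroup \<pi>_hom \<pi>_surj by blast
qed

section \<open>The natural action and its identification with \<tau>\<close>

lemma \<delta>_linear: "clinear_on A \<delta>"
  unfolding natural_action_def by (rule clinear_on_comp[OF \<Delta>_linear tensor_map_id_\<pi>_linear \<Delta>_in])

lemma \<delta>_continuous: "continuous_on A \<delta>"
  unfolding natural_action_def by (rule continuous_on_comp[OF \<Delta>_continuous tensor_map_id_\<pi>_continuous \<Delta>_in])

lemma \<delta>_monomial: "V \<in> monomials S \<Longrightarrow> \<delta> V = V \<otimes>\<^sub>o char_op (ind V)"
  by (simp add: natural_action_def \<Delta>_monomial tensor_map_id_\<pi>_apply monomial_in_A \<pi>_monomial)

lemma clinear_op_A_CG: "x \<in> A \<otimes>\<^sub>m CG \<Longrightarrow> clinear_op x"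
  by (rule clinear_op_min_tensor[OF A_clinear CG_clinear])

lemma \<delta>_star_hom: "star_hom A (A \<otimes>\<^sub>m CG) \<delta>"
proof (rule star_hom_closure_cspan[of "monomials S", folded reduced_cstar_eq[of S],
      OF clinear_monomial monomials.comp adj_monomial \<delta>_linear \<delta>_continuous])
  fix V W assume V: "V \<in> monomials S" and W: "W \<in> monomials S"
  show "\<delta> V \<in> A \<otimes>\<^sub>m CG"
    unfolding \<delta>_monomial[OF V] by (rule tensor_in_min_tensor[OF monomial_in_A[OF V] char_op_in_CG])
  show "\<delta> (V o\<^sub>L W) = \<delta> V o\<^sub>L \<delta> W"
    using V W by (simp add: \<delta>_monomial monomials.comp tensor_op_compose clinear_monomial clinear_char_op
        char_op_compose monomial_index_compose)
  show "\<delta> (adj V) = adj (\<delta> V)"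
    using V by (simp add: \<delta>_monomial adj_monomial adj_tensor_op clinear_monomial clinear_char_op
        adj_char_op monomial_index_adj)
qed (auto intro: clinear_op_A_CG)

lemma \<delta>_in: "a \<in> A \<Longrightarrow> \<delta> a \<in> A \<otimes>\<^sub>m CG"
  using \<delta>_star_hom by (auto simp: star_hom_def)

lemma \<delta>_clinear: "a \<in> A \<Longrightarrow> clinear_op (\<delta> a)"
  by (rule clinear_op_A_CG[OF \<delta>_in])

lemma \<delta>_unital: "unital_star_hom A (A \<otimes>\<^sub>m CG) \<delta>"
proof -
  have "\<delta> (trans_op S 0) = trans_op S 0 \<otimes>\<^sub>o char_op 0"
    using \<delta>_monomial[OF trans_op_0_monomial] by (simp add: monomial_index_trans zero_in)
  then show ?thesis
    unfolding unital_star_hom_def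
    using \<delta>_star_hom unit_of_eq[OF A_unit]
      unit_of_eq[OF is_unit_of_min_tensor[OF A_clinear CG_clinear A_unit CG_unit]] by simp
qed

lemma norm_\<delta>_le: "a \<in> A \<Longrightarrow> norm (\<delta> a) \<le> norm a"
  by (rule star_hom_norm_le[OF cstar_A clinear_op_A_CG \<delta>_star_hom])

lemma clinear_on_symbol: "clinear_on B (\<lambda>X. symbol X k)"
  by (simp add: clinear_on_def symbol_add symbol_scaleC scaleC_complex_def)

lemma tensor_map_\<delta>_id_linear: "clinear_on (A \<otimes>\<^sub>m CG) (tensor_map A CG \<delta> id)"
  and tensor_map_\<delta>_id_continuous: "continuous_on (A \<otimes>\<^sub>m CG) (tensor_map A CG \<delta> id)"
  and tensor_map_\<delta>_id_apply: "a \<in> A \<Longrightarrow> b \<in> CG \<Longrightarrow> tensor_map A CG \<delta> id (a \<otimes>\<^sub>o b) = \<delta> a \<otimes>\<^sub>o id b"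
  by (rule tensor_map_mult_op[where \<phi> = \<delta> and \<psi> = id and C = 1 and M = "dual_group"
        and h = "\<lambda>k b. symbol b k"];
      simp add: A_clinear A_subspace CG_clinear CG_subspace \<delta>_linear norm_\<delta>_le
        \<delta>_clinear clinear_on_symbol norm_symbol_le CG_mult_op)+

text \<open>\<open>dual_comult b\<close> is multiplication by a function of two characters, so here
  the functionals are indexed by pairs.\<close>

lemma tensor_map_id_comult_linear: "clinear_on (A \<otimes>\<^sub>m CG) (tensor_map A CG id dual_comult)"
  and tensor_map_id_comult_continuous: "continuous_on (A \<otimes>\<^sub>m CG) (tensor_map A CG id dual_comult)"
  and tensor_map_id_comult_apply:
    "a \<in> A \<Longrightarrow> b \<in> CG \<Longrightarrow> tensor_map A CG id dual_comult (a \<otimes>\<^sub>o b) = id a \<otimes>\<^sub>o dual_comult b"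
  by (rule tensor_map_mult_op[where \<phi> = id and \<psi> = dual_comult and C = 1 and M = "dual_group \<times> dual_group"
        and h = "\<lambda>p b. symbol b (\<lambda>a. fst p a * snd p a)"];
      simp add: A_clinear A_subspace CG_clinear CG_subspace clinear_on_id
        clinear_on_symbol norm_symbol_le dual_comult_eq)+

text \<open>On a monomial both sides of coassociativity are \<open>V\<close> tensored with two
  copies of its character, up to bracketing.\<close>

lemma \<delta>_quantum_action: "quantum_action CG dual_comult A \<delta>"
proof -
  have "assoc_ell2 (tensor_map A CG \<delta> id (\<delta> a) f) = tensor_map A CG id dual_comult (\<delta> a) (assoc_ell2 f)"
    if "a \<in> A" for a f
  proof (rule clinear_on_A_eqI[OF _ _ _ _ _ that])
    have l: "clinear_on UNIV (assoc_ell2 :: (('g \<times> ('g \<Rightarrow> complex)) \<times> ('g \<Rightarrow> complex)) ell2 \<Rightarrow> _)"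
      by (simp add: clinear_on_def assoc_ell2_scaleC linear_add[OF bounded_linear.linear[OF bounded_linear_assoc_ell2]])
    have c: "continuous_on UNIV (assoc_ell2 :: (('g \<times> ('g \<Rightarrow> complex)) \<times> ('g \<Rightarrow> complex)) ell2 \<Rightarrow> _)"
      by (rule linear_continuous_on[OF bounded_linear_assoc_ell2])
    note l1 = clinear_on_comp[OF \<delta>_linear tensor_map_\<delta>_id_linear \<delta>_in]
      and c1 = continuous_on_comp[OF \<delta>_continuous tensor_map_\<delta>_id_continuous \<delta>_in]
    show "clinear_on A (\<lambda>a. assoc_ell2 (tensor_map A CG \<delta> id (\<delta> a) f))"
      by (rule clinear_on_comp[OF clinear_on_comp[OF l1 clinear_on_blinfun_apply[of UNIV]] l]) simp_all
    show "continuous_on A (\<lambda>a. assoc_ell2 (tensor_map A CG \<delta> id (\<delta> a) f))"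
      by (rule continuous_on_comp[OF continuous_on_comp[OF c1 continuous_on_blinfun_apply[of UNIV]] c]) simp_all
    show "clinear_on A (\<lambda>a. tensor_map A CG id dual_comult (\<delta> a) (assoc_ell2 f))"
      by (rule clinear_on_comp[OF clinear_on_comp[OF \<delta>_linear tensor_map_id_comult_linear \<delta>_in]
            clinear_on_blinfun_apply[of UNIV]]) simp_all
    show "continuous_on A (\<lambda>a. tensor_map A CG id dual_comult (\<delta> a) (assoc_ell2 f))"
      by (rule continuous_on_comp[OF continuous_on_comp[OF \<delta>_continuous tensor_map_id_comult_continuous \<delta>_in]
            continuous_on_blinfun_apply[of UNIV]]) simp_all
    show "assoc_ell2 (tensor_map A CG \<delta> id (\<delta> V) f) = tensor_map A CG id dual_comult (\<delta> V) (assoc_ell2 f)"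
      if V: "V \<in> monomials S" for V
      by (simp add: \<delta>_monomial[OF V] tensor_map_\<delta>_id_apply tensor_map_id_comult_apply monomial_in_A[OF V]
          char_op_in_CG dual_comult_char_op assoc_ell2_tensor_op clinear_monomial[OF V] clinear_char_op)
  qed
  then show ?thesis
    unfolding quantum_action_def unital_cstar_algebra_def
    using CG_quantum_semigroup cstar_A A_unit \<delta>_unital by blast
qed

text \<open>Applying \<open>\<delta> a\<close> to vectors with second factor
  \<open>ket \<alpha>\<close> is evaluation at \<alpha> of the corresponding A-valued
  function.\<close>

lemma \<delta>_slice:
  assumes \<alpha>: "\<alpha> \<in> dual_group" and a: "a \<in> A"
  shows "\<delta> a (f \<otimes>\<^sub>v ket \<alpha>) = \<tau> \<alpha> a f \<otimes>\<^sub>v ket \<alpha>"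
proof (rule clinear_on_A_eqI[OF _ _ _ _ _ a])
  show "clinear_on A (\<lambda>a. \<delta> a (f \<otimes>\<^sub>v ket \<alpha>))"
    by (rule clinear_on_comp[OF \<delta>_linear clinear_on_blinfun_apply[of UNIV]]) simp
  show "continuous_on A (\<lambda>a. \<delta> a (f \<otimes>\<^sub>v ket \<alpha>))"
    by (rule continuous_on_comp[OF \<delta>_continuous continuous_on_blinfun_apply[of UNIV]]) simp
  have "clinear_on A (\<lambda>a. \<tau> \<alpha> a f)"
    by (rule clinear_on_comp[OF \<tau>_linear[OF \<alpha>] clinear_on_blinfun_apply[of UNIV]]) simp
  then show "clinear_on A (\<lambda>a. \<tau> \<alpha> a f \<otimes>\<^sub>v ket \<alpha>)"
    by (simp add: clinear_on_def tensor_vec_add_left tensor_vec_scaleC_left)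
  have "continuous_on A (\<lambda>a. \<tau> \<alpha> a f)"
    by (rule continuous_on_comp[OF \<tau>_continuous[OF \<alpha>] continuous_on_blinfun_apply[of UNIV]]) simp
  then show "continuous_on A (\<lambda>a. \<tau> \<alpha> a f \<otimes>\<^sub>v ket \<alpha>)"
    by (rule bounded_linear.continuous_on[OF bounded_linear_tensor_vec_left])
  show "\<delta> V (f \<otimes>\<^sub>v ket \<alpha>) = \<tau> \<alpha> V f \<otimes>\<^sub>v ket \<alpha>" if V: "V \<in> monomials S" for V
    by (simp add: \<delta>_monomial[OF V] \<tau>_monomial[OF \<alpha> V] tensor_op_apply[OF clinear_monomial[OF V] clinear_char_op]
        char_op_ket \<alpha> tensor_vec_scaleC_left tensor_vec_scaleC_right)
qed

text \<open>All \<tau>(\<alpha>) are contractions, so the elements with norm-continuous orbit map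
  form a closed subspace. It contains the monomials, on which \<tau>(\<alpha>) is the scalar
  \<alpha>(ind V), continuous in \<alpha>.\<close>

lemma continuous_on_\<tau>:
  assumes "a \<in> A"
  shows "continuous_on dual_group (\<lambda>\<alpha>. \<tau> \<alpha> a)"
proof -
  let ?T = "{a \<in> A. continuous_on dual_group (\<lambda>\<alpha>. \<tau> \<alpha> a)}"
  have "closed ?T"
    unfolding closed_sequential_limits
  proof (intro allI impI, elim conjE)
    fix s a assume s: "\<forall>n. s n \<in> ?T" "s \<longlonglongrightarrow> a"
    have a: "a \<in> A" by (rule closed_sequentially[OF A_closed _ s(2)]) (use s(1) in simp)
    have "uniform_limit dual_group (\<lambda>n \<alpha>. \<tau> \<alpha> (s n)) (\<lambda>\<alpha>. \<tau> \<alpha> a) sequentially"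
    proof (rule uniform_limitI)
      fix e :: real assume "e > 0"
      then have "\<forall>\<^sub>F n in sequentially. dist (s n) a < e" using s(2) by (rule tendstoD[rotated])
      then show "\<forall>\<^sub>F n in sequentially. \<forall>\<alpha>\<in>dual_group. dist (\<tau> \<alpha> (s n)) (\<tau> \<alpha> a) < e"
      proof eventually_elim
        case (elim n)
        have sn: "s n \<in> A" using s(1) by simp
        have "dist (\<tau> \<alpha> (s n)) (\<tau> \<alpha> a) \<le> dist (s n) a" if "\<alpha> \<in> dual_group" for \<alpha>
          unfolding dist_norm clinear_on_diff[OF A_subspace \<tau>_linear[OF that] sn a, symmetric]
          by (rule norm_\<tau>_le[OF that complex_vs.subspace_diff[OF A_subspace sn a]])
        then show ?case using elim by (auto intro: le_less_trans)
      qed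
    qed
    then have "continuous_on dual_group (\<lambda>\<alpha>. \<tau> \<alpha> a)"
      by (rule uniform_limit_theorem[rotated]) (use s(1) in auto)
    then show "a \<in> ?T" using a by simp
  qed
  moreover have "complex_vs.subspace ?T"
  proof (rule complex_vs.subspaceI)
    have "continuous_on dual_group (\<lambda>\<alpha>. \<tau> \<alpha> 0) \<longleftrightarrow> continuous_on dual_group (\<lambda>_ :: 'g \<Rightarrow> complex. 0 :: 'g ell2 \<Rightarrow>\<^sub>L 'g ell2)"
      by (rule continuous_on_cong) (simp_all add: clinear_on_0[OF A_subspace \<tau>_linear])
    then show "0 \<in> ?T" by (simp add: complex_vs.subspace_0[OF A_subspace])
    fix x y c assume x: "x \<in> ?T"
    have "continuous_on dual_group (\<lambda>\<alpha>. \<tau> \<alpha> (c *\<^sub>C x)) \<longleftrightarrow> continuous_on dual_group (\<lambda>\<alpha>. c *\<^sub>C \<tau> \<alpha> x)"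
      by (rule continuous_on_cong) (use x in \<open>simp_all add: clinear_on_scaleC[OF \<tau>_linear]\<close>)
    then show "c *\<^sub>C x \<in> ?T"
      using x by (simp add: complex_vs.subspace_scale[OF A_subspace]
          bounded_linear.continuous_on[OF bounded_linear_scaleC_right])
    assume y: "y \<in> ?T"
    have "continuous_on dual_group (\<lambda>\<alpha>. \<tau> \<alpha> (x + y)) \<longleftrightarrow> continuous_on dual_group (\<lambda>\<alpha>. \<tau> \<alpha> x + \<tau> \<alpha> y)"
      by (rule continuous_on_cong) (use x y in \<open>simp_all add: clinear_on_add[OF \<tau>_linear]\<close>)
    then show "x + y \<in> ?T"
      using x y by (simp add: complex_vs.subspace_add[OF A_subspace] continuous_on_add)
  qed
  moreover have "monomials S \<subseteq> ?T"
  proof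
    fix V assume V: "V \<in> monomials S"
    have "continuous_on dual_group (\<lambda>\<alpha>. \<tau> \<alpha> V) \<longleftrightarrow> continuous_on dual_group (\<lambda>\<alpha> :: 'g \<Rightarrow> complex. \<alpha> (ind V) *\<^sub>C V)"
      by (rule continuous_on_cong) (simp_all add: \<tau>_monomial V)
    moreover have "bounded_linear (\<lambda>c. c *\<^sub>C V)"
      by (rule bounded_linear_intro[where K = "norm V"])
        (simp_all add: scaleC_add_left scaleR_scaleC scaleC_scaleC scaleC_complex_def norm_scaleC)
    ultimately show "V \<in> ?T"
      using monomial_in_A[OF V] bounded_linear.continuous_on[OF _ continuous_on_character] by auto
  qed
  ultimately have "closure (cspan (monomials S)) \<subseteq> ?T" by (intro closure_cspan_minimal)
  with assms show ?thesis unfolding reduced_cstar_eq by blast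
qed

lemma \<delta>_corresponds_to_\<tau>: "a \<in> A \<Longrightarrow> corresponds_to_function A dual_group (\<delta> a) (\<lambda>\<alpha>. \<tau> \<alpha> a)"
  unfolding corresponds_to_function_def
  using \<delta>_in continuous_on_\<tau> \<tau>_in \<delta>_slice by auto

section \<open>Fixed points, non-ergodicity and the quotient semigroup\<close>

lemma index_zero_algebra_eq: "index_zero_algebra S = closure (cspan D0)"
  unfolding index_zero_algebra_def ..

lemma index_zero_algebra_subset: "index_zero_algebra S \<subseteq> A"
  unfolding index_zero_algebra_eq
  by (rule closure_cspan_minimal) (auto simp: monomial_in_A A_subspace A_closed)

lemma D0_in_index_zero_algebra: "D0 \<subseteq> index_zero_algebra S"
  unfolding index_zero_algebra_eq by (rule subset_closure_cspan)

lemma separating_character: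
  fixes g :: 'g
  assumes "g \<noteq> 0"
  shows "\<exists>\<alpha>\<in>dual_group. \<alpha> g \<noteq> 1"
proof (rule characters_separate[of g])
  show "x = 0" if "n > 0" "(\<Sum>i<n. x) = 0" for n :: nat and x :: 'g
    by (rule torsion_free[OF that])
qed (use assms in blast)+

text \<open>
  The diagonal compression \<open>mult_op UNIV (symbol X)\<close> replaces averaging over \<open>G\<close>: it kills the
  monomials of non-zero index, and fixes every operator that is invariant under all \<open>\<tau> \<alpha>\<close>.
\<close>

lemma invariant_in_index_zero_algebra:
  assumes b: "b \<in> A" and inv: "\<And>\<alpha>. \<alpha> \<in> dual_group \<Longrightarrow> \<tau> \<alpha> b = b"
  shows "b \<in> index_zero_algebra S"
proof -
  let ?E = "\<lambda>X :: 'g ell2 \<Rightarrow>\<^sub>L 'g ell2. mult_op UNIV (symbol X)"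
  have E_ket: "?E X (ket k) = symbol X k *\<^sub>C ket k" for X k
    using mult_op_symbol_ket[of UNIV X "\<lambda>k. k" k] by simp
  have E_clinear: "clinear_op (?E X)" for X
    using clinear_mult_op_symbol[of UNIV X "\<lambda>k. k"] by simp
  have "?E b \<in> index_zero_algebra S"
    unfolding index_zero_algebra_eq
  proof (rule clinear_on_closure_cspan_in[where D = "monomials S" and F = ?E])
    show lin: "clinear_on (closure (cspan (monomials S))) ?E"
      by (simp add: clinear_on_def mult_op_symbol_add[where h = "\<lambda>k. k"] mult_op_symbol_scaleC[where h = "\<lambda>k. k"])
    show "continuous_on (closure (cspan (monomials S))) ?E"
      by (rule clinear_on_continuousI[OF subspace_closure_cspan lin, of 1])
        (use norm_mult_op_symbol_le[where h = "\<lambda>k. k"] in auto)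
    show "b \<in> closure (cspan (monomials S))" using b by (simp add: reduced_cstar_eq)
    fix V assume V: "V \<in> monomials S"
    note shift = shifts_by_cases[OF monomial_shifts_by_index[OF V]]
    show "?E V \<in> closure (cspan D0)"
    proof (cases "ind V = 0")
      case True
      have "?E V = V"
      proof (rule clinear_op_eqI[OF E_clinear clinear_monomial[OF V]])
        show "?E V (ket k) = V (ket k)" for k
          by (rule shift[of k]) (simp_all add: E_ket symbol_def True)
      qed
      then show ?thesis using V True subset_closure_cspan[of D0] by auto
    next
      case False
      have "?E V = 0"
      proof (rule clinear_op_eqI[OF E_clinear])
        show "?E V (ket k) = (0 :: 'g ell2 \<Rightarrow>\<^sub>L 'g ell2) (ket k)" for k
          by (rule shift[of k]) (simp_all add: E_ket symbol_def False)
      qed simp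
      then show ?thesis using complex_vs.subspace_0[OF subspace_closure_cspan] by simp
    qed
  qed simp_all
  moreover have "?E b = b"
  proof (rule clinear_op_eqI[OF E_clinear A_clinear[OF b]], rule ell2_eqI)
    fix y x
    show "Rep_ell2 (?E b (ket y)) x = Rep_ell2 (b (ket y)) x"
    proof (cases "x = y")
      case False
      then have "x - y \<noteq> 0" by simp
      then obtain \<alpha> where \<alpha>: "\<alpha> \<in> dual_group" "\<alpha> (x - y) \<noteq> 1"
        using separating_character by blast
      have "Rep_ell2 (b (ket y)) x = \<alpha> (x - y) * Rep_ell2 (b (ket y)) x"
        using Rep_\<tau>_ket[OF \<alpha>(1) b, of y x] inv[OF \<alpha>(1)] by simp
      then have "Rep_ell2 (b (ket y)) x = 0" using \<alpha>(2) by simp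
      then show ?thesis using False by (simp add: E_ket)
    qed (simp add: E_ket symbol_def)
  qed
  ultimately show ?thesis by simp
qed

text \<open>Sliced at \<open>ket \<alpha>\<close>, the fixed point equation becomes invariance under
  \<tau>(\<alpha>). Conversely the equation is linear and continuous in \<open>b\<close> and holds
  for monomials of index 0, whose character is constant.\<close>

lemma left_coset_space_eq: "left_coset_space A \<Delta> CG \<pi> = index_zero_algebra S"
  unfolding left_coset_space_def fixed_point_algebra_def unit_of_eq[OF CG_unit]
proof (intro equalityI subsetI)
  fix b assume "b \<in> {b \<in> A. \<delta> b = b \<otimes>\<^sub>o char_op 0}"
  then have b: "b \<in> A" "\<delta> b = b \<otimes>\<^sub>o char_op 0" by auto
  show "b \<in> index_zero_algebra S"
  proof (rule invariant_in_index_zero_algebra[OF b(1)], rule blinfun_eqI)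
    fix \<alpha> :: "'g \<Rightarrow> complex" and f assume \<alpha>: "\<alpha> \<in> dual_group"
    have "\<tau> \<alpha> b f \<otimes>\<^sub>v ket \<alpha> = (b \<otimes>\<^sub>o char_op 0) (f \<otimes>\<^sub>v ket \<alpha>)"
      using \<delta>_slice[OF \<alpha> b(1), of f] b(2) by simp
    also have "\<dots> = b f \<otimes>\<^sub>v ket \<alpha>"
      by (simp add: tensor_op_apply[OF A_clinear[OF b(1)] clinear_char_op] char_op_ket \<alpha>
          dual_groupD(3)[OF \<alpha>])
    finally show "\<tau> \<alpha> b f = b f" by (rule tensor_ket_right_cancel)
  qed
next
  fix b assume b: "b \<in> index_zero_algebra S"
  then have bA: "b \<in> A" using index_zero_algebra_subset by blast
  have sub: "closure (cspan D0) \<subseteq> A" using index_zero_algebra_subset index_zero_algebra_eq by simp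
  have lin: "clinear_on (closure (cspan D0)) (\<lambda>b. b \<otimes>\<^sub>o char_op (0 :: 'g))"
    unfolding clinear_on_def
    using sub A_clinear by (auto simp: tensor_op_add_left tensor_op_scaleC_left clinear_char_op subset_eq)
  have "\<delta> b = b \<otimes>\<^sub>o char_op 0"
  proof (rule clinear_on_closure_cspan_eqI[OF _ _ lin])
    show "clinear_on (closure (cspan D0)) \<delta>" by (rule clinear_on_subset[OF \<delta>_linear sub])
    show "continuous_on (closure (cspan D0)) \<delta>" by (rule continuous_on_subset[OF \<delta>_continuous sub])
    show "continuous_on (closure (cspan D0)) (\<lambda>b. b \<otimes>\<^sub>o char_op (0 :: 'g))"
    proof (rule clinear_on_continuousI[OF subspace_closure_cspan lin])
      show "norm (x \<otimes>\<^sub>o char_op (0 :: 'g)) \<le> norm (char_op (0 :: 'g)) * norm x"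
        if "x \<in> closure (cspan D0)" for x
        using norm_tensor_op_le[OF A_clinear[OF subsetD[OF sub that]] clinear_char_op, of 0]
        by (simp add: mult.commute)
    qed
  qed (use b index_zero_algebra_eq \<delta>_monomial in auto)
  with bA show "b \<in> {b \<in> A. \<delta> b = b \<otimes>\<^sub>o char_op 0}" by simp
qed

text \<open>The range projection of T_c with -c outside \<open>S\<close> has index 0, kills the
  basis vector at 0 and fixes the one at c, so it is no multiple of the unit. If \<open>S\<close> is
  the whole group, every monomial of index 0 is the identity and the fixed points are
  scalar.\<close>

lemma not_ergodic:
  assumes "S \<noteq> UNIV"
  shows "\<not> ergodic_action CG A \<delta>"
proof
  assume "ergodic_action CG A \<delta>"
  then have fixed: "index_zero_algebra S = range (\<lambda>c. c *\<^sub>C trans_op S 0)"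
    using left_coset_space_eq unit_of_eq[OF A_unit]
    by (simp add: ergodic_action_def left_coset_space_def)
  \<comment> \<open>A semigroup closed under negation would contain all differences of its elements,
    hence the whole group.\<close>
  obtain c where c: "c \<in> S" "- c \<notin> S"
  proof (rule ccontr)
    assume "\<not> thesis"
    then have neg: "- c \<in> S" if "c \<in> S" for c using that \<open>\<And>c. c \<in> S \<Longrightarrow> - c \<notin> S \<Longrightarrow> thesis\<close> by blast
    have "g \<in> S" for g
    proof -
      obtain a b where "a \<in> S" "b \<in> S" "g = a - b" using generates by blast
      then show ?thesis using add_in[OF _ neg, of a b] by simp
    qed
    with assms show False by blast
  qed
  define V where "V = trans_op S c o\<^sub>L adj (trans_op S c)"
  have T: "trans_op S c \<in> monomials S" and T': "adj (trans_op S c) \<in> monomials S"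
    by (rule monomials.trans[OF c(1)] monomials.adj_trans[OF c(1)])+
  have "V \<in> D0"
    using monomials.comp[OF T T'] monomial_index_compose[OF T T'] monomial_index_adj[OF T]
    by (simp add: V_def)
  then obtain k where k: "V = k *\<^sub>C trans_op S 0"
    using D0_in_index_zero_algebra fixed by blast
  have "V (ket 0) = 0" using c(2) by (simp add: V_def adj_trans_op_ket)
  then have "k *\<^sub>C ket (0 :: 'g) = 0" by (simp add: k trans_op_ket zero_in)
  then have "k = 0" by simp
  then have "V (ket c) = 0" by (simp add: k)
  moreover have "V (ket c) = ket c" by (simp add: V_def adj_trans_op_ket trans_op_ket zero_in)
  ultimately show False by simp
qed

lemma index_zero_algebra_commutative: "commutative_algebra (index_zero_algebra S)"
  unfolding commutative_algebra_def
proof (intro ballI)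
  fix a b assume a: "a \<in> index_zero_algebra S" and b: "b \<in> index_zero_algebra S"
  have clin: "clinear_op x" if "x \<in> index_zero_algebra S" for x
    using that index_zero_algebra_subset A_clinear by blast
  have 1: "x o\<^sub>L V = V o\<^sub>L x" if "V \<in> D0" "x \<in> index_zero_algebra S" for V x
    by (rule clinear_on_closure_cspan_eqI[OF clinear_on_compose_right continuous_on_compose_right
          clinear_on_compose_left continuous_on_compose_left _ that(2)[unfolded index_zero_algebra_eq]])
      (use that in \<open>auto intro: index_zero_compose_commute clinear_monomial\<close>)
  show "a o\<^sub>L b = b o\<^sub>L a"
    by (rule clinear_on_closure_cspan_eqI[OF clinear_on_compose_left[OF clin[OF a]] continuous_on_compose_left
          clinear_on_compose_right continuous_on_compose_right _ b[unfolded index_zero_algebra_eq]])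
      (rule 1[OF _ a])
qed

text \<open>Additivity of the index makes the monomials of index 0 a self-adjoint multiplicative set
  containing the unit. The laws are checked afresh, because functionals and their tensor products
  now refer to the smaller algebra; the counit is restricted from \<open>A\<close>.\<close>

lemma index_zero_quantum_semigroup:
  "classical_compact_quantum_semigroup (index_zero_algebra S) (restrict \<Delta> (index_zero_algebra S))"
proof -
  let ?A0 = "index_zero_algebra S"
  have "compact_quantum_semigroup ?A0 (restrict \<Delta> ?A0)"
  proof (rule compact_quantum_semigroup_of_group_like[where D = D0 and u = "trans_op S 0"
        and \<epsilon> = "\<lambda>a. symbol (\<pi> a) (\<lambda>_. 1)"])
    show "clinear_on ?A0 (restrict \<Delta> ?A0)"
      using clinear_on_subset[OF \<Delta>_linear index_zero_algebra_subset]
        complex_vs.subspace_add[of ?A0] complex_vs.subspace_scale[of ?A0]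
      by (simp add: clinear_on_def index_zero_algebra_eq)
    show "continuous_on ?A0 (restrict \<Delta> ?A0)"
      using continuous_on_subset[OF \<Delta>_continuous index_zero_algebra_subset]
      by (simp cong: continuous_on_cong)
    show "(\<lambda>a. symbol (\<pi> a) (\<lambda>_. 1)) \<in> dual_space ?A0"
      using counit_in_dual_space[of "\<lambda>_. 1"] index_zero_algebra_subset
      by (auto simp: dual_space_def intro: clinear_on_subset continuous_on_subset)
    show "restrict \<Delta> ?A0 d = d \<otimes>\<^sub>o d" if "d \<in> D0" for d
      using that D0_in_index_zero_algebra \<Delta>_monomial by auto
  qed (use trans_op_0_monomial in \<open>auto simp: index_zero_algebra_eq clinear_monomial adj_monomial
      monomial_index_adj monomial_index_compose monomial_index_trans zero_in trans_op_0_compose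
      counit_monomial intro: monomials.comp\<close>)
  then show ?thesis
    unfolding classical_compact_quantum_semigroup_def using index_zero_algebra_commutative by blast
qed

end

theorem proposition2:
  fixes S :: "'g::ab_group_add set"
    and \<Delta> :: "('g ell2 \<Rightarrow>\<^sub>L 'g ell2) \<Rightarrow> (('g \<times> 'g) ell2 \<Rightarrow>\<^sub>L ('g \<times> 'g) ell2)"
    and \<pi> :: "('g ell2 \<Rightarrow>\<^sub>L 'g ell2) \<Rightarrow> (('g \<Rightarrow> complex) ell2 \<Rightarrow>\<^sub>L ('g \<Rightarrow> complex) ell2)"
    and \<tau> :: "('g \<Rightarrow> complex) \<Rightarrow> ('g ell2 \<Rightarrow>\<^sub>L 'g ell2) \<Rightarrow> ('g ell2 \<Rightarrow>\<^sub>L 'g ell2)"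
  assumes torsion_free: "\<And>(n::nat) (x::'g). n > 0 \<Longrightarrow> (\<Sum>i<n. x) = 0 \<Longrightarrow> x = 0"
    and S_zero: "0 \<in> S"
    and S_add: "\<And>a b. a \<in> S \<Longrightarrow> b \<in> S \<Longrightarrow> a + b \<in> S"
    and S_generates: "\<And>g. \<exists>a\<in>S. \<exists>b\<in>S. g = a - b"
    and \<Delta>_range: "\<Delta> ` reduced_cstar S \<subseteq> reduced_cstar S \<otimes>\<^sub>m reduced_cstar S"
    and \<Delta>_linear: "clinear_on (reduced_cstar S) \<Delta>"
    and \<Delta>_continuous: "continuous_on (reduced_cstar S) \<Delta>"
    and \<Delta>_monomial: "\<And>V. V \<in> monomials S \<Longrightarrow> \<Delta> V = V \<otimes>\<^sub>o V"
    and \<pi>_hom: "star_hom (reduced_cstar S) (cont_algebra dual_group) \<pi>"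
    and \<pi>_surj: "\<pi> ` reduced_cstar S = cont_algebra dual_group"
    and \<pi>_trans: "\<And>a. a \<in> S \<Longrightarrow> \<pi> (trans_op S a) = mult_op dual_group (\<lambda>\<alpha>. \<alpha> a)"
    and \<tau>_aut: "\<And>\<alpha>. \<alpha> \<in> dual_group \<Longrightarrow> star_automorphism (reduced_cstar S) (\<tau> \<alpha>)"
    and \<tau>_trans: "\<And>\<alpha> a. \<alpha> \<in> dual_group \<Longrightarrow> a \<in> S \<Longrightarrow> \<tau> \<alpha> (trans_op S a) = \<alpha> a *\<^sub>C trans_op S a"
  shows "let A = reduced_cstar S; CG = cont_algebra dual_group; A0 = index_zero_algebra S;
             \<delta> = natural_action A \<Delta> \<pi>
         in compact_quantum_subsemigroup A \<Delta> CG dual_comult \<pi> \<and>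
            quantum_action CG dual_comult A \<delta> \<and>
            (S \<noteq> UNIV \<longrightarrow> \<not> ergodic_action CG A \<delta>) \<and>
            (\<forall>a\<in>A. corresponds_to_function A dual_group (\<delta> a) (\<lambda>\<alpha>. \<tau> \<alpha> a)) \<and>
            left_coset_space A \<Delta> CG \<pi> = A0 \<and>
            left_quotient_space A \<Delta> CG \<pi> = (A0, restrict \<Delta> A0) \<and>
            classical_compact_quantum_semigroup A0 (restrict \<Delta> A0)"
proof -
  interpret semigroup_action S \<Delta> \<pi> \<tau>
    by (unfold_locales; (fact assms)?) (use \<tau>_aut in \<open>simp add: star_automorphism_def\<close>)
  show ?thesis
    unfolding Let_def left_quotient_space_def left_coset_space_eq
    using quantum_subsemigroup \<delta>_quantum_action not_ergodic \<delta>_corresponds_to_\<tau>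
      index_zero_quantum_semigroup
    by blast
qed

end
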